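(* Consider the TASEP on $\mathbb Z$ with the step initial condition, and for $t>0$ let $P_t$ be the total number of jumps made by all particles up to time $t$. Then $$\lim_{t\to\infty}\frac{\mathbb E\,P_t}{t^2}=\frac16 .$$
   Context: TASEP (totally asymmetric simple exclusion process) on $\mathbb Z$ with the step initial condition: at time $0$ there is exactly one particle at each of the sites $0,-1,-2,\dots$ and the sites $1,2,3,\dots$ are empty. At any time each site holds at most one particle. Each particle waits an Exponential(1) time (its clock) and then, if the site immediately to its right is empty, jumps to that site; if that site is occupied, the particle does not move; in either case its clock then restarts. All clocks (successive clocks of the same particle and clocks of different particles) are mutually independent. Equivalently, particles are numbered $r=1,2,\dots$ from right to left (particle $r$ starts at site $1-r$), particle $r$ carries a rate-1 Poisson process of clock rings, these Poisson processes are independent for different $r$, and at each ring of its clock particle $r$ moves one step right if and only if the site to its right is not occupied (for $r\ge 2$, not occupied by particle $r-1$; particle $1$ is never blocked). Let $N_t^{(r)}$ be the number of jumps (actual moves) of particle $r$ in the time interval $[0,t]$. The total number of jumps up to time $t$ is $P_t=\sum_{r\ge1}N_t^{(r)}$. Equivalently, if $X(k,t)$ is the indicator that site $k$ is occupied at time $t$ and $S(k,t)=\sum_{i>k}X(i,t)$, then $P_t=\sum_{k\in\mathbb Z}\bigl(S(k,t)-S(k,0)\bigr)$. *)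

theory Defs
  imports "HOL-Probability.Probability"
begin

text \<open>
  Particles are numbered from right to left by \<open>r = 0, 1, 2, \<dots>\<close>, so particle \<open>r\<close> starts at
  site \<open>-r\<close> (step initial condition), particle \<open>0\<close> is never blocked, and particle \<open>r + 1\<close> can
  only be blocked by particle \<open>r\<close>. A path of the process is determined by the waiting times:
  \<open>w r n\<close> is the time between the \<open>n\<close>-th and the \<open>(n + 1)\<close>-st ring of the clock of particle \<open>r\<close>
  (between time \<open>0\<close> and the first ring if \<open>n = 0\<close>).
\<close>

type_synonym waits = "nat \<Rightarrow> nat \<Rightarrow> real"

text \<open>Rings of a clock are counted from \<open>0\<close>: \<open>ring_time w r 0\<close> is the time of the first ring.\<close>

definition ring_time :: "waits \<Rightarrow> nat \<Rightarrow> nat \<Rightarrow> real" where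
  "ring_time w r n = (\<Sum>i\<le>n. w r i)"

text \<open>
  With probability one only finitely many rings occur in bounded time; on the remaining
  null set \<open>card\<close> may return the meaningless value \<open>0\<close>.
\<close>

definition rings_upto :: "waits \<Rightarrow> nat \<Rightarrow> real \<Rightarrow> nat" where
  "rings_upto w r t = card {n. ring_time w r n \<le> t}"

definition rings_before :: "waits \<Rightarrow> nat \<Rightarrow> real \<Rightarrow> nat" where
  "rings_before w r t = card {n. ring_time w r n < t}"

definition site_after :: "nat \<Rightarrow> nat \<Rightarrow> int" where
  "site_after r j = - int r + int j"

text \<open>
  \<open>moves w r n\<close> is the number of actual moves of particle \<open>r\<close> at its first \<open>n\<close> rings. When particle
  \<open>r + 1\<close> rings at time \<open>s\<close>, it stays put iff the site to its right is occupied by particle \<open>r\<close>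
  immediately before \<open>s\<close>.
\<close>

fun moves :: "waits \<Rightarrow> nat \<Rightarrow> nat \<Rightarrow> nat" where
  "moves w r 0 = 0"
| "moves w 0 (Suc n) = Suc (moves w 0 n)"
| "moves w (Suc r) (Suc n) =
     (let j = moves w (Suc r) n; s = ring_time w (Suc r) n
      in if site_after (Suc r) j + 1 = site_after r (moves w r (rings_before w r s))
         then j else Suc j)"

definition jumps :: "waits \<Rightarrow> nat \<Rightarrow> real \<Rightarrow> nat" where
  "jumps w r t = moves w r (rings_upto w r t)"

definition total_jumps :: "waits \<Rightarrow> real \<Rightarrow> ennreal" where
  "total_jumps w t = (\<Sum>r. of_nat (jumps w r t))"

end

theory Submission imports Defs begin

text \<open>
  Particle \<open>r\<close> is server \<open>r\<close> in a tandem of queues in which server \<open>0\<close> always has customers, and the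
  number of moves satisfies the min-plus recursion \<open>N (r+1) (k+1) = min (N (r+1) k + S) (N r k)\<close> once
  time is cut into cells so fine that distinct rings fall into distinct cells. The cell indicators are
  independent Bernoulli variables, and for the discrete system with Bernoulli arrivals of intensity
  \<open>\<alpha>\<close> a discrete Burke theorem gives a product-form stationary law with mean queue length about
  \<open>\<alpha> / (1 - \<alpha>)\<close>.

  Comparing with the stationary system yields \<open>N r t \<ge> \<alpha> t - r \<alpha> / (1 - \<alpha>)\<close> up to \<open>O(\<surd>t)\<close>, whose
  maximum over \<open>\<alpha>\<close>, attained at \<open>1 - \<alpha> = \<surd>(r/t)\<close>, is \<open>(\<surd>t - \<surd>r)\<^sup>2\<close>. For the opposite bound the
  stationary system is a minimum over exit points from its boundary. At the maximising \<open>\<alpha>\<close>, comparison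
  with the systems of intensities \<open>\<alpha> \<plusminus> \<epsilon>\<close> shows that exits far from the corner are too expensive, and
  an exit near the corner costs about \<open>N r t + r \<alpha> / (1 - \<alpha>)\<close>. Hence
  \<open>E N \<lfloor>x t\<rfloor> t / t \<rightarrow> (1 - \<surd>x)\<^sup>2\<close> for \<open>0 < x < 1\<close>, and dominated convergence gives
  \<open>\<integral>\<^sub>0\<^sup>1 (1 - \<surd>x)\<^sup>2 dx = 1/6\<close>.
\<close>

section \<open>A discrete Burke theorem\<close>

text \<open>In discrete time the product form is checked by comparing point masses cell by cell.
  Conservation of customers writes a height as the arrivals minus the final queues; both sums have
  explicit laws, so the mean of a height is known exactly, and second moments bound its fluctuations
  by order \<open>sqrt t\<close>, which vanishes after division by \<open>t\<close>.

  The obstacle is the upper bound, since the particle count enters only one branch of the minimum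
  that forms the stationary system. Call an exit far if it lies beyond a fraction
  \<open>\<delta>\<close> of its axis. At the maximiser \<alpha> of the mean height, changing the
  intensity by \<open>e\<close> loses only order \<open>e^2 * t\<close>, whereas the offset that the
  comparison earns on the boundary before a far exit is of order \<open>e * \<delta> * t\<close>.
  With \<open>e\<close> a small multiple of \<open>\<delta>\<close> the comparison therefore has a
  positive drift, and Chebyshev's inequality makes far exits improbable. A near exit costs order
  \<open>\<delta> * t\<close>, and \<open>\<delta>\<close> can be fixed as small as desired before
  \<open>t\<close> grows.\<close>

text \<open>The law with tails \<open>P (X > x) = c * s ^ x\<close>.\<close>

definition mgeo :: "real \<Rightarrow> real \<Rightarrow> nat pmf" where
  "mgeo c s = bernoulli_pmf c \<bind> (\<lambda>b. if b then map_pmf Suc (geometric_pmf (1 - s)) else return_pmf 0)"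

lemma pmf_mgeo_0: "0 \<le> c \<Longrightarrow> c \<le> 1 \<Longrightarrow> pmf (mgeo c s) 0 = 1 - c"
  by (simp add: mgeo_def pmf_bind pmf_map_outside)

lemma pmf_mgeo_Suc:
  "0 \<le> c \<Longrightarrow> c \<le> 1 \<Longrightarrow> 0 \<le> s \<Longrightarrow> s < 1 \<Longrightarrow> pmf (mgeo c s) (Suc x) = c * (1 - s) * s ^ x"
  by (simp add: mgeo_def pmf_bind pmf_map_inj')

text \<open>The quotient of the up probability \<open>\<alpha> * p * (1 - p)\<close> and the down
  probability \<open>p * (1 - \<alpha> * p)\<close> of a nonempty queue with arrival probability
  \<open>\<alpha> * p\<close> and service probability \<open>p\<close> per cell. An empty queue
  wastes its service and goes up with probability \<open>\<alpha> * p\<close>, whence the separate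
  atom at \<open>0\<close> in the stationary law.\<close>

definition queue_ratio :: "real \<Rightarrow> real \<Rightarrow> real" where
  "queue_ratio p \<alpha> = \<alpha> * (1 - p) / (1 - \<alpha> * p)"

definition stat_queue :: "real \<Rightarrow> real \<Rightarrow> nat pmf" where
  "stat_queue p \<alpha> = mgeo \<alpha> (queue_ratio p \<alpha>)"

lemma one_minus_queue_ratio:
  assumes "0 < p" "p < 1" "0 < \<alpha>" "\<alpha> < 1"
  shows "1 - queue_ratio p \<alpha> = (1 - \<alpha>) / (1 - \<alpha> * p)" and "\<alpha> * p < 1"
proof -
  show "\<alpha> * p < 1" using assms mult_strict_mono[of \<alpha> 1 p 1] by simp
  then show "1 - queue_ratio p \<alpha> = (1 - \<alpha>) / (1 - \<alpha> * p)"
    by (simp add: queue_ratio_def divide_simps) (simp add: algebra_simps)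
qed

lemma queue_ratio_bounds:
  assumes "0 < p" "p < 1" "0 < \<alpha>" "\<alpha> < 1"
  shows "0 < queue_ratio p \<alpha>" "queue_ratio p \<alpha> < 1"
proof -
  note q = one_minus_queue_ratio[OF assms]
  show "0 < queue_ratio p \<alpha>" using assms q(2) by (simp add: queue_ratio_def)
  have "0 < 1 - queue_ratio p \<alpha>" using q assms by simp
  then show "queue_ratio p \<alpha> < 1" by simp
qed

text \<open>A queue changes by at most one, so each point mass on the left is a sum over at most
  three predecessors, which the balance equations \<open>b0\<close> and \<open>bS\<close> turn into
  the product. The departure is decided by the queue before the arrival, so a customer cannot leave
  in the cell in which it arrives.\<close>

lemma burke_step:
  assumes "0 < p" "p < 1" "0 < \<alpha>" "\<alpha> < 1"
  shows "do {q \<leftarrow> stat_queue p \<alpha>; x \<leftarrow> bernoulli_pmf (\<alpha> * p); y \<leftarrow> bernoulli_pmf p;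
             return_pmf (q + of_bool x - of_bool (y \<and> 0 < q), y \<and> 0 < q)}
       = pair_pmf (stat_queue p \<alpha>) (bernoulli_pmf (\<alpha> * p))" (is "?L = ?R")
proof (rule pmf_eqI)
  fix nd :: "nat \<times> bool"
  obtain n d where nd: "nd = (n, d)" by (cases nd)
  let ?a = "\<alpha> * p" and ?s = "queue_ratio p \<alpha>"
  let ?pi = "pmf (stat_queue p \<alpha>)"
  note q = one_minus_queue_ratio[OF assms] and s = queue_ratio_bounds[OF assms]
  have a: "0 < ?a" "?a < 1" using assms q by auto
  have pi0: "?pi 0 = 1 - \<alpha>" and piS: "?pi (Suc x) = \<alpha> * (1 - ?s) * ?s ^ x" for x
    using assms s by (auto simp: stat_queue_def pmf_mgeo_0 pmf_mgeo_Suc)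
  have b0: "?pi (Suc 0) * p * (1 - ?a) = ?pi 0 * ?a"
    using q by (simp add: pi0 piS divide_simps)
  have bS: "?pi (Suc (Suc x)) * p * (1 - ?a) = ?pi (Suc x) * ?a * (1 - p)" for x
  proof -
    have "?s * (1 - ?a) = \<alpha> * (1 - p)" using q(2) by (simp add: queue_ratio_def)
    then have "\<alpha> * (1 - ?s) * ?s ^ x * p * (?s * (1 - ?a)) = \<alpha> * (1 - ?s) * ?s ^ x * p * (\<alpha> * (1 - p))"
      by simp
    then show ?thesis by (simp add: piS algebra_simps)
  qed
  define h where "h q = (\<integral>x. \<integral>y. pmf (return_pmf (q + of_bool x - of_bool (y \<and> 0 < q), y \<and> 0 < q)) (n, d)
     \<partial>bernoulli_pmf p \<partial>bernoulli_pmf ?a)" for q :: nat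
  have h: "h q = ?a * (p * of_bool (q + 1 - of_bool (0 < q) = n \<and> (0 < q) = d) + (1 - p) * of_bool (q + 1 = n \<and> \<not> d))
     + (1 - ?a) * (p * of_bool (q - of_bool (0 < q) = n \<and> (0 < q) = d) + (1 - p) * of_bool (q = n \<and> \<not> d))" for q
    using assms a by (simp add: h_def indicator_def)
  have "pmf ?L nd = (\<integral>q. h q \<partial>stat_queue p \<alpha>)"
    unfolding nd h_def by (simp only: pmf_bind)
  also have "\<dots> = (\<Sum>q\<in>{n - 1, n, Suc n}. h q * ?pi q)"
  proof (rule integral_measure_pmf_real)
    have "h q = 0" if "q \<notin> {n - 1, n, Suc n}" for q
      using that by (cases q) (auto simp: h)
    then show "q \<in> {n - 1, n, Suc n}" if "h q \<noteq> 0" for q using that by blast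
  qed simp
  also have "\<dots> = ?pi n * pmf (bernoulli_pmf ?a) d"
  proof (cases n)
    case 0
    then show ?thesis using a b0 by (cases d) (auto simp: h algebra_simps)
  next
    case (Suc m)
    show ?thesis
    proof (cases m)
      case 0
      then show ?thesis using a Suc b0 bS[of 0] by (cases d) (auto simp: h algebra_simps)
    next
      case (Suc k)
      then show ?thesis using a \<open>n = Suc m\<close> bS[of k] bS[of m] by (cases d) (auto simp: h algebra_simps)
    qed
  qed
  also have "\<dots> = pmf ?R nd" by (simp add: nd pmf_pair)
  finally show "pmf ?L nd = pmf ?R nd" .
qed

section \<open>Burke's theorem over many cells and for queues in series\<close>

fun queue :: "nat \<Rightarrow> bool list \<Rightarrow> bool list \<Rightarrow> nat \<times> bool list" where
  "queue q (a # as) (s # ss) =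
     (let d = (s \<and> 0 < q); (r, ds) = queue (q + of_bool a - of_bool d) as ss in (r, d # ds))"
| "queue q _ _ = (q, [])"

lemma length_queue: "length (snd (queue q as ss)) = min (length as) (length ss)"
  by (induction q as ss rule: queue.induct) (auto simp: Let_def split: prod.splits)

text \<open>After the first cell the queue is again stationary and independent of the departure just
  made, so the remaining cells repeat the same situation with that departure set aside as the head
  of the list.\<close>

lemma burke:
  assumes "0 < p" "p < 1" "0 < \<alpha>" "\<alpha> < 1"
  shows "do {q \<leftarrow> stat_queue p \<alpha>; as \<leftarrow> replicate_pmf K (bernoulli_pmf (\<alpha> * p));
             ss \<leftarrow> replicate_pmf K (bernoulli_pmf p); return_pmf (queue q as ss)}
       = pair_pmf (stat_queue p \<alpha>) (replicate_pmf K (bernoulli_pmf (\<alpha> * p)))" (is "?L K = _")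
proof (induction K)
  case 0
  show ?case by (simp add: pair_pmf_def bind_return_pmf)
next
  case (Suc K)
  let ?A = "bernoulli_pmf (\<alpha> * p)" and ?B = "bernoulli_pmf p" and ?G = "stat_queue p \<alpha>"
  let ?As = "replicate_pmf K ?A" and ?Ss = "replicate_pmf K ?B"
  have "?L (Suc K) = do {q \<leftarrow> ?G; a \<leftarrow> ?A; as \<leftarrow> ?As; s \<leftarrow> ?B; ss \<leftarrow> ?Ss; return_pmf (queue q (a # as) (s # ss))}"
    by (simp add: bind_assoc_pmf bind_return_pmf)
  also have "\<dots> = do {q \<leftarrow> ?G; a \<leftarrow> ?A; s \<leftarrow> ?B; as \<leftarrow> ?As; ss \<leftarrow> ?Ss; return_pmf (queue q (a # as) (s # ss))}"
    by (subst bind_commute_pmf[of ?As ?B]) (rule refl)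
  also have "\<dots> = do {(q, d) \<leftarrow> do {q \<leftarrow> ?G; a \<leftarrow> ?A; s \<leftarrow> ?B;
             return_pmf (q + of_bool a - of_bool (s \<and> 0 < q), s \<and> 0 < q)};
           as \<leftarrow> ?As; ss \<leftarrow> ?Ss; return_pmf (apsnd ((#) d) (queue q as ss))}"
    by (simp add: bind_assoc_pmf bind_return_pmf Let_def case_prod_beta apsnd_def map_prod_def)
  also have "\<dots> = do {(q, d) \<leftarrow> pair_pmf ?G ?A;
           as \<leftarrow> ?As; ss \<leftarrow> ?Ss; return_pmf (apsnd ((#) d) (queue q as ss))}"
    by (simp only: burke_step[OF assms])
  also have "\<dots> = do {d \<leftarrow> ?A; map_pmf (apsnd ((#) d)) (?L K)}"
    by (simp add: pair_pmf_def bind_assoc_pmf bind_return_pmf map_bind_pmf)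
       (subst bind_commute_pmf, rule refl)
  also have "\<dots> = pair_pmf ?G (replicate_pmf (Suc K) ?A)"
    unfolding Suc.IH
    by (simp add: pair_pmf_def bind_assoc_pmf bind_return_pmf map_bind_pmf)
       (subst bind_commute_pmf, rule refl)
  finally show ?case .
qed

fun tandem :: "bool list \<Rightarrow> (nat \<times> bool list) list \<Rightarrow> nat list" where
  "tandem as [] = []"
| "tandem as ((q, ss) # rs) = (let (r, ds) = queue q as ss in r # tandem ds rs)"

text \<open>By \<open>burke\<close> the departures of a server have the law of its arrivals and are
  independent of its final queue. The next server thus sees the same kind of input, and its final
  queue is independent of the earlier ones.\<close>

lemma tandem_stationary:
  assumes "0 < p" "p < 1" "0 < \<alpha>" "\<alpha> < 1"
  shows "do {as \<leftarrow> replicate_pmf K (bernoulli_pmf (\<alpha> * p));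
             rs \<leftarrow> replicate_pmf R (pair_pmf (stat_queue p \<alpha>) (replicate_pmf K (bernoulli_pmf p)));
             return_pmf (tandem as rs)}
       = replicate_pmf R (stat_queue p \<alpha>)" (is "?L R = _")
proof (induction R)
  case 0
  show ?case by (simp add: bind_return_pmf)
next
  case (Suc R)
  let ?A = "replicate_pmf K (bernoulli_pmf (\<alpha> * p))" and ?S = "replicate_pmf K (bernoulli_pmf p)"
  let ?G = "stat_queue p \<alpha>"
  let ?Rs = "replicate_pmf R (pair_pmf ?G ?S)"
  have "?L (Suc R) = do {as \<leftarrow> ?A; q \<leftarrow> ?G; ss \<leftarrow> ?S; rs \<leftarrow> ?Rs; return_pmf (tandem as ((q, ss) # rs))}"
    by (simp add: bind_assoc_pmf bind_return_pmf pair_pmf_def)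
  also have "\<dots> = do {(r, ds) \<leftarrow> do {q \<leftarrow> ?G; as \<leftarrow> ?A; ss \<leftarrow> ?S; return_pmf (queue q as ss)};
        rs \<leftarrow> ?Rs; return_pmf (r # tandem ds rs)}"
    by (simp add: bind_assoc_pmf bind_return_pmf Let_def case_prod_beta)
       (subst bind_commute_pmf, rule refl)
  also have "\<dots> = do {(r, ds) \<leftarrow> pair_pmf ?G ?A; rs \<leftarrow> ?Rs; return_pmf (r # tandem ds rs)}"
    by (simp only: burke[OF assms])
  also have "\<dots> = do {r \<leftarrow> ?G; map_pmf ((#) r) (?L R)}"
    by (simp add: pair_pmf_def bind_assoc_pmf bind_return_pmf map_bind_pmf)
  also have "\<dots> = replicate_pmf (Suc R) ?G"
    unfolding Suc.IH by (simp add: map_pmf_def)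
  finally show ?case .
qed

text \<open>The free offset \<open>c\<close> makes the notion stable under independent sums, with no integrability side conditions.\<close>

definition centered :: "'a pmf \<Rightarrow> ('a \<Rightarrow> real) \<Rightarrow> real \<Rightarrow> real \<Rightarrow> bool" where
  "centered P f \<mu> v \<longleftrightarrow> 0 \<le> v \<and>
     (\<forall>c. (\<integral>\<^sup>+x. ennreal ((f x - \<mu> + c)\<^sup>2) \<partial>P) \<le> ennreal (v + c\<^sup>2))"

lemma centered_mono: "centered P f \<mu> v \<Longrightarrow> v \<le> w \<Longrightarrow> centered P f \<mu> w"
  unfolding centered_def by (meson add_right_mono ennreal_leI order_trans)

text \<open>The first summand is absorbed into the offset \<open>c\<close> of the remaining ones, so
  the bounds add without any cross term being computed.\<close>

lemma centered_sum_list: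
  assumes "centered P f \<mu> v"
  shows "centered (replicate_pmf n P) (\<lambda>xs. \<Sum>x\<leftarrow>xs. f x) (real n * \<mu>) (real n * v)"
proof (induction n)
  case 0
  show ?case by (simp add: centered_def)
next
  case (Suc n)
  have v: "0 \<le> v" using assms by (simp add: centered_def)
  show ?case
    unfolding centered_def
  proof (intro conjI allI)
    show "0 \<le> real (Suc n) * v" using v by simp
    fix c
    have "(\<integral>\<^sup>+xs. ennreal (((\<Sum>x\<leftarrow>xs. f x) - real (Suc n) * \<mu> + c)\<^sup>2) \<partial>replicate_pmf (Suc n) P)
       = (\<integral>\<^sup>+x. \<integral>\<^sup>+xs. ennreal (((\<Sum>x\<leftarrow>xs. f x) - real n * \<mu> + (f x - \<mu> + c))\<^sup>2) \<partial>replicate_pmf n P \<partial>P)"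
      by (simp add: algebra_simps)
    also have "\<dots> \<le> (\<integral>\<^sup>+x. ennreal (real n * v + (f x - \<mu> + c)\<^sup>2) \<partial>P)"
      using Suc.IH by (intro nn_integral_mono) (auto simp: centered_def simp del: ennreal_plus)
    also have "\<dots> = ennreal (real n * v) + (\<integral>\<^sup>+x. ennreal ((f x - \<mu> + c)\<^sup>2) \<partial>P)"
      using v by (simp add: nn_integral_add measure_pmf.emeasure_space_1)
    also have "\<dots> \<le> ennreal (real n * v) + ennreal (v + c\<^sup>2)"
      using assms by (intro add_left_mono) (auto simp: centered_def simp del: ennreal_plus)
    also have "\<dots> = ennreal (real (Suc n) * v + c\<^sup>2)"
      using v by (simp add: ennreal_plus[symmetric] algebra_simps del: ennreal_plus)
    finally show "(\<integral>\<^sup>+xs. ennreal (((\<Sum>x\<leftarrow>xs. f x) - real (Suc n) * \<mu> + c)\<^sup>2) \<partial>replicate_pmf (Suc n) P)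
       \<le> ennreal (real (Suc n) * v + c\<^sup>2)" .
  qed
qed

lemma centered_bernoulli:
  assumes "0 \<le> p" "p \<le> 1"
  shows "centered (bernoulli_pmf p) of_bool p p"
  unfolding centered_def
proof (intro conjI allI)
  fix c :: real
  have "(\<integral>\<^sup>+x. ennreal ((of_bool x - p + c)\<^sup>2) \<partial>bernoulli_pmf p)
     = ennreal ((1 - p + c)\<^sup>2 * p + (- p + c)\<^sup>2 * (1 - p))"
    using assms by (simp add: ennreal_plus[symmetric] ennreal_mult[symmetric] del: ennreal_plus)
  also have "(1 - p + c)\<^sup>2 * p + (- p + c)\<^sup>2 * (1 - p) = p * (1 - p) + c\<^sup>2"
    by (simp add: power2_eq_square algebra_simps)
  also have "ennreal (p * (1 - p) + c\<^sup>2) \<le> ennreal (p + c\<^sup>2)"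
    using assms by (intro ennreal_leI) (simp add: mult_left_le)
  finally show "(\<integral>\<^sup>+x. ennreal ((of_bool x - p + c)\<^sup>2) \<partial>bernoulli_pmf p) \<le> ennreal (p + c\<^sup>2)" .
qed (use assms in auto)

section \<open>Moments, tails and minima of the modified geometric law\<close>

lemma sums_rising_power:
  fixes s :: real
  assumes "\<bar>s\<bar> < 1"
  shows "(\<lambda>n. real (Suc n) * real (Suc (Suc n)) * s ^ n) sums (2 / (1 - s) ^ 3)"
proof -
  let ?f = "\<lambda>n. real (Suc n) * real (Suc (Suc n)) * s ^ n"
  have g: "(\<lambda>n. real (Suc n) * x ^ n) sums (1 / (1 - x)\<^sup>2)" if "norm x < 1" for x :: real
    using geometric_deriv_sums[OF that] by simp
  have "summable (\<lambda>n. diffs (\<lambda>n. real (Suc n)) n * s ^ n)"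
    by (rule termdiff_converges[of s 1]) (use assms g in \<open>auto intro: sums_summable\<close>)
  then have "summable ?f" by (simp add: diffs_def)
  then obtain S where S: "?f sums S" by (auto simp: summable_def)
  \<comment> \<open>Subtracting \<open>s\<close> times the series telescopes the coefficients:
    \<open>(n + 1) * (n + 2) - n * (n + 1) = 2 * (n + 1)\<close> leaves twice the differentiated
    geometric series.\<close>
  have "(\<lambda>n. case n of 0 \<Rightarrow> 0 | Suc n \<Rightarrow> s * ?f n) sums (s * S)"
    using sums_Suc[of "\<lambda>n. case n of 0 \<Rightarrow> 0 | Suc n \<Rightarrow> s * ?f n"] sums_mult[OF S, of s] by simp
  from sums_diff[OF S this] have "(\<lambda>n. 2 * (real (Suc n) * s ^ n)) sums (S - s * S)"
    by (rule sums_cong[THEN iffD1, rotated]) (auto simp: algebra_simps split: nat.splits)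
  from sums_unique2[OF this sums_mult[OF g, of s 2]] assms
  have "S - s * S = 2 / (1 - s)\<^sup>2" by simp
  then have "S * (1 - s) = 2 / (1 - s)\<^sup>2" by (simp add: algebra_simps)
  moreover have "1 - s \<noteq> 0" using assms by auto
  ultimately have "S = 2 / (1 - s)\<^sup>2 / (1 - s)" by (metis nonzero_mult_div_cancel_right)
  then have "S = 2 / (1 - s) ^ 3" by (simp add: power3_eq_cube power2_eq_square)
  with S show ?thesis by simp
qed

lemma centered_mgeo:
  assumes c: "0 \<le> c" "c \<le> 1" and s: "0 \<le> s" "s < 1"
  shows "centered (mgeo c s) real (c / (1 - s)) (2 / (1 - s)\<^sup>2)"
  unfolding centered_def
proof (intro conjI allI)
  fix d :: real
  define \<mu> where "\<mu> = c / (1 - s)"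
  define e where "e = d - \<mu>"
  let ?G = "mgeo c s"
  have s1: "\<bar>s\<bar> < 1" "norm s < 1" "1 - s \<noteq> 0" using s by auto
  \<comment> \<open>The square is expanded as \<open>(n + 1 + e)^2 = (n + 1) * (n + 2) + (2 * e - 1)
    * (n + 1) + e^2\<close>, each part being a series with a known sum.\<close>
  have "(\<lambda>n. real (Suc n) * real (Suc (Suc n)) * s ^ n + (2 * e - 1) * (real (Suc n) * s ^ n) + e\<^sup>2 * s ^ n)
      sums (2 / (1 - s) ^ 3 + (2 * e - 1) * (1 / (1 - s)\<^sup>2) + e\<^sup>2 * (1 / (1 - s)))"
    using geometric_deriv_sums[OF s1(2)] by (intro sums_add sums_mult sums_rising_power s1 geometric_sums) simp
  then have "(\<lambda>n. c * (1 - s) * (real (Suc n) * real (Suc (Suc n)) * s ^ n + (2 * e - 1) * (real (Suc n) * s ^ n) + e\<^sup>2 * s ^ n))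
      sums (c * (1 - s) * (2 / (1 - s) ^ 3 + (2 * e - 1) * (1 / (1 - s)\<^sup>2) + e\<^sup>2 * (1 / (1 - s))))"
    by (rule sums_mult)
  then have "(\<lambda>n. pmf ?G (Suc n) * (real (Suc n) + e)\<^sup>2)
      sums (c * (1 - s) * (2 / (1 - s) ^ 3 + (2 * e - 1) * (1 / (1 - s)\<^sup>2) + e\<^sup>2 * (1 / (1 - s))))"
    by (rule sums_cong[THEN iffD1, rotated])
      (use c s in \<open>auto simp: pmf_mgeo_Suc power2_eq_square algebra_simps\<close>)
  from sums_Suc[OF this] have S: "(\<lambda>n. pmf ?G n * (real n + e)\<^sup>2)
      sums (c * (1 - s) * (2 / (1 - s) ^ 3 + (2 * e - 1) * (1 / (1 - s)\<^sup>2) + e\<^sup>2 * (1 / (1 - s))) + (1 - c) * e\<^sup>2)"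
    (is "_ sums ?S") using c by (simp add: pmf_mgeo_0)
  have "?S = 2 * c / (1 - s)\<^sup>2 - \<mu> + 2 * e * \<mu> + e\<^sup>2"
  proof -
    have "c * u * (2 / u ^ 3 + (2 * e - 1) * (1 / u\<^sup>2) + e\<^sup>2 * (1 / u)) + (1 - c) * e\<^sup>2
        = 2 * c / u\<^sup>2 - c / u + 2 * e * (c / u) + e\<^sup>2" if "u \<noteq> 0" for u
      using that by (simp add: field_simps power2_eq_square power3_eq_cube)
    from this[OF s1(3)] show ?thesis by (simp add: \<mu>_def)
  qed
  also have "\<dots> = 2 * c / (1 - s)\<^sup>2 - \<mu> - \<mu>\<^sup>2 + d\<^sup>2"
    by (simp add: e_def power2_eq_square algebra_simps)
  also have "\<dots> \<le> 2 / (1 - s)\<^sup>2 + d\<^sup>2"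
  proof -
    have "0 \<le> \<mu>" using c s by (simp add: \<mu>_def)
    moreover have "2 * c / (1 - s)\<^sup>2 \<le> 2 / (1 - s)\<^sup>2" using c by (intro divide_right_mono) auto
    ultimately show ?thesis by (smt (verit) zero_le_power2)
  qed
  finally have le: "?S \<le> 2 / (1 - s)\<^sup>2 + d\<^sup>2" .
  have "(\<integral>\<^sup>+x. ennreal ((real x - c / (1 - s) + d)\<^sup>2) \<partial>?G)
      = (\<Sum>n. ennreal (pmf ?G n * (real n + e)\<^sup>2))"
    by (subst nn_integral_measure_pmf)
       (simp add: nn_integral_count_space_nat ennreal_mult e_def \<mu>_def algebra_simps)
  also have "\<dots> = ennreal ?S"
    by (rule suminf_ennreal_eq) (use S in auto)
  also have "\<dots> \<le> ennreal (2 / (1 - s)\<^sup>2 + d\<^sup>2)" using le by (rule ennreal_leI)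
  finally show "(\<integral>\<^sup>+x. ennreal ((real x - c / (1 - s) + d)\<^sup>2) \<partial>?G) \<le> ennreal (2 / (1 - s)\<^sup>2 + d\<^sup>2)" .
qed simp

lemma prob_mgeo_atLeast_Suc:
  assumes "0 \<le> c" "c \<le> 1" "0 \<le> s" "s < 1"
  shows "measure (mgeo c s) {Suc x..} = c * s ^ x"
proof -
  have split: "measure P {n..} = pmf P n + measure P {Suc n..}" for P :: "nat pmf" and n
  proof -
    have "{n..} = {n} \<union> {Suc n..}" by auto
    then have "measure P {n..} = measure P {n} + measure P {Suc n..}"
      by (simp only:) (rule measure_pmf.finite_measure_Union, auto)
    then show ?thesis by (simp add: measure_pmf_single)
  qed
  show ?thesis
  proof (induction x)
    case 0
    have "{0::nat..} = UNIV" by auto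
    then show ?case using split[of "mgeo c s" 0] assms by (simp add: pmf_mgeo_0)
  next
    case (Suc x)
    then show ?case using split[of "mgeo c s" "Suc x"] assms by (simp add: pmf_mgeo_Suc algebra_simps)
  qed
qed

lemma pmf_eqI_tails:
  fixes P Q :: "nat pmf"
  assumes "\<And>n. measure P {Suc n..} = measure Q {Suc n..}"
  shows "P = Q"
proof (rule pmf_eqI)
  have split: "pmf P n = measure P {n..} - measure P {Suc n..}" for P :: "nat pmf" and n
  proof -
    have "{n} = {n..} - {Suc n..}" by auto
    then show ?thesis
      by (simp add: measure_pmf_single[symmetric] measure_pmf.finite_measure_Diff del: measure_pmf_single)
  qed
  have "measure P {n..} = measure Q {n..}" for n
  proof (cases n)
    case 0
    then have "{n..} = UNIV" by auto
    then show ?thesis by simp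
  qed (use assms in simp)
  then show "pmf P n = pmf Q n" for n by (simp add: split)
qed

text \<open>Tails of an independent minimum multiply. Read backwards, this represents a stationary
  queue of small intensity as the minimum of one of larger intensity and an independent variable,
  which yields a monotone coupling.\<close>

lemma mgeo_min:
  assumes "0 \<le> c" "c \<le> 1" "0 \<le> s" "s < 1" "0 \<le> c'" "c' \<le> 1" "0 \<le> s'" "s' < 1"
  shows "map_pmf (\<lambda>(q, z). min q z) (pair_pmf (mgeo c s) (mgeo c' s')) = mgeo (c * c') (s * s')"
proof (rule pmf_eqI_tails)
  fix n
  have "(\<lambda>(q, z). min q z) -` {Suc n..} = {Suc n..} \<times> {Suc n..}" by (auto simp: Suc_le_eq)
  moreover have "s * s' < 1" "c * c' \<le> 1"
    using assms by (smt (verit) mult_left_le mult_le_one)+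
  ultimately show "measure (map_pmf (\<lambda>(q, z). min q z) (pair_pmf (mgeo c s) (mgeo c' s'))) {Suc n..}
      = measure (mgeo (c * c') (s * s')) {Suc n..}"
    using assms by (simp add: measure_pmf_prob_product prob_mgeo_atLeast_Suc power_mult_distrib)
qed

section \<open>Min-plus comparison\<close>

text \<open>\<open>S r k\<close> tells whether clock \<open>r\<close> rings in cell
  \<open>k\<close>. As particle \<open>r\<close> starts at \<open>- r\<close>, particle
  \<open>r + 1\<close> is blocked exactly when both have moved equally often. The predecessor is
  read at the start of the cell, so all particles are updated simultaneously.\<close>

fun dmoves :: "(nat \<Rightarrow> nat \<Rightarrow> bool) \<Rightarrow> nat \<Rightarrow> nat \<Rightarrow> nat" where
  "dmoves S r 0 = 0"
| "dmoves S 0 (Suc k) = dmoves S 0 k + of_bool (S 0 k)"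
| "dmoves S (Suc r) (Suc k) =
     dmoves S (Suc r) k + of_bool (S (Suc r) k \<and> dmoves S (Suc r) k \<noteq> dmoves S r k)"

lemma dmoves_mono_Suc: "dmoves S r k \<le> dmoves S r (Suc k)"
  by (cases r) auto

lemma dmoves_Suc_le: "dmoves S (Suc r) k \<le> dmoves S r k"
proof (induction k)
  case (Suc k)
  then show ?case using dmoves_mono_Suc[of S r k] by auto
qed simp

lemma dmoves_antimono: "r \<le> r' \<Longrightarrow> dmoves S r' k \<le> dmoves S r k"
  by (induction r' rule: dec_induct) (auto intro: order_trans dmoves_Suc_le)

lemma dmoves_0: "dmoves S 0 k = (\<Sum>j<k. of_bool (S 0 j))"
  by (induction k) auto

text \<open>Row \<open>0\<close> is the external input and row \<open>Suc i\<close> counts the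
  departures of server \<open>i\<close>, hence the shift between the indices of \<open>f\<close> and
  \<open>S\<close>. The recursion is linear over the min-plus semiring, so solutions may be
  minimised and translated.\<close>

definition evolves :: "(nat \<Rightarrow> nat \<Rightarrow> bool) \<Rightarrow> (nat \<Rightarrow> nat \<Rightarrow> int) \<Rightarrow> bool" where
  "evolves S f \<longleftrightarrow> (\<forall>i k. f (Suc i) (Suc k) = min (f (Suc i) k + of_bool (S i k)) (f i k))"

lemma evolves_min: "evolves S f \<Longrightarrow> evolves S g \<Longrightarrow> evolves S (\<lambda>i k. min (f i k) (g i k))"
  by (auto simp: evolves_def min_def)

lemma evolves_add: "evolves S f \<Longrightarrow> evolves S (\<lambda>i k. f i k + c)"
  by (auto simp: evolves_def min_def)

lemma evolves_le:
  assumes f: "evolves S f" and g: "evolves S g"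
    and bd: "\<And>i. i \<le> R \<Longrightarrow> f i 0 \<le> g i 0" "\<And>k. k \<le> K \<Longrightarrow> f 0 k \<le> g 0 k"
  shows "i \<le> R \<Longrightarrow> k \<le> K \<Longrightarrow> f i k \<le> g i k"
proof (induction k arbitrary: i)
  case (Suc k)
  show ?case
  proof (cases i)
    case (Suc j)
    then show ?thesis using Suc.IH[of i] Suc.IH[of j] Suc.prems f g by (auto simp: evolves_def)
  qed (use bd Suc.prems in auto)
qed (use bd in auto)

text \<open>Row \<open>0\<close> plays a supply that never runs out: with the summand
  \<open>1\<close> it stays ahead of server \<open>0\<close> by one customer, so the minimum in the
  recursion is always attained by \<open>dmoves S 0 k + of_bool (S 0 k)\<close>. This summand is the
  origin of the \<open>1\<close> in the later bounds.\<close>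

definition free_front :: "(nat \<Rightarrow> nat \<Rightarrow> bool) \<Rightarrow> nat \<Rightarrow> nat \<Rightarrow> int" where
  "free_front S i k = (case i of 0 \<Rightarrow> int (dmoves S 0 k) + 1 | Suc r \<Rightarrow> int (dmoves S r k))"

lemma evolves_free_front: "evolves S (free_front S)"
  unfolding evolves_def
proof (intro allI)
  fix i k
  show "free_front S (Suc i) (Suc k) = min (free_front S (Suc i) k + of_bool (S i k)) (free_front S i k)"
  proof (cases i)
    case (Suc r)
    then show ?thesis using dmoves_Suc_le[of S r k] by (auto simp: free_front_def)
  qed (auto simp: free_front_def)
qed

text \<open>The departure counts of the system with arrivals \<open>a\<close> and initial queues
  \<open>Q\<close>, normalised to \<open>0\<close> at the corner. A difference of adjacent rows is a
  queue length, so the left boundary descends by \<open>Q\<close>.\<close>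

fun height :: "(nat \<Rightarrow> bool) \<Rightarrow> (nat \<Rightarrow> nat) \<Rightarrow> (nat \<Rightarrow> nat \<Rightarrow> bool) \<Rightarrow> nat \<Rightarrow> nat \<Rightarrow> int" where
  "height a Q S 0 k = (\<Sum>j<k. of_bool (a j))"
| "height a Q S (Suc i) 0 = height a Q S i 0 - int (Q i)"
| "height a Q S (Suc i) (Suc k) = min (height a Q S (Suc i) k + of_bool (S i k)) (height a Q S i k)"

lemma evolves_height: "evolves S (height a Q S)"
  by (simp add: evolves_def)

lemma height_init: "height a Q S i 0 = - (\<Sum>j<i. int (Q j))"
  by (induction i) auto

text \<open>Both sides follow the same recursion, but the height starts at or below \<open>0\<close>
  and is in addition capped by the input row. Row \<open>0\<close> has no counterpart among the
  particles, so the induction runs over positive rows.\<close>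

lemma height_le_dmoves: "height a Q S (Suc r) k \<le> int (dmoves S r k)"
proof -
  have "height a Q S i k \<le> int (dmoves S (i - 1) k)" if "0 < i" for i k
    using that
  proof (induction k arbitrary: i)
    case 0
    show ?case by (simp add: height_init sum_nonneg)
  next
    case (Suc k)
    then obtain j where j: "i = Suc j" by (cases i) auto
    show ?case
    proof (cases j)
      case 0
      then show ?thesis using Suc.IH[of i] j by auto
    next
      case (Suc l)
      then show ?thesis using Suc.IH[of i] Suc.IH[of j] j by auto
    qed
  qed
  from this[of "Suc r"] show ?thesis by simp
qed

text \<open>
  Min-plus linearity: by \<open>evolves_le\<close> it suffices to compare on the two boundaries. The three
  terms correspond to optimal paths that leave the boundary of the system \<open>(a, Q)\<close> early
  (before time \<open>m\<close> and before queue \<open>l\<close>), late in time, or late in space.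
\<close>

lemma height_ge_min:
  assumes a: "\<And>j. b j \<Longrightarrow> a j" and Q: "\<And>j. Q j \<le> Qc j"
  shows "min (int (dmoves S r K) - 1 - (\<Sum>j<m. of_bool (S 0 j)) - (\<Sum>j<l. int (Q j)))
     (min (height b Qb S (Suc r) K + (\<Sum>j<m. of_bool (a j) - of_bool (b j)))
          (height c Qc S (Suc r) K + (\<Sum>j<l. int (Qc j) - int (Q j))))
     \<le> height a Q S (Suc r) K" (is "min (_ - 1 - ?C - ?D) (min (_ + ?E) (_ + ?F)) \<le> _")
proof -
  define C D E F where "C = ?C" and "D = ?D" and "E = ?E" and "F = ?F"
  define f where "f i k = min (free_front S i k + (- 1 - C - D))
     (min (height b Qb S i k + E) (height c Qc S i k + F))" for i k
  have f: "evolves S f"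
    unfolding f_def by (intro evolves_min evolves_add evolves_free_front evolves_height)
  have f_le: "f i k \<le> free_front S i k - 1 - C - D" "f i k \<le> height b Qb S i k + E"
    "f i k \<le> height c Qc S i k + F" for i k
    by (auto simp: f_def)
  have C0: "0 \<le> C" "0 \<le> D" unfolding C_def D_def by (auto intro: sum_nonneg)
  \<comment> \<open>Up to \<open>l\<close> the constant \<open>- 1 - C - D\<close> pushes the free
    front below the boundary; beyond \<open>l\<close> the offset \<open>F\<close> makes the system
    with queues \<open>Qc\<close> agree at \<open>l\<close>, and from there on it descends at least
    as fast. The bottom boundary is treated alike with \<open>m\<close>, \<open>E\<close> and the
    sparser arrivals \<open>b\<close>.\<close>
  have left: "f i 0 \<le> height a Q S i 0" for i
  proof (cases "i \<le> l")
    case True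
    have "free_front S i 0 \<le> 1" by (simp add: free_front_def split: nat.splits)
    moreover have "(\<Sum>j<i. int (Q j)) \<le> D" unfolding D_def using True by (intro sum_mono2) auto
    ultimately show ?thesis using C0 f_le(1)[of i 0] unfolding height_init by linarith
  next
    case False
    then have U: "{..<i} = {..<l} \<union> {l..<i}" by auto
    have sp: "(\<Sum>j<i. g j) = (\<Sum>j<l. g j) + (\<Sum>j=l..<i. g j)" for g :: "nat \<Rightarrow> int"
      unfolding U by (rule sum.union_disjoint) auto
    have "(\<Sum>j=l..<i. int (Q j)) \<le> (\<Sum>j=l..<i. int (Qc j))" using Q by (intro sum_mono) simp
    then show ?thesis
      using f_le(3)[of i 0] sp[of "\<lambda>j. int (Q j)"] sp[of "\<lambda>j. int (Qc j)"]
      unfolding height_init F_def sum_subtractf by linarith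
  qed
  have bottom: "f 0 k \<le> height a Q S 0 k" for k
  proof (cases "k \<le> m")
    case True
    then have "(\<Sum>j<k. of_bool (S 0 j) :: int) \<le> C" unfolding C_def by (intro sum_mono2) auto
    then have "free_front S 0 k \<le> C + 1" by (simp add: free_front_def dmoves_0 del: sum_of_bool_eq)
    moreover have "0 \<le> height a Q S 0 k" by (simp add: sum_nonneg del: sum_of_bool_eq)
    ultimately show ?thesis using C0 f_le(1)[of 0 k] by linarith
  next
    case False
    then have U: "{..<k} = {..<m} \<union> {m..<k}" by auto
    have sp: "(\<Sum>j<k. g j) = (\<Sum>j<m. g j) + (\<Sum>j=m..<k. g j)" for g :: "nat \<Rightarrow> int"
      unfolding U by (rule sum.union_disjoint) auto
    have "(\<Sum>j=m..<k. of_bool (b j) :: int) \<le> (\<Sum>j=m..<k. of_bool (a j))" using a by (intro sum_mono) auto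
    then show ?thesis
      using f_le(2)[of 0 k] sp[of "\<lambda>j. of_bool (a j)"] sp[of "\<lambda>j. of_bool (b j)"]
      unfolding height.simps E_def sum_subtractf by linarith
  qed
  have "f (Suc r) K \<le> height a Q S (Suc r) K"
    by (rule evolves_le[OF f evolves_height left bottom, where R = "Suc r" and K = K]) auto
  moreover have "free_front S (Suc r) K + (- 1 - C - D) = int (dmoves S r K) - 1 - C - D"
    by (simp add: free_front_def)
  ultimately show ?thesis unfolding f_def C_def D_def E_def F_def by presburger
qed

section \<open>Queue lengths read off from solutions of the min-plus recursion\<close>

lemma queue_evolves:
  fixes u v :: "nat \<Rightarrow> int"
  assumes "length as = length ss"
    and "\<And>k. k < length ss \<Longrightarrow> u (Suc k) = u k + of_bool (as ! k)"
    and "\<And>k. k < length ss \<Longrightarrow> v (Suc k) = min (v k + of_bool (ss ! k)) (u k)"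
    and "u 0 - v 0 = int q"
  shows "int (fst (queue q as ss)) = u (length ss) - v (length ss) \<and>
    (\<forall>k < length ss. v (Suc k) = v k + of_bool (snd (queue q as ss) ! k))"
  using assms
proof (induction q as ss arbitrary: u v rule: queue.induct)
  case (1 q a as s ss)
  define d where "d \<longleftrightarrow> s \<and> 0 < q"
  define q' where "q' = q + of_bool a - of_bool d"
  \<comment> \<open>The minimum in the recursion is \<open>v 0 + of_bool d\<close>: a departure
    occurs exactly if the server rings and \<open>u 0 - v 0 = int q\<close> is positive.\<close>
  have u1: "u (Suc 0) = u 0 + of_bool a" and v1: "v (Suc 0) = v 0 + of_bool d"
    using "1.prems"(2)[of 0] "1.prems"(3)[of 0] "1.prems"(4) by (auto simp: d_def)
  have q': "u (Suc 0) - v (Suc 0) = int q'"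
    using "1.prems"(4) u1 v1 by (auto simp: q'_def d_def)
  have "int (fst (queue q' as ss)) = u (Suc (length ss)) - v (Suc (length ss)) \<and>
    (\<forall>k < length ss. v (Suc (Suc k)) = v (Suc k) + of_bool (snd (queue q' as ss) ! k))"
    unfolding q'_def
  proof (rule "1.IH"[OF d_def])
    show "length as = length ss" using "1.prems"(1) by simp
    show "u (Suc (Suc k)) = u (Suc k) + of_bool (as ! k)" if "k < length ss" for k
      using "1.prems"(2)[of "Suc k"] that by simp
    show "v (Suc (Suc k)) = min (v (Suc k) + of_bool (ss ! k)) (u (Suc k))" if "k < length ss" for k
      using "1.prems"(3)[of "Suc k"] that by simp
    show "u (Suc 0) - v (Suc 0) = int (q + of_bool a - of_bool d)" using q' by (simp add: q'_def)
  qed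
  moreover have "queue q (a # as) (s # ss) = (fst (queue q' as ss), d # snd (queue q' as ss))"
    by (simp add: Let_def d_def q'_def case_prod_beta)
  ultimately show ?case
    using v1 by (auto simp: nth_Cons split: nat.splits)
qed auto

text \<open>Adjacent rows differ by the initial queue in the first column and by the final queue in
  column \<open>K\<close>; the latter differences telescope.\<close>

lemma tandem_evolves:
  fixes f :: "nat \<Rightarrow> nat \<Rightarrow> int"
  assumes "length as = K" and "\<And>q ss. (q, ss) \<in> set rs \<Longrightarrow> length ss = K"
    and "\<And>k. k < K \<Longrightarrow> f 0 (Suc k) = f 0 k + of_bool (as ! k)"
    and "\<And>i k. i < length rs \<Longrightarrow> k < K \<Longrightarrow>
       f (Suc i) (Suc k) = min (f (Suc i) k + of_bool (snd (rs ! i) ! k)) (f i k)"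
    and "\<And>i. i < length rs \<Longrightarrow> f i 0 - f (Suc i) 0 = int (fst (rs ! i))"
  shows "int (sum_list (tandem as rs)) = f 0 K - f (length rs) K"
  using assms
proof (induction as rs arbitrary: f rule: tandem.induct)
  case (2 as q ss rs)
  have l: "length ss = K" using "2.prems"(2)[of q ss] by simp
  have Q: "int (fst (queue q as ss)) = f 0 K - f 1 K \<and>
    (\<forall>k < K. f 1 (Suc k) = f 1 k + of_bool (snd (queue q as ss) ! k))"
    using queue_evolves[of as ss "f 0" "f 1" q] "2.prems"(1,3) "2.prems"(4)[of 0] "2.prems"(5)[of 0] l by simp
  have "int (sum_list (tandem (snd (queue q as ss)) rs)) = f 1 K - f (Suc (length rs)) K"
    unfolding One_nat_def
  proof (rule "2.IH"[OF refl prod.collapse, where f = "\<lambda>i. f (Suc i)", simplified])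
    show "length (snd (queue q as ss)) = K" using "2.prems"(1) l by (simp add: length_queue)
    show "length ss' = K" if "(q', ss') \<in> set rs" for q' ss' using "2.prems"(2)[of q' ss'] that by simp
    show "f (Suc 0) (Suc k) = f (Suc 0) k + of_bool (snd (queue q as ss) ! k)" if "k < K" for k
      using Q that by simp
    show "f (Suc (Suc i)) (Suc k) = min (f (Suc (Suc i)) k + of_bool (snd (rs ! i) ! k)) (f (Suc i) k)"
      if "i < length rs" "k < K" for i k
      using "2.prems"(4)[of "Suc i" k] that by simp
    show "f (Suc i) 0 - f (Suc (Suc i)) 0 = int (fst (rs ! i))" if "i < length rs" for i
      using "2.prems"(5)[of "Suc i"] that by simp
  qed
  then show ?case using Q by (simp add: case_prod_beta Let_def)
qed simp

text \<open>Customers are conserved: what has come in and is not left in a queue has gone out. This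
  expresses a height through two sums whose laws are explicit in the stationary system.\<close>

lemma height_conservation:
  assumes "length as = K" "length Qs = R" "length SS = R" "\<And>ss. ss \<in> set SS \<Longrightarrow> length ss = K"
  shows "height (\<lambda>k. as ! k) (\<lambda>i. Qs ! i) (\<lambda>i k. SS ! i ! k) R K
     = (\<Sum>a\<leftarrow>as. of_bool a) - int (sum_list (tandem as (zip Qs SS)))"
proof -
  have "int (sum_list (tandem as (zip Qs SS))) =
     height (\<lambda>k. as ! k) (\<lambda>i. Qs ! i) (\<lambda>i k. SS ! i ! k) 0 K - height (\<lambda>k. as ! k) (\<lambda>i. Qs ! i) (\<lambda>i k. SS ! i ! k) (length (zip Qs SS)) K"
    by (rule tandem_evolves) (use assms in \<open>auto dest: set_zip_rightD\<close>)
  moreover have "(\<Sum>a\<leftarrow>as. of_bool a) = (\<Sum>j<K. of_bool (as ! j) :: int)"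
    using assms(1) by (simp add: sum_list_sum_nth atLeast0LessThan del: sum_of_bool_eq)
  ultimately show ?thesis using assms by simp
qed

section \<open>Bounds for the discretised process\<close>

lemma map_replicate_pmf: "map_pmf (map f) (replicate_pmf n P) = replicate_pmf n (map_pmf f P)"
proof (induction n)
  case (Suc n)
  have "map_pmf (map f) (replicate_pmf (Suc n) P)
      = do {x \<leftarrow> P; ys \<leftarrow> map_pmf (map f) (replicate_pmf n P); return_pmf (f x # ys)}"
    by (simp add: map_bind_pmf bind_map_pmf)
  then show ?case by (simp add: Suc.IH bind_map_pmf)
qed simp

lemma zip_replicate_pmf:
  "map_pmf (\<lambda>(xs, ys). zip xs ys) (pair_pmf (replicate_pmf n P) (replicate_pmf n Q)) = replicate_pmf n (pair_pmf P Q)"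
proof (induction n)
  case (Suc n)
  have "map_pmf (\<lambda>(xs, ys). zip xs ys) (pair_pmf (replicate_pmf (Suc n) P) (replicate_pmf (Suc n) Q))
     = do {x \<leftarrow> P; xs \<leftarrow> replicate_pmf n P; y \<leftarrow> Q; ys \<leftarrow> replicate_pmf n Q; return_pmf ((x, y) # zip xs ys)}"
    by (simp add: pair_pmf_def map_bind_pmf bind_assoc_pmf bind_return_pmf)
  also have "\<dots> = do {x \<leftarrow> P; y \<leftarrow> Q; xs \<leftarrow> replicate_pmf n P; ys \<leftarrow> replicate_pmf n Q; return_pmf ((x, y) # zip xs ys)}"
    by (subst bind_commute_pmf[of _ Q]) (rule refl)
  also have "\<dots> = do {x \<leftarrow> P; y \<leftarrow> Q; map_pmf ((#) (x, y)) (map_pmf (\<lambda>(xs, ys). zip xs ys) (pair_pmf (replicate_pmf n P) (replicate_pmf n Q)))}"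
    by (simp add: pair_pmf_def map_bind_pmf bind_assoc_pmf bind_return_pmf)
  also have "\<dots> = replicate_pmf (Suc n) (pair_pmf P Q)"
    unfolding Suc.IH by (simp add: pair_pmf_def map_pmf_def bind_assoc_pmf bind_return_pmf)
  finally show ?case .
qed (simp add: pair_pmf_def bind_return_pmf)

lemma take_replicate_pmf:
  assumes "m \<le> n"
  shows "map_pmf (take m) (replicate_pmf n P) = replicate_pmf m P"
proof -
  have "map_pmf (take m) (replicate_pmf (m + (n - m)) P)
    = do {xs \<leftarrow> replicate_pmf m P; ys \<leftarrow> replicate_pmf (n - m) P; return_pmf (take m (xs @ ys))}"
    by (simp only: replicate_pmf_distrib map_bind_pmf map_return_pmf)
  also have "\<dots> = do {xs \<leftarrow> replicate_pmf m P; ys \<leftarrow> replicate_pmf (n - m) P; return_pmf xs}"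
    by (intro bind_pmf_cong refl) (auto simp: set_replicate_pmf)
  finally show ?thesis using assms by (simp add: bind_return_pmf')
qed

lemma nth_replicate_pmf:
  assumes "k < n"
  shows "map_pmf (\<lambda>xs. xs ! k) (replicate_pmf n P) = P"
  using assms
proof (induction n arbitrary: k)
  case (Suc n)
  show ?case
  proof (cases k)
    case 0
    then show ?thesis by (simp add: map_bind_pmf bind_return_pmf')
  next
    case (Suc j)
    have "map_pmf (\<lambda>xs. xs ! k) (replicate_pmf (Suc n) P) = P \<bind> (\<lambda>x. map_pmf (\<lambda>xs. xs ! j) (replicate_pmf n P))"
      by (simp add: Suc map_bind_pmf map_pmf_def bind_assoc_pmf bind_return_pmf)
    then show ?thesis using Suc.IH[of j] Suc.prems Suc by simp
  qed
qed simp

text \<open>Mean-square deviation from a given number. In contrast to \<open>centered\<close> it is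
  stable under sums of dependent variables, at the price of a factor \<open>2\<close>; this matters
  because arrivals, final queues and the coupled systems are all dependent.\<close>

definition spread :: "'a pmf \<Rightarrow> ('a \<Rightarrow> real) \<Rightarrow> real \<Rightarrow> real \<Rightarrow> bool" where
  "spread P X \<mu> v \<longleftrightarrow> 0 \<le> v \<and> (\<integral>\<^sup>+x. ennreal ((X x - \<mu>)\<^sup>2) \<partial>P) \<le> ennreal v"

lemma centered_spread: "centered P X \<mu> v \<Longrightarrow> spread P X \<mu> v"
  unfolding centered_def spread_def by (auto dest: spec[of _ 0])

lemma spread_mono: "spread P X \<mu> v \<Longrightarrow> v \<le> w \<Longrightarrow> spread P X \<mu> w"
  unfolding spread_def by (meson ennreal_leI order_trans)

lemma spread_map: "spread (map_pmf g P) X \<mu> v \<longleftrightarrow> spread P (\<lambda>x. X (g x)) \<mu> v"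
  by (simp add: spread_def)

lemma spread_cong: "(\<And>x. x \<in> set_pmf P \<Longrightarrow> X x = Y x) \<Longrightarrow> spread P X \<mu> v \<longleftrightarrow> spread P Y \<mu> v"
proof -
  assume "\<And>x. x \<in> set_pmf P \<Longrightarrow> X x = Y x"
  then have "(\<integral>\<^sup>+x. ennreal ((X x - \<mu>)\<^sup>2) \<partial>P) = (\<integral>\<^sup>+x. ennreal ((Y x - \<mu>)\<^sup>2) \<partial>P)"
    by (intro nn_integral_cong_AE) (simp add: AE_measure_pmf_iff)
  then show ?thesis by (simp add: spread_def)
qed

lemma spread_minus: "spread P X \<mu> v \<Longrightarrow> spread P (\<lambda>x. - X x) (- \<mu>) v"
  by (simp add: spread_def power2_commute)

lemma spread_add:
  assumes "spread P X \<mu> v" "spread P Y \<nu> w"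
  shows "spread P (\<lambda>x. X x + Y x) (\<mu> + \<nu>) (2 * v + 2 * w)"
proof -
  have "(\<integral>\<^sup>+x. ennreal ((X x + Y x - (\<mu> + \<nu>))\<^sup>2) \<partial>P)
     \<le> (\<integral>\<^sup>+x. ennreal 2 * ennreal ((X x - \<mu>)\<^sup>2) + ennreal 2 * ennreal ((Y x - \<nu>)\<^sup>2) \<partial>P)"
  proof (rule nn_integral_mono)
    fix x
    have "(a + b)\<^sup>2 \<le> 2 * a\<^sup>2 + 2 * b\<^sup>2" for a b :: real
      using zero_le_power2[of "a - b"] by (simp add: power2_eq_square algebra_simps)
    from this[of "X x - \<mu>" "Y x - \<nu>"]
    have "ennreal ((X x + Y x - (\<mu> + \<nu>))\<^sup>2) \<le> ennreal (2 * (X x - \<mu>)\<^sup>2 + 2 * (Y x - \<nu>)\<^sup>2)"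
      by (intro ennreal_leI) (simp add: algebra_simps)
    then show "ennreal ((X x + Y x - (\<mu> + \<nu>))\<^sup>2)
       \<le> ennreal 2 * ennreal ((X x - \<mu>)\<^sup>2) + ennreal 2 * ennreal ((Y x - \<nu>)\<^sup>2)"
      by (simp add: ennreal_mult)
  qed
  also have "\<dots> = ennreal 2 * (\<integral>\<^sup>+x. ennreal ((X x - \<mu>)\<^sup>2) \<partial>P) + ennreal 2 * (\<integral>\<^sup>+x. ennreal ((Y x - \<nu>)\<^sup>2) \<partial>P)"
    by (simp add: nn_integral_add nn_integral_cmult)
  also have "\<dots> \<le> ennreal 2 * ennreal v + ennreal 2 * ennreal w"
    using assms by (intro add_mono mult_left_mono) (auto simp: spread_def)
  also have "\<dots> = ennreal (2 * v + 2 * w)"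
    using assms by (simp add: spread_def ennreal_mult)
  finally show ?thesis using assms by (simp add: spread_def)
qed

lemma spread_diff:
  "spread P X \<mu> v \<Longrightarrow> spread P Y \<nu> w \<Longrightarrow> spread P (\<lambda>x. X x - Y x) (\<mu> - \<nu>) (2 * v + 2 * w)"
  using spread_add[of P X \<mu> v "\<lambda>x. - Y x" "- \<nu>" w] spread_minus[of P Y \<nu> w] by simp

lemma spread_chebyshev:
  assumes "spread P X \<mu> v" "0 < \<mu>"
  shows "(\<integral>\<^sup>+x. of_bool (X x \<le> 0) \<partial>P) \<le> ennreal (v / \<mu>\<^sup>2)"
proof -
  have "(\<integral>\<^sup>+x. of_bool (X x \<le> 0) \<partial>P) \<le> (\<integral>\<^sup>+x. ennreal (1 / \<mu>\<^sup>2) * ennreal ((X x - \<mu>)\<^sup>2) \<partial>P)"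
  proof (rule nn_integral_mono)
    fix x
    have "1 \<le> 1 / \<mu>\<^sup>2 * (X x - \<mu>)\<^sup>2" if "X x \<le> 0"
    proof -
      have "\<mu>\<^sup>2 \<le> (\<mu> - X x)\<^sup>2" using that assms by (intro power_mono) auto
      then show ?thesis using assms by (simp add: power2_commute)
    qed
    then show "of_bool (X x \<le> 0) \<le> ennreal (1 / \<mu>\<^sup>2) * ennreal ((X x - \<mu>)\<^sup>2)"
      by (auto simp: ennreal_mult[symmetric] ennreal_1[symmetric] simp del: ennreal_1 intro!: ennreal_leI)
  qed
  also have "\<dots> = ennreal (1 / \<mu>\<^sup>2) * (\<integral>\<^sup>+x. ennreal ((X x - \<mu>)\<^sup>2) \<partial>P)"
    by (simp add: nn_integral_cmult)
  also have "\<dots> \<le> ennreal (1 / \<mu>\<^sup>2) * ennreal v"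
    using assms by (intro mult_left_mono) (auto simp: spread_def)
  also have "\<dots> = ennreal (v / \<mu>\<^sup>2)" using assms by (simp add: ennreal_mult[symmetric] spread_def)
  finally show ?thesis .
qed

text \<open>Rests on \<open>\<bar>a\<bar> \<le> s + a^2 / s\<close>. For \<open>v\<close> of order
  \<open>t\<close> the choice \<open>s = sqrt t\<close> makes both terms of order
  \<open>sqrt t\<close>.\<close>

lemma spread_abs:
  assumes "spread P X \<mu> v" "0 < s"
  shows "(\<integral>\<^sup>+x. ennreal \<bar>X x - \<mu>\<bar> \<partial>P) \<le> ennreal (s + v / s)"
proof -
  have "(\<integral>\<^sup>+x. ennreal \<bar>X x - \<mu>\<bar> \<partial>P) \<le> (\<integral>\<^sup>+x. ennreal s + ennreal (1 / s) * ennreal ((X x - \<mu>)\<^sup>2) \<partial>P)"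
  proof (rule nn_integral_mono)
    fix x
    have "\<bar>a\<bar> \<le> s + 1 / s * a\<^sup>2" for a :: real
    proof (cases "\<bar>a\<bar> \<le> s")
      case False
      then have "s * \<bar>a\<bar> \<le> a\<^sup>2" using assms by (metis abs_ge_zero less_eq_real_def linorder_not_less mult_right_mono power2_abs power2_eq_square)
      then show ?thesis using assms by (simp add: field_simps) (smt (verit) mult_pos_pos)
    qed (use assms in \<open>simp add: add_increasing2\<close>)
    then show "ennreal \<bar>X x - \<mu>\<bar> \<le> ennreal s + ennreal (1 / s) * ennreal ((X x - \<mu>)\<^sup>2)"
      using assms by (simp add: ennreal_mult[symmetric] ennreal_plus[symmetric] ennreal_leI del: ennreal_plus)
  qed
  also have "\<dots> = ennreal s + ennreal (1 / s) * (\<integral>\<^sup>+x. ennreal ((X x - \<mu>)\<^sup>2) \<partial>P)"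
    by (simp add: nn_integral_cmult nn_integral_add measure_pmf.emeasure_space_1)
  also have "\<dots> \<le> ennreal s + ennreal (1 / s) * ennreal v"
    using assms by (intro add_left_mono mult_left_mono) (auto simp: spread_def)
  also have "\<dots> = ennreal (s + v / s)"
    using assms by (simp add: ennreal_mult[symmetric] ennreal_plus[symmetric] spread_def del: ennreal_plus)
  finally show ?thesis .
qed

section \<open>Concentration of the stationary height and the lower bound for the moves\<close>

definition clocks :: "real \<Rightarrow> nat \<Rightarrow> nat \<Rightarrow> bool list list pmf" where
  "clocks p R K = replicate_pmf R (replicate_pmf K (bernoulli_pmf p))"

definition mean_queue :: "real \<Rightarrow> real \<Rightarrow> real" where
  "mean_queue p \<alpha> = \<alpha> * (1 - \<alpha> * p) / (1 - \<alpha>)"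

definition mean_height :: "real \<Rightarrow> nat \<Rightarrow> nat \<Rightarrow> real \<Rightarrow> real" where
  "mean_height p R K \<alpha> = real K * (\<alpha> * p) - real R * mean_queue p \<alpha>"

text \<open>Twice the variance bound \<open>real K * p\<close> of the arrivals plus twice the bound
  \<open>real R * (2 / (1 - \<alpha>)^2)\<close> of the final queues, the doubling being that of
  \<open>spread_diff\<close>.\<close>

definition noise :: "real \<Rightarrow> nat \<Rightarrow> nat \<Rightarrow> real \<Rightarrow> real" where
  "noise p R K \<alpha> = 2 * real K * p + 4 * real R / (1 - \<alpha>)\<^sup>2"

abbreviation grid :: "bool list list \<Rightarrow> nat \<Rightarrow> nat \<Rightarrow> bool" where
  "grid SS \<equiv> \<lambda>i k. SS ! i ! k"

lemma centered_stat_queue: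
  assumes "0 < p" "p < 1" "0 < \<alpha>" "\<alpha> < 1"
  shows "centered (stat_queue p \<alpha>) real (mean_queue p \<alpha>) (2 / (1 - \<alpha>)\<^sup>2)"
proof -
  note q = one_minus_queue_ratio[OF assms] and s = queue_ratio_bounds[OF assms]
  have "centered (stat_queue p \<alpha>) real (\<alpha> / (1 - queue_ratio p \<alpha>)) (2 / (1 - queue_ratio p \<alpha>)\<^sup>2)"
    unfolding stat_queue_def using assms s by (intro centered_mgeo) auto
  moreover have "\<alpha> / (1 - queue_ratio p \<alpha>) = mean_queue p \<alpha>"
    using q by (simp add: mean_queue_def)
  moreover have "2 / (1 - queue_ratio p \<alpha>)\<^sup>2 \<le> 2 / (1 - \<alpha>)\<^sup>2"
  proof -
    have "1 - \<alpha> \<le> 1 - queue_ratio p \<alpha>"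
      unfolding q(1) using assms q(2) by (simp add: pos_le_divide_eq mult_left_le)
    then show ?thesis using assms by (intro divide_left_mono power_mono mult_pos_pos zero_less_power) auto
  qed
  ultimately show ?thesis using centered_mono by metis
qed

lemma clocks_lengthD:
  "SS \<in> set_pmf (clocks p R K) \<Longrightarrow> length SS = R \<and> (\<forall>ss\<in>set SS. length ss = K)"
  by (auto simp: clocks_def set_replicate_pmf)

text \<open>The height is the arrivals minus the final queues. These are dependent, but the former
  are independent Bernoulli variables and the latter, by the product form, independent stationary
  queues, so each sum has a known centre and variance bound.\<close>

lemma spread_height:
  assumes p: "0 < p" "p < 1" "0 < \<alpha>" "\<alpha> < 1"
  shows "spread (pair_pmf (replicate_pmf K (bernoulli_pmf (\<alpha> * p)))
        (pair_pmf (replicate_pmf R (stat_queue p \<alpha>)) (clocks p R K)))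
     (\<lambda>(as, Qs, SS). real_of_int (height (\<lambda>k. as ! k) (\<lambda>i. Qs ! i) (grid SS) R K))
     (mean_height p R K \<alpha>) (noise p R K \<alpha>)"
proof -
  let ?A = "replicate_pmf K (bernoulli_pmf (\<alpha> * p))" and ?Q = "replicate_pmf R (stat_queue p \<alpha>)"
  let ?P = "pair_pmf ?A (pair_pmf ?Q (clocks p R K))"
  have a: "0 < \<alpha> * p" "\<alpha> * p < 1" using p one_minus_queue_ratio[OF p] by auto
  have "map_pmf (\<lambda>(as, Qs, SS). tandem as (zip Qs SS)) ?P
     = do {as \<leftarrow> ?A; rs \<leftarrow> map_pmf (\<lambda>(xs, ys). zip xs ys) (pair_pmf ?Q (clocks p R K)); return_pmf (tandem as rs)}"
    by (simp add: pair_pmf_def map_bind_pmf bind_map_pmf bind_assoc_pmf bind_return_pmf)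
  also have "\<dots> = ?Q"
    unfolding clocks_def zip_replicate_pmf by (rule tandem_stationary[OF p])
  finally have law: "map_pmf (\<lambda>(as, Qs, SS). tandem as (zip Qs SS)) ?P = ?Q" .
  have "spread ?Q (\<lambda>xs. \<Sum>x\<leftarrow>xs. real x) (real R * mean_queue p \<alpha>) (real R * (2 / (1 - \<alpha>)\<^sup>2))"
    by (intro centered_spread centered_sum_list centered_stat_queue p)
  then have Q: "spread ?P (\<lambda>(as, Qs, SS). \<Sum>x\<leftarrow>tandem as (zip Qs SS). real x)
     (real R * mean_queue p \<alpha>) (real R * (2 / (1 - \<alpha>)\<^sup>2))"
    by (subst (asm) law[symmetric]) (simp add: spread_map case_prod_unfold)
  have "spread ?A (\<lambda>xs. \<Sum>x\<leftarrow>xs. of_bool x) (real K * (\<alpha> * p)) (real K * (\<alpha> * p))"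
    using a by (intro centered_spread centered_sum_list centered_bernoulli) auto
  then have "spread (map_pmf fst ?P) (\<lambda>xs. \<Sum>x\<leftarrow>xs. of_bool x) (real K * (\<alpha> * p)) (real K * (\<alpha> * p))"
    by (simp add: map_fst_pair_pmf)
  then have A: "spread ?P (\<lambda>(as, Qs, SS). \<Sum>x\<leftarrow>as. of_bool x) (real K * (\<alpha> * p)) (real K * (\<alpha> * p))"
    by (simp add: spread_map case_prod_unfold)
  have "spread ?P (\<lambda>(as, Qs, SS). real_of_int (height (\<lambda>k. as ! k) (\<lambda>i. Qs ! i) (grid SS) R K))
     (real K * (\<alpha> * p) - real R * mean_queue p \<alpha>) (2 * (real K * (\<alpha> * p)) + 2 * (real R * (2 / (1 - \<alpha>)\<^sup>2)))"
  proof (subst spread_cong)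
    show "spread ?P (\<lambda>x. (case x of (as, Qs, SS) \<Rightarrow> \<Sum>x\<leftarrow>as. of_bool x) - (case x of (as, Qs, SS) \<Rightarrow> \<Sum>x\<leftarrow>tandem as (zip Qs SS). real x))
     (real K * (\<alpha> * p) - real R * mean_queue p \<alpha>) (2 * (real K * (\<alpha> * p)) + 2 * (real R * (2 / (1 - \<alpha>)\<^sup>2)))"
      by (rule spread_diff[OF A Q])
    have of_int_bools: "real_of_int (\<Sum>a\<leftarrow>as. of_bool a) = (\<Sum>a\<leftarrow>as. of_bool a)" for as
      by (induction as) auto
    have of_nat_sums: "real (sum_list xs) = (\<Sum>x\<leftarrow>xs. real x)" for xs
      by (induction xs) auto
    fix x assume x: "x \<in> set_pmf ?P"
    obtain as Qs SS where [simp]: "x = (as, Qs, SS)" by (cases x) auto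
    have "length as = K" "length Qs = R" "length SS = R" "\<And>ss. ss \<in> set SS \<Longrightarrow> length ss = K"
      using x clocks_lengthD[of SS p R K] by (auto simp: set_replicate_pmf)
    from height_conservation[OF this]
    show "(case x of (as, Qs, SS) \<Rightarrow> real_of_int (height (\<lambda>k. as ! k) (\<lambda>i. Qs ! i) (grid SS) R K))
      = (case x of (as, Qs, SS) \<Rightarrow> \<Sum>x\<leftarrow>as. of_bool x) - (case x of (as, Qs, SS) \<Rightarrow> \<Sum>x\<leftarrow>tandem as (zip Qs SS). real x)"
      using of_int_bools[of as] of_nat_sums[of "tandem as (zip Qs SS)"] by simp
  qed
  moreover have "\<alpha> * (real K * p) \<le> 1 * (real K * p)" using p by (intro mult_right_mono) auto
  ultimately show ?thesis
    unfolding mean_height_def noise_def by (elim spread_mono) (simp add: algebra_simps)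
qed

definition mean_moves :: "real \<Rightarrow> nat \<Rightarrow> nat \<Rightarrow> ennreal" where
  "mean_moves p r K = (\<integral>\<^sup>+SS. of_nat (dmoves (grid SS) r K) \<partial>clocks p (Suc r) K)"

text \<open>The moves dominate the stationary height for every intensity, so the optimal \<alpha>
  can be inserted later. The error is added on the right because subtraction in
  \<open>ennreal\<close> truncates.\<close>

lemma mean_moves_ge:
  assumes p: "0 < p" "p < 1" "0 < \<alpha>" "\<alpha> < 1" and s: "0 < s"
  shows "ennreal (mean_height p (Suc r) K \<alpha>)
     \<le> mean_moves p r K + ennreal (s + noise p (Suc r) K \<alpha> / s)"
proof -
  let ?R = "Suc r"
  let ?P = "pair_pmf (replicate_pmf K (bernoulli_pmf (\<alpha> * p)))
        (pair_pmf (replicate_pmf ?R (stat_queue p \<alpha>)) (clocks p ?R K))"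
  let ?X = "\<lambda>(as, Qs, SS). real_of_int (height (\<lambda>k. as ! k) (\<lambda>i. Qs ! i) (grid SS) ?R K)"
  let ?\<mu> = "mean_height p ?R K \<alpha>"
  have "ennreal ?\<mu> = (\<integral>\<^sup>+x. ennreal ?\<mu> \<partial>?P)" by (simp add: measure_pmf.emeasure_space_1)
  also have "\<dots> \<le> (\<integral>\<^sup>+x. of_nat (dmoves (grid (snd (snd x))) r K) + ennreal \<bar>?X x - ?\<mu>\<bar> \<partial>?P)"
  proof (rule nn_integral_mono)
    fix x :: "bool list \<times> nat list \<times> bool list list"
    obtain as Qs SS where [simp]: "x = (as, Qs, SS)" by (cases x) auto
    have "real_of_int (height (\<lambda>k. as ! k) (\<lambda>i. Qs ! i) (grid SS) ?R K) \<le> real (dmoves (grid SS) r K)"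
      using height_le_dmoves[of "\<lambda>k. as ! k" "\<lambda>i. Qs ! i" "grid SS" r K] by linarith
    then have "?\<mu> \<le> real (dmoves (grid SS) r K) + \<bar>?X x - ?\<mu>\<bar>" by simp
    then show "ennreal ?\<mu> \<le> of_nat (dmoves (grid (snd (snd x))) r K) + ennreal \<bar>?X x - ?\<mu>\<bar>"
      by (simp add: ennreal_of_nat_eq_real_of_nat ennreal_plus[symmetric] ennreal_leI del: ennreal_plus)
  qed
  also have "\<dots> = mean_moves p r K + (\<integral>\<^sup>+x. ennreal \<bar>?X x - ?\<mu>\<bar> \<partial>?P)"
    by (simp add: nn_integral_add nn_integral_pair_pmf' mean_moves_def measure_pmf.emeasure_space_1)
  also have "\<dots> \<le> mean_moves p r K + ennreal (s + noise p ?R K \<alpha> / s)"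
    by (intro add_left_mono spread_abs[OF spread_height] p s)
  finally show ?thesis .
qed

section \<open>Decay of the mean number of moves in the particle index\<close>

lemma nn_integral_pmf_cong:
  "(\<And>x. x \<in> set_pmf P \<Longrightarrow> f x = g x) \<Longrightarrow> (\<integral>\<^sup>+x. f x \<partial>measure_pmf P) = (\<integral>\<^sup>+x. g x \<partial>measure_pmf P)"
  by (rule nn_integral_cong_AE) (simp add: AE_measure_pmf_iff)

lemma nn_integral_pmf_mono:
  "(\<And>x. x \<in> set_pmf P \<Longrightarrow> f x \<le> g x) \<Longrightarrow> (\<integral>\<^sup>+x. f x \<partial>measure_pmf P) \<le> (\<integral>\<^sup>+x. g x \<partial>measure_pmf P)"
  by (rule nn_integral_mono_AE) (simp add: AE_measure_pmf_iff)

lemma dmoves_cong: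
  "(\<And>i j. i \<le> r \<Longrightarrow> j < k \<Longrightarrow> S i j = S' i j) \<Longrightarrow> dmoves S r k = dmoves S' r k"
  by (induction S r k rule: dmoves.induct) auto

lemma clocks_split:
  assumes "i < R"
  shows "clocks p R K = do {X \<leftarrow> clocks p i K; row \<leftarrow> replicate_pmf K (bernoulli_pmf p);
     Y \<leftarrow> clocks p (R - Suc i) K; return_pmf (X @ row # Y)}"
proof -
  have "R = i + Suc (R - Suc i)" using assms by simp
  then have "clocks p R K = replicate_pmf (i + Suc (R - Suc i)) (replicate_pmf K (bernoulli_pmf p))"
    by (simp add: clocks_def)
  then show ?thesis
    unfolding replicate_pmf_distrib clocks_def by (simp add: bind_assoc_pmf bind_return_pmf)
qed

text \<open>A bit of row \<open>i\<close> is independent of a function that reads only the rows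
  before \<open>i\<close>; the hypothesis on \<open>g\<close> expresses this dependence.\<close>

lemma nn_integral_clock_bit:
  assumes "i < R" "k < K" "0 \<le> p" "p \<le> 1"
    and f: "\<And>X row Y. length X = i \<Longrightarrow> f (X @ row # Y) = (g X :: ennreal)"
  shows "(\<integral>\<^sup>+SS. of_bool (SS ! i ! k) * f SS \<partial>clocks p R K) = ennreal p * (\<integral>\<^sup>+SS. f SS \<partial>clocks p R K)"
proof -
  let ?B = "replicate_pmf K (bernoulli_pmf p)"
  have bit: "(\<integral>\<^sup>+row. of_bool (row ! k) \<partial>?B) = ennreal p"
  proof -
    have "(\<integral>\<^sup>+row. of_bool (row ! k) \<partial>?B) = (\<integral>\<^sup>+b. of_bool b \<partial>map_pmf (\<lambda>row. row ! k) ?B)" by simp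
    also have "\<dots> = ennreal p" using assms by (simp only: nth_replicate_pmf) simp
    finally show ?thesis .
  qed
  have f': "f (X @ row # Y) = g X" if "X \<in> set_pmf (clocks p i K)" for X row Y
    using f clocks_lengthD[OF that] by simp
  have nth: "(X @ row # Y) ! i = row" if "X \<in> set_pmf (clocks p i K)" for X row Y
    using clocks_lengthD[OF that] by (simp add: nth_append)
  have "(\<integral>\<^sup>+SS. of_bool (SS ! i ! k) * f SS \<partial>clocks p R K)
      = (\<integral>\<^sup>+X. \<integral>\<^sup>+row. of_bool (row ! k) * g X \<partial>?B \<partial>clocks p i K)"
    unfolding clocks_split[OF assms(1)]
    by (simp, rule nn_integral_pmf_cong) (simp add: f' nth measure_pmf.emeasure_space_1)
  also have "\<dots> = ennreal p * (\<integral>\<^sup>+X. g X \<partial>clocks p i K)"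
    by (simp add: nn_integral_multc bit nn_integral_cmult)
  also have "(\<integral>\<^sup>+X. g X \<partial>clocks p i K) = (\<integral>\<^sup>+SS. f SS \<partial>clocks p R K)"
    unfolding clocks_split[OF assms(1)]
    by (simp, rule nn_integral_pmf_cong) (simp add: f' measure_pmf.emeasure_space_1)
  finally show ?thesis .
qed

lemma dmoves_grid_prefix:
  assumes "length X = Suc r"
  shows "dmoves (grid (X @ Z)) r k = dmoves (grid X) r k"
  by (rule dmoves_cong) (use assms in \<open>auto simp: nth_append\<close>)

lemma nn_integral_dmoves_0:
  assumes "0 \<le> p" "p \<le> 1" "0 < R" "k \<le> K"
  shows "(\<integral>\<^sup>+SS. of_nat (dmoves (grid SS) 0 k) \<partial>clocks p R K) = ennreal (real k * p)"
  using assms(4)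
proof (induction k)
  case (Suc k)
  have "(\<integral>\<^sup>+SS. of_bool (SS ! 0 ! k) \<partial>clocks p R K) = ennreal p"
    using nn_integral_clock_bit[of 0 R k K p "\<lambda>_. 1" "\<lambda>_. 1"] Suc.prems assms
    by (simp add: measure_pmf.emeasure_space_1)
  then show ?case
    using Suc assms by (simp add: nn_integral_add ennreal_plus[symmetric] algebra_simps del: ennreal_plus)
qed simp

lemma mean_moves_le:
  assumes "0 \<le> p" "p \<le> 1"
  shows "mean_moves p r K \<le> ennreal (real K * p)"
proof -
  have "mean_moves p r K \<le> (\<integral>\<^sup>+SS. of_nat (dmoves (grid SS) 0 K) \<partial>clocks p (Suc r) K)"
    unfolding mean_moves_def by (intro nn_integral_mono of_nat_mono dmoves_antimono) simp
  then show ?thesis using nn_integral_dmoves_0[of p "Suc r" K K] assms by simp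
qed

text \<open>
  The first move of particle \<open>r + 1\<close> needs an earlier move of particle \<open>r\<close>; iterating gives
  decay in \<open>r\<close> faster than any geometric rate.
\<close>

lemma nn_integral_dmoves_le:
  assumes p: "0 \<le> p" "p \<le> 1" and x: "0 < x"
  shows "r < R \<Longrightarrow> k \<le> K \<Longrightarrow>
    (\<integral>\<^sup>+SS. of_nat (dmoves (grid SS) r k) \<partial>clocks p R K) \<le> ennreal ((1 + p * x) ^ k / x ^ Suc r)"
proof (induction k arbitrary: r)
  case 0
  then show ?case by simp
next
  case (Suc k)
  show ?case
  proof (cases r)
    case 0
    have "1 + real (Suc k) * (p * x) \<le> (1 + p * x) ^ Suc k"
      using p x by (intro Bernoulli_inequality) (smt (verit) mult_nonneg_nonneg)
    then have "real (Suc k) * p \<le> (1 + p * x) ^ Suc k / x"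
      using x by (simp only: pos_le_divide_eq mult.assoc le_add_same_cancel2)
    then show ?thesis using 0 Suc.prems p nn_integral_dmoves_0[of p R "Suc k" K]
      by (simp del: dmoves.simps power_Suc add: ennreal_leI)
  next
    case (Suc q)
    let ?P = "clocks p R K"
    have "(\<integral>\<^sup>+SS. of_nat (dmoves (grid SS) r (Suc k)) \<partial>?P)
       \<le> (\<integral>\<^sup>+SS. of_nat (dmoves (grid SS) r k) + of_bool (SS ! r ! k) * of_nat (dmoves (grid SS) q k) \<partial>?P)"
    proof (rule nn_integral_mono)
      fix SS
      \<comment> \<open>A move of particle \<open>r\<close> requires its predecessor to be strictly
        ahead, hence to have moved at least once; this bounds the increment by a bit of row
        \<open>r\<close> times the count of row \<open>q\<close>, and the two are
        independent.\<close>
      have "dmoves (grid SS) r (Suc k) \<le> dmoves (grid SS) r k + of_bool (SS ! r ! k) * dmoves (grid SS) q k"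
        using dmoves_Suc_le[of "grid SS" q k] Suc by auto
      then have "(of_nat (dmoves (grid SS) r (Suc k)) :: ennreal)
          \<le> of_nat (dmoves (grid SS) r k + of_bool (SS ! r ! k) * dmoves (grid SS) q k)"
        by (rule of_nat_mono)
      then show "of_nat (dmoves (grid SS) r (Suc k))
         \<le> of_nat (dmoves (grid SS) r k) + of_bool (SS ! r ! k) * (of_nat (dmoves (grid SS) q k) :: ennreal)"
        by simp
    qed
    also have "\<dots> = (\<integral>\<^sup>+SS. of_nat (dmoves (grid SS) r k) \<partial>?P)
        + ennreal p * (\<integral>\<^sup>+SS. of_nat (dmoves (grid SS) q k) \<partial>?P)"
    proof -
      have "(\<integral>\<^sup>+SS. of_bool (SS ! r ! k) * of_nat (dmoves (grid SS) q k) \<partial>?P)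
         = ennreal p * (\<integral>\<^sup>+SS. of_nat (dmoves (grid SS) q k) \<partial>?P)"
        by (rule nn_integral_clock_bit[where g = "\<lambda>X. of_nat (dmoves (grid X) q k)"])
          (use Suc.prems p Suc in \<open>auto simp: dmoves_grid_prefix\<close>)
      then show ?thesis by (simp add: nn_integral_add)
    qed
    also have "\<dots> \<le> ennreal ((1 + p * x) ^ k / x ^ Suc r) + ennreal p * ennreal ((1 + p * x) ^ k / x ^ Suc q)"
      using Suc.prems Suc by (intro add_mono mult_left_mono Suc.IH) auto
    also have "\<dots> = ennreal ((1 + p * x) ^ k / x ^ Suc r + p * ((1 + p * x) ^ k / x ^ Suc q))"
      using p x by (simp add: ennreal_mult[symmetric] ennreal_plus[symmetric] del: ennreal_plus)
    \<comment> \<open>The bound is chosen to satisfy the recursion with equality: lowering the index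
      by one gains a factor \<open>x\<close>, and the two terms combine to the factor
      \<open>1 + p * x\<close>.\<close>
    also have "(1 + p * x) ^ k / x ^ Suc r + p * ((1 + p * x) ^ k / x ^ Suc q) = (1 + p * x) ^ Suc k / x ^ Suc r"
      using x Suc by (simp add: field_simps)
    finally show ?thesis .
  qed
qed

text \<open>Replacing the power by an exponential leaves only \<open>real K * p\<close>, which stays
  bounded as the mesh is refined.\<close>

lemma mean_moves_decay:
  assumes "0 \<le> p" "p \<le> 1" "0 < x"
  shows "mean_moves p r K \<le> ennreal (exp (real K * p * x) / x ^ Suc r)"
proof -
  have "(1 + p * x) ^ K \<le> exp (p * x) ^ K"
    using assms by (intro power_mono exp_ge_add_one_self) (smt (verit) mult_nonneg_nonneg)
  then have "(1 + p * x) ^ K / x ^ Suc r \<le> exp (real K * p * x) / x ^ Suc r"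
    using assms by (intro divide_right_mono) (auto simp: exp_of_nat_mult[symmetric] mult.assoc)
  moreover have "mean_moves p r K \<le> ennreal ((1 + p * x) ^ K / x ^ Suc r)"
    unfolding mean_moves_def by (rule nn_integral_dmoves_le) (use assms in auto)
  ultimately show ?thesis by (meson ennreal_leI order_trans)
qed

section \<open>Coupled stationary systems and the upper bound for the moves\<close>

definition coupled_arrivals :: "real \<Rightarrow> real \<Rightarrow> real \<Rightarrow> (bool \<times> bool) pmf" where
  "coupled_arrivals p \<alpha> \<beta> =
     map_pmf (\<lambda>(x, y). (x, x \<and> y)) (pair_pmf (bernoulli_pmf (\<alpha> * p)) (bernoulli_pmf (\<beta> / \<alpha>)))"

text \<open>The parameters of the auxiliary variable are the quotients that \<open>mgeo_min\<close>
  multiplies back to those of the stationary queue for \<alpha>. The smaller queue, for \<alpha>, is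
  the first component.\<close>

definition coupled_queues :: "real \<Rightarrow> real \<Rightarrow> real \<Rightarrow> (nat \<times> nat) pmf" where
  "coupled_queues p \<alpha> \<gamma> = map_pmf (\<lambda>(q, z). (min q z, q))
     (pair_pmf (stat_queue p \<gamma>) (mgeo (\<alpha> / \<gamma>) (queue_ratio p \<alpha> / queue_ratio p \<gamma>)))"

lemma bernoulli_pmf_eqI:
  assumes "pmf P True = c" "0 \<le> c" "c \<le> 1"
  shows "P = bernoulli_pmf c"
proof (rule pmf_eqI)
  have "pmf P False = 1 - c"
  proof -
    have "measure P {True, False} = 1" using measure_pmf.prob_space[of P] by (simp add: UNIV_bool insert_commute)
    moreover have "measure P {True, False} = pmf P True + pmf P False"
      by (subst measure_measure_pmf_finite) auto
    ultimately show ?thesis using assms by simp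
  qed
  then show "pmf P b = pmf (bernoulli_pmf c) b" for b using assms by (cases b) auto
qed

text \<open>The third marginal concerns the excess arrivals, present for \<alpha> and absent for
  \<beta>; their number in the first \<open>m\<close> cells is the offset in the comparison with the
  system for \<beta>.\<close>

lemma coupled_arrivals_marginals:
  assumes "0 < p" "p < 1" "0 < \<beta>" "\<beta> < \<alpha>" "\<alpha> < 1"
  shows "map_pmf fst (coupled_arrivals p \<alpha> \<beta>) = bernoulli_pmf (\<alpha> * p)"
    and "map_pmf snd (coupled_arrivals p \<alpha> \<beta>) = bernoulli_pmf (\<beta> * p)"
    and "map_pmf (\<lambda>(a, b). a \<and> \<not> b) (coupled_arrivals p \<alpha> \<beta>) = bernoulli_pmf ((\<alpha> - \<beta>) * p)"
proof -
  have a: "0 < \<alpha> * p" "\<alpha> * p < 1" "0 < \<beta> / \<alpha>" "\<beta> / \<alpha> < 1" "0 < \<beta> * p" "\<beta> * p < \<alpha> * p"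
    using assms one_minus_queue_ratio(2)[of p \<alpha>] by simp_all
  show "map_pmf fst (coupled_arrivals p \<alpha> \<beta>) = bernoulli_pmf (\<alpha> * p)"
    by (simp add: coupled_arrivals_def map_pmf_comp case_prod_unfold map_fst_pair_pmf)
  let ?P = "pair_pmf (bernoulli_pmf (\<alpha> * p)) (bernoulli_pmf (\<beta> / \<alpha>))"
  have pm: "measure ?P {(True, b)} = \<alpha> * p * pmf (bernoulli_pmf (\<beta> / \<alpha>)) b" for b
  proof -
    have "pmf (bernoulli_pmf (\<alpha> * p)) True = \<alpha> * p" using a by (intro pmf_bernoulli_True) auto
    then show ?thesis by (simp add: measure_pmf_single pmf_pair)
  qed
  show "map_pmf snd (coupled_arrivals p \<alpha> \<beta>) = bernoulli_pmf (\<beta> * p)"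
  proof (rule bernoulli_pmf_eqI)
    have "map_pmf snd (coupled_arrivals p \<alpha> \<beta>) = map_pmf (\<lambda>x. fst x \<and> snd x) ?P"
      unfolding coupled_arrivals_def map_pmf_comp by (rule map_pmf_cong[OF refl]) (simp add: case_prod_unfold)
    moreover have "(\<lambda>x. fst x \<and> snd x) -` {True} = {(True, True)}"
      by (rule set_eqI) (simp only: vimage_eq singleton_iff prod_eq_iff fst_conv snd_conv eq_True)
    ultimately have "pmf (map_pmf snd (coupled_arrivals p \<alpha> \<beta>)) True = measure ?P {(True, True)}"
      by (simp only: pmf_map)
    also have "\<dots> = \<beta> * p"
    proof -
      have "pmf (bernoulli_pmf (\<beta> / \<alpha>)) True = \<beta> / \<alpha>" using a by (intro pmf_bernoulli_True) auto
      then show ?thesis using assms(3,4) by (simp add: pm)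
    qed
    finally show "pmf (map_pmf snd (coupled_arrivals p \<alpha> \<beta>)) True = \<beta> * p" .
  qed (use a in auto)
  show "map_pmf (\<lambda>(a, b). a \<and> \<not> b) (coupled_arrivals p \<alpha> \<beta>) = bernoulli_pmf ((\<alpha> - \<beta>) * p)"
  proof (rule bernoulli_pmf_eqI)
    have "map_pmf (\<lambda>(a, b). a \<and> \<not> b) (coupled_arrivals p \<alpha> \<beta>) = map_pmf (\<lambda>x. fst x \<and> \<not> snd x) ?P"
      unfolding coupled_arrivals_def map_pmf_comp by (rule map_pmf_cong[OF refl]) (simp add: case_prod_unfold, blast)
    moreover have "(\<lambda>x. fst x \<and> \<not> snd x) -` {True} = {(True, False)}"
      by (rule set_eqI) (simp only: vimage_eq singleton_iff prod_eq_iff fst_conv snd_conv eq_True eq_False)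
    ultimately have "pmf (map_pmf (\<lambda>(a, b). a \<and> \<not> b) (coupled_arrivals p \<alpha> \<beta>)) True = measure ?P {(True, False)}"
      by (simp only: pmf_map)
    also have "\<dots> = (\<alpha> - \<beta>) * p"
    proof -
      have "pmf (bernoulli_pmf (\<beta> / \<alpha>)) False = 1 - \<beta> / \<alpha>" using a by (intro pmf_bernoulli_False) auto
      then show ?thesis using assms(3,4) by (simp add: pm right_diff_distrib left_diff_distrib)
    qed
    finally show "pmf (map_pmf (\<lambda>(a, b). a \<and> \<not> b) (coupled_arrivals p \<alpha> \<beta>)) True = (\<alpha> - \<beta>) * p" .
    show "0 \<le> (\<alpha> - \<beta>) * p" using assms by simp
    have "(\<alpha> - \<beta>) * p = \<alpha> * p - \<beta> * p" by (simp add: algebra_simps)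
    then show "(\<alpha> - \<beta>) * p \<le> 1" using a by linarith
  qed
qed

lemma coupled_queues_marginals:
  assumes "0 < p" "p < 1" "0 < \<alpha>" "\<alpha> < \<gamma>" "\<gamma> < 1"
  shows "map_pmf fst (coupled_queues p \<alpha> \<gamma>) = stat_queue p \<alpha>"
    and "map_pmf snd (coupled_queues p \<alpha> \<gamma>) = stat_queue p \<gamma>"
proof -
  have s: "0 < queue_ratio p \<alpha>" "0 < queue_ratio p \<gamma>" "queue_ratio p \<gamma> < 1"
    using queue_ratio_bounds assms by auto
  \<comment> \<open>Monotonicity of the ratio in the intensity makes the quotient used in
    \<open>coupled_queues\<close> smaller than \<open>1\<close>.\<close>
  have lt: "queue_ratio p \<alpha> < queue_ratio p \<gamma>"
  proof -
    have "\<alpha> * p < 1" "\<gamma> * p < 1" using assms one_minus_queue_ratio(2)[of p] by auto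
    moreover have "\<alpha> * (1 - p) * (1 - \<gamma> * p) < \<gamma> * (1 - p) * (1 - \<alpha> * p)"
    proof -
      have "0 < (1 - p) * (\<gamma> - \<alpha>)" using assms by simp
      then show ?thesis by (simp add: algebra_simps)
    qed
    moreover have "a / b < c / d" if "0 < b" "0 < d" "a * d < c * b" for a b c d :: real
      using that by (simp add: field_simps)
    ultimately show ?thesis by (simp add: queue_ratio_def)
  qed
  show "map_pmf snd (coupled_queues p \<alpha> \<gamma>) = stat_queue p \<gamma>"
    by (simp add: coupled_queues_def map_pmf_comp case_prod_unfold map_fst_pair_pmf)
  have "map_pmf fst (coupled_queues p \<alpha> \<gamma>) = mgeo (\<gamma> * (\<alpha> / \<gamma>)) (queue_ratio p \<gamma> * (queue_ratio p \<alpha> / queue_ratio p \<gamma>))"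
    using mgeo_min[of \<gamma> "queue_ratio p \<gamma>" "\<alpha> / \<gamma>" "queue_ratio p \<alpha> / queue_ratio p \<gamma>"] assms s lt
    by (simp add: coupled_queues_def map_pmf_comp case_prod_unfold stat_queue_def)
  then show "map_pmf fst (coupled_queues p \<alpha> \<gamma>) = stat_queue p \<alpha>"
    using assms s by (simp add: stat_queue_def)
qed

lemma noise_mono:
  assumes "0 \<le> p" "\<alpha> \<le> \<gamma>" "\<gamma> < 1"
  shows "noise p R K \<alpha> \<le> noise p R K \<gamma>"
proof -
  have "4 * real R / (1 - \<alpha>)\<^sup>2 \<le> 4 * real R / (1 - \<gamma>)\<^sup>2"
    using assms by (intro divide_left_mono power_mono mult_pos_pos zero_less_power) auto
  then show ?thesis by (simp add: noise_def)
qed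

lemma spread_prefix_sum:
  assumes c: "centered P f \<mu> v" and "m \<le> n" and le: "real m * v \<le> w"
  shows "spread (replicate_pmf n P) (\<lambda>xs. \<Sum>j<m. f (xs ! j)) (real m * \<mu>) w"
proof -
  have "spread (map_pmf (take m) (replicate_pmf n P)) (\<lambda>xs. \<Sum>x\<leftarrow>xs. f x) (real m * \<mu>) w"
    unfolding take_replicate_pmf[OF \<open>m \<le> n\<close>]
    by (rule spread_mono[OF centered_spread[OF centered_sum_list[OF c]] le])
  then have "spread (replicate_pmf n P) (\<lambda>xs. \<Sum>x\<leftarrow>take m xs. f x) (real m * \<mu>) w"
    by (simp add: spread_map)
  then show ?thesis
  proof (subst spread_cong)
    fix xs assume "xs \<in> set_pmf (replicate_pmf n P)"
    then have "length xs = n" by (auto simp: set_replicate_pmf)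
    then show "(\<Sum>j<m. f (xs ! j)) = (\<Sum>x\<leftarrow>take m xs. f x)"
      using \<open>m \<le> n\<close> by (simp add: sum_list_sum_nth atLeast0LessThan)
  qed
qed

lemma height_cong:
  assumes "\<And>j. j < k \<Longrightarrow> a j = a' j" "\<And>j. j < i \<Longrightarrow> Q j = Q' j"
  shows "height a Q S i k = height a' Q' S i k"
  using assms by (induction a Q S i k rule: height.induct) (auto intro!: sum.cong simp del: sum_of_bool_eq)

text \<open>
  Only two couplings are needed for \<open>height_ge_min\<close>: arrivals for \<open>\<beta>\<close> are a thinning of those for \<open>\<alpha>\<close>,
  and initial queues for \<open>\<alpha>\<close> are dominated by those for \<open>\<gamma>\<close>.
\<close>

type_synonym sample =
  "(bool \<times> bool) list \<times> bool list \<times> (nat \<times> nat) list \<times> nat list \<times> bool list list"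

text \<open>The components are the arrivals for \<alpha> and \<beta>, the arrivals for \<gamma>, the
  initial queues for \<alpha> and \<gamma>, the initial queues for \<beta>, and the clocks, which
  all three systems share.\<close>

definition joint :: "real \<Rightarrow> nat \<Rightarrow> nat \<Rightarrow> real \<Rightarrow> real \<Rightarrow> real \<Rightarrow> sample pmf" where
  "joint p R K \<alpha> \<beta> \<gamma> = pair_pmf (replicate_pmf K (coupled_arrivals p \<alpha> \<beta>))
     (pair_pmf (replicate_pmf K (bernoulli_pmf (\<gamma> * p)))
       (pair_pmf (replicate_pmf R (coupled_queues p \<alpha> \<gamma>))
         (pair_pmf (replicate_pmf R (stat_queue p \<beta>)) (clocks p R K))))"

text \<open>By \<open>height_ge_min\<close> every sample falls under one of three alternatives:
  either the moves are at most \<open>1 + Z\<close>, the case of an exit near the corner, or one of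
  the comparison variables \<open>X\<close> and \<open>Y\<close> is nonpositive. These are centred
  at \<open>\<mu>\<beta>\<close> and \<open>\<mu>\<gamma>\<close>, whose positivity gives Chebyshev
  bounds for the bad events. There the moves are estimated by \<open>B\<close>, the number of cells
  in which the first clock rings.\<close>

lemma mean_moves_le_deviation:
  fixes p \<alpha> \<beta> \<gamma> s :: real
  assumes p: "0 < p" "p < 1" and par: "0 < \<beta>" "\<beta> < \<alpha>" "\<alpha> < \<gamma>" "\<gamma> < 1"
    and R: "R = Suc r" and ml: "m \<le> K" "l \<le> R" and s: "0 < s"
  defines "\<mu>\<beta> \<equiv> mean_height p R K \<beta> - mean_height p R K \<alpha> + real m * ((\<alpha> - \<beta>) * p)"
    and "\<mu>\<gamma> \<equiv> mean_height p R K \<gamma> - mean_height p R K \<alpha> + real l * (mean_queue p \<gamma> - mean_queue p \<alpha>)"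
    and "w \<equiv> noise p R K \<gamma>"
  assumes pos: "0 < \<mu>\<beta>" "0 < \<mu>\<gamma>"
  shows "mean_moves p r K \<le>
    ennreal (1 + mean_height p R K \<alpha> + real m * p + real l * mean_queue p \<alpha>)
    + ennreal (2 * s + 11 * w / s + real K * p * (10 * w / \<mu>\<beta>\<^sup>2 + 16 * w / \<mu>\<gamma>\<^sup>2))"
proof -
  let ?P = "joint p R K \<alpha> \<beta> \<gamma>"
  have a1: "0 < \<alpha>" "\<alpha> < 1" "\<beta> < 1" "0 < \<gamma>" using par by auto
  note [simp] = coupled_arrivals_marginals[OF p par(1,2) a1(2)] coupled_queues_marginals[OF p a1(1) par(3,4)]
  \<comment> \<open>The noise grows with the intensity, so its value at \<gamma> serves all three
    systems and the prefix sums as well.\<close>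
  have w: "noise p R K \<alpha> \<le> w" "noise p R K \<beta> \<le> w" "noise p R K \<gamma> \<le> w"
    unfolding w_def using p par by (intro noise_mono; simp)+
  have w_ge: "real K * p \<le> w" "2 * real R / (1 - \<gamma>)\<^sup>2 \<le> w"
    using p par by (auto simp: w_def noise_def intro!: add_increasing2 add_increasing divide_right_mono)
  define H\<alpha> H\<beta> H\<gamma> :: "sample \<Rightarrow> int" where
    "H\<alpha> = (\<lambda>(AB, Cs, QQ, Qb, SS).
        height (\<lambda>k. map fst AB ! k) (\<lambda>i. map fst QQ ! i) (grid SS) R K)" and
    "H\<beta> = (\<lambda>(AB, Cs, QQ, Qb, SS).
        height (\<lambda>k. map snd AB ! k) (\<lambda>i. Qb ! i) (grid SS) R K)" and
    "H\<gamma> = (\<lambda>(AB, Cs, QQ, Qb, SS).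
        height (\<lambda>k. Cs ! k) (\<lambda>i. map snd QQ ! i) (grid SS) R K)"
  define U C D E B :: "sample \<Rightarrow> real" where
    "U = (\<lambda>(AB, Cs, QQ, Qb, SS).
        \<Sum>j<m. of_bool (map (\<lambda>(a, b). a \<and> \<not> b) AB ! j) :: real)" and
    "C = (\<lambda>(AB, Cs, QQ, Qb, SS).
        \<Sum>j<m. of_bool (hd SS ! j) :: real)" and
    "D = (\<lambda>(AB, Cs, QQ, Qb, SS).
        \<Sum>j<l. real (map fst QQ ! j))" and
    "E = (\<lambda>(AB, Cs, QQ, Qb, SS).
        \<Sum>j<l. real (map snd QQ ! j))" and
    "B = (\<lambda>(AB, Cs, QQ, Qb, SS).
        \<Sum>j<K. of_bool (hd SS ! j) :: real)"
  have law\<alpha>: "map_pmf (\<lambda>(AB, Cs, QQ, Qb, SS). (map fst AB, map fst QQ, SS)) ?P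
     = pair_pmf (replicate_pmf K (bernoulli_pmf (\<alpha> * p))) (pair_pmf (replicate_pmf R (stat_queue p \<alpha>)) (clocks p R K))"
  proof -
    have "pair_pmf (map_pmf (map fst) (replicate_pmf K (coupled_arrivals p \<alpha> \<beta>)))
        (pair_pmf (map_pmf (map fst) (replicate_pmf R (coupled_queues p \<alpha> \<gamma>))) (clocks p R K))
      = map_pmf (\<lambda>(AB, Cs, QQ, Qb, SS). (map fst AB, map fst QQ, SS)) ?P"
      by (simp add: joint_def pair_pmf_def map_bind_pmf bind_map_pmf bind_assoc_pmf bind_return_pmf)
    then show ?thesis by (simp add: map_replicate_pmf)
  qed
  have law\<beta>: "map_pmf (\<lambda>(AB, Cs, QQ, Qb, SS). (map snd AB, Qb, SS)) ?P
     = pair_pmf (replicate_pmf K (bernoulli_pmf (\<beta> * p))) (pair_pmf (replicate_pmf R (stat_queue p \<beta>)) (clocks p R K))"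
  proof -
    have "pair_pmf (map_pmf (map snd) (replicate_pmf K (coupled_arrivals p \<alpha> \<beta>)))
        (pair_pmf (replicate_pmf R (stat_queue p \<beta>)) (clocks p R K))
      = map_pmf (\<lambda>(AB, Cs, QQ, Qb, SS). (map snd AB, Qb, SS)) ?P"
      by (simp add: joint_def pair_pmf_def map_bind_pmf bind_map_pmf bind_assoc_pmf bind_return_pmf)
    then show ?thesis by (simp add: map_replicate_pmf)
  qed
  have law\<gamma>: "map_pmf (\<lambda>(AB, Cs, QQ, Qb, SS). (Cs, map snd QQ, SS)) ?P
     = pair_pmf (replicate_pmf K (bernoulli_pmf (\<gamma> * p))) (pair_pmf (replicate_pmf R (stat_queue p \<gamma>)) (clocks p R K))"
  proof -
    have "pair_pmf (replicate_pmf K (bernoulli_pmf (\<gamma> * p)))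
        (pair_pmf (map_pmf (map snd) (replicate_pmf R (coupled_queues p \<alpha> \<gamma>))) (clocks p R K))
      = map_pmf (\<lambda>(AB, Cs, QQ, Qb, SS). (Cs, map snd QQ, SS)) ?P"
      by (simp add: joint_def pair_pmf_def map_bind_pmf bind_map_pmf bind_assoc_pmf bind_return_pmf)
    then show ?thesis by (simp add: map_replicate_pmf)
  qed
  have "spread ?P (\<lambda>x. real_of_int (H\<alpha> x)) (mean_height p R K \<alpha>) (noise p R K \<alpha>)"
    using spread_height[OF p a1(1,2), of K R] unfolding law\<alpha>[symmetric] spread_map
    by (simp add: H\<alpha>_def case_prod_unfold)
  then have S\<alpha>: "spread ?P (\<lambda>x. real_of_int (H\<alpha> x)) (mean_height p R K \<alpha>) w"
    using w spread_mono by blast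
  have "spread ?P (\<lambda>x. real_of_int (H\<beta> x)) (mean_height p R K \<beta>) (noise p R K \<beta>)"
    using spread_height[OF p par(1) a1(3), of K R] unfolding law\<beta>[symmetric] spread_map
    by (simp add: H\<beta>_def case_prod_unfold)
  then have S\<beta>: "spread ?P (\<lambda>x. real_of_int (H\<beta> x)) (mean_height p R K \<beta>) w"
    using w spread_mono by blast
  have "spread ?P (\<lambda>x. real_of_int (H\<gamma> x)) (mean_height p R K \<gamma>) (noise p R K \<gamma>)"
    using spread_height[OF p a1(4) par(4), of K R] unfolding law\<gamma>[symmetric] spread_map
    by (simp add: H\<gamma>_def case_prod_unfold)
  then have S\<gamma>: "spread ?P (\<lambda>x. real_of_int (H\<gamma> x)) (mean_height p R K \<gamma>) w"
    using w spread_mono by blast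

  have lawAB: "map_pmf fst ?P = replicate_pmf K (coupled_arrivals p \<alpha> \<beta>)"
    by (simp add: joint_def map_fst_pair_pmf)
  have lawQQ: "map_pmf (\<lambda>x. fst (snd (snd x))) ?P = replicate_pmf R (coupled_queues p \<alpha> \<gamma>)"
  proof -
    have "map_pmf (\<lambda>x. fst (snd (snd x))) ?P = map_pmf fst (map_pmf snd (map_pmf snd ?P))"
      by (simp add: map_pmf_comp)
    then show ?thesis by (simp add: joint_def map_fst_pair_pmf map_snd_pair_pmf)
  qed
  have lawS: "map_pmf (\<lambda>x. hd (snd (snd (snd (snd x))))) ?P = replicate_pmf K (bernoulli_pmf p)"
  proof -
    have "map_pmf (\<lambda>x. hd (snd (snd (snd (snd x))))) ?P = map_pmf hd (map_pmf snd (map_pmf snd (map_pmf snd (map_pmf snd ?P))))"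
      by (simp add: map_pmf_comp)
    then show ?thesis by (simp add: joint_def map_snd_pair_pmf clocks_def R map_bind_pmf bind_return_pmf')
  qed
  have pm: "real m * p \<le> real K * p" using ml p by (simp add: mult_right_mono)
  have U: "spread ?P U (real m * ((\<alpha> - \<beta>) * p)) w"
  proof -
    have b: "0 \<le> (\<alpha> - \<beta>) * p" "(\<alpha> - \<beta>) * p \<le> 1 * p" using p par by (auto intro: mult_right_mono)
    have b1: "(\<alpha> - \<beta>) * p \<le> 1" using b(2) p by linarith
    have "real m * ((\<alpha> - \<beta>) * p) \<le> w"
      using mult_left_mono[OF b(2), of "real m"] pm w_ge(1) by simp
    then have "spread (replicate_pmf K (bernoulli_pmf ((\<alpha> - \<beta>) * p))) (\<lambda>xs. \<Sum>j<m. of_bool (xs ! j)) (real m * ((\<alpha> - \<beta>) * p)) w"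
      by (intro spread_prefix_sum[OF centered_bernoulli] b(1) b1 ml)
    then have "spread (map_pmf (map (\<lambda>(a, b). a \<and> \<not> b)) (map_pmf fst ?P)) (\<lambda>xs. \<Sum>j<m. of_bool (xs ! j)) (real m * ((\<alpha> - \<beta>) * p)) w"
      unfolding lawAB map_replicate_pmf by simp
    then show ?thesis by (simp add: spread_map U_def case_prod_unfold del: sum_of_bool_eq)
  qed
  have S: "spread ?P (\<lambda>x. \<Sum>j<n. of_bool (hd (snd (snd (snd (snd x)))) ! j)) (real n * p) w" if "n \<le> K" for n
  proof -
    have "real n * p \<le> w" using that p order_trans[OF mult_right_mono[of "real n" "real K" p] w_ge(1)] by simp
    then have "spread (replicate_pmf K (bernoulli_pmf p)) (\<lambda>xs. \<Sum>j<n. of_bool (xs ! j)) (real n * p) w"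
      using p that by (intro spread_prefix_sum[OF centered_bernoulli]) auto
    then show ?thesis unfolding lawS[symmetric] by (simp add: spread_map del: sum_of_bool_eq)
  qed
  have C: "spread ?P C (real m * p) w" and B: "spread ?P B (real K * p) w"
    using S[of m] S[of K] ml by (simp_all add: C_def B_def case_prod_unfold del: sum_of_bool_eq)
  have lw: "real l * (2 / (1 - \<delta>)\<^sup>2) \<le> w" if "\<delta> \<le> \<gamma>" for \<delta>
  proof -
    have "real l * (2 / (1 - \<delta>)\<^sup>2) \<le> real R * (2 / (1 - \<gamma>)\<^sup>2)"
      using ml par that by (intro mult_mono divide_left_mono power_mono mult_pos_pos zero_less_power) auto
    then show ?thesis using w_ge(2) by (simp add: mult.commute)
  qed
  have D: "spread ?P D (real l * mean_queue p \<alpha>) w"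
  proof -
    have "spread (replicate_pmf R (stat_queue p \<alpha>)) (\<lambda>xs. \<Sum>j<l. real (xs ! j)) (real l * mean_queue p \<alpha>) w"
      using p par ml lw[of \<alpha>] by (intro spread_prefix_sum[OF centered_stat_queue]) auto
    then have "spread (map_pmf (map fst) (map_pmf (\<lambda>x. fst (snd (snd x))) ?P)) (\<lambda>xs. \<Sum>j<l. real (xs ! j)) (real l * mean_queue p \<alpha>) w"
      unfolding lawQQ map_replicate_pmf by simp
    then show ?thesis by (simp add: spread_map D_def case_prod_unfold)
  qed
  have E: "spread ?P E (real l * mean_queue p \<gamma>) w"
  proof -
    have "spread (replicate_pmf R (stat_queue p \<gamma>)) (\<lambda>xs. \<Sum>j<l. real (xs ! j)) (real l * mean_queue p \<gamma>) w"
      using p par ml lw[of \<gamma>] by (intro spread_prefix_sum[OF centered_stat_queue]) auto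
    then have "spread (map_pmf (map snd) (map_pmf (\<lambda>x. fst (snd (snd x))) ?P)) (\<lambda>xs. \<Sum>j<l. real (xs ! j)) (real l * mean_queue p \<gamma>) w"
      unfolding lawQQ map_replicate_pmf by simp
    then show ?thesis by (simp add: spread_map E_def case_prod_unfold)
  qed

  define X where "X x = real_of_int (H\<beta> x) - real_of_int (H\<alpha> x) + U x" for x
  define Y where "Y x = real_of_int (H\<gamma> x) - real_of_int (H\<alpha> x) + (E x - D x)" for x
  define Z where "Z x = real_of_int (H\<alpha> x) + C x + D x" for x
  define \<nu> where "\<nu> = mean_height p R K \<alpha> + real m * p + real l * mean_queue p \<alpha>"
  \<comment> \<open>Each sum of two variables doubles the bounds:
    \<open>2 * (2 * w + 2 * w) + 2 * w\<close> gives the \<open>10\<close> of \<open>X\<close> and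
    \<open>Z\<close>, and \<open>2 * (4 * w) + 2 * (4 * w)\<close> the \<open>16\<close> of
    \<open>Y\<close>. The \<open>11\<close> of the conclusion is the \<open>10\<close> of
    \<open>Z\<close> plus the \<open>1\<close> of \<open>B\<close>.\<close>
  have X: "spread ?P X \<mu>\<beta> (10 * w)"
    using spread_add[OF spread_diff[OF S\<beta> S\<alpha>] U] by (simp add: X_def[abs_def] \<mu>\<beta>_def)
  have Y: "spread ?P Y \<mu>\<gamma> (16 * w)"
    using spread_add[OF spread_diff[OF S\<gamma> S\<alpha>] spread_diff[OF E D]]
    by (simp add: Y_def[abs_def] \<mu>\<gamma>_def right_diff_distrib)
  have Z: "spread ?P Z \<nu> (10 * w)"
    using spread_add[OF spread_add[OF S\<alpha> C] D] by (simp add: Z_def[abs_def] \<nu>_def)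

  let ?N = "\<lambda>x. dmoves (grid (snd (snd (snd (snd x))))) r K"
  \<comment> \<open>Only the constant \<open>real K * p\<close> is multiplied by the indicators; the
    fluctuation of \<open>B\<close> is added on every sample, so no mixed moment of \<open>B\<close>
    with an indicator arises.\<close>
  have key: "of_nat (?N x) \<le> ennreal (1 + \<nu>) + ennreal \<bar>Z x - \<nu>\<bar> + ennreal \<bar>B x - real K * p\<bar>
      + ennreal (real K * p) * of_bool (X x \<le> 0) + ennreal (real K * p) * of_bool (Y x \<le> 0)"
    if x: "x \<in> set_pmf ?P" for x
  proof -
    obtain AB Cs QQ Qb SS where xe: "x = (AB, Cs, QQ, Qb, SS)" by (cases x) auto
    have len: "length AB = K" "length QQ = R" "length SS = R"
      and sub: "set AB \<subseteq> set_pmf (coupled_arrivals p \<alpha> \<beta>)" "set QQ \<subseteq> set_pmf (coupled_queues p \<alpha> \<gamma>)"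
      using x clocks_lengthD[of SS p R K] by (auto simp: xe joint_def set_replicate_pmf)
    have AB: "b \<Longrightarrow> a" if "(a, b) \<in> set AB" for a b
      using subsetD[OF sub(1) that] by (auto simp: coupled_arrivals_def)
    have QQ: "a \<le> b" if "(a, b) \<in> set QQ" for a b
      using subsetD[OF sub(2) that] by (auto simp: coupled_queues_def)
    have hdS: "hd SS = SS ! 0" using len(3) R by (cases SS) auto
    \<comment> \<open>\<open>height_ge_min\<close> compares the sequences at all indices, whereas
      the coupling orders them only inside the lists; hence the padding by \<open>False\<close> and
      \<open>0\<close>, which the heights in question do not see.\<close>
    define a b Q Qc where "a j = (if j < K then map fst AB ! j else False)"
      and "b j = (if j < K then map snd AB ! j else False)"
      and "Q j = (if j < R then map fst QQ ! j else 0)"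
      and "Qc j = (if j < R then map snd QQ ! j else 0)" for j
    have mem: "j < K \<Longrightarrow> (fst (AB ! j), snd (AB ! j)) \<in> set AB" "j < R \<Longrightarrow> (fst (QQ ! j), snd (QQ ! j)) \<in> set QQ" for j
      using len by auto
    have ab: "b j \<Longrightarrow> a j" for j
      using AB[OF mem(1)] len by (cases "j < K") (auto simp: a_def b_def)
    have QQc: "Q j \<le> Qc j" for j
      using QQ[OF mem(2)] len by (cases "j < R") (auto simp: Q_def Qc_def)
    define c where "c j = Cs ! j" for j
    have hts: "height a Q (grid SS) R K = H\<alpha> x" "height b (\<lambda>i. Qb ! i) (grid SS) R K = H\<beta> x"
      "height c Qc (grid SS) R K = H\<gamma> x"
      by (auto simp: xe H\<alpha>_def H\<beta>_def H\<gamma>_def a_def b_def c_def Q_def Qc_def intro!: height_cong)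
    have U': "real_of_int (\<Sum>j<m. of_bool (a j) - of_bool (b j)) = U x"
    proof -
      have "of_bool (a j) - of_bool (b j) = (of_bool (map (\<lambda>(a, b). a \<and> \<not> b) AB ! j) :: real)" if "j < m" for j
        using that ab[of j] ml len by (auto simp: a_def b_def case_prod_unfold)
      then have "(\<Sum>j<m. of_bool (a j) - of_bool (b j)) = (\<Sum>j<m. of_bool (map (\<lambda>(a, b). a \<and> \<not> b) AB ! j) :: real)"
        by (intro sum.cong) auto
      then show ?thesis by (simp add: xe U_def del: sum_of_bool_eq)
    qed
    have C': "real_of_int (\<Sum>j<m. of_bool (SS ! 0 ! j)) = C x"
      by (simp add: xe C_def hdS)
    have D': "real_of_int (\<Sum>j<l. int (Q j)) = D x"
      using ml by (auto simp: xe D_def Q_def intro!: sum.cong)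
    have ED': "real_of_int (\<Sum>j<l. int (Qc j) - int (Q j)) = E x - D x"
      using ml by (auto simp: xe D_def E_def Q_def Qc_def sum_subtractf[symmetric] intro!: sum.cong)
    have Nx: "?N x = dmoves (grid SS) r K" by (simp add: xe)
    have "int (?N x) - 1 - (\<Sum>j<m. of_bool (SS ! 0 ! j)) - (\<Sum>j<l. int (Q j)) \<le> H\<alpha> x
       \<or> H\<beta> x + (\<Sum>j<m. of_bool (a j) - of_bool (b j)) \<le> H\<alpha> x \<or> H\<gamma> x + (\<Sum>j<l. int (Qc j) - int (Q j)) \<le> H\<alpha> x"
      using height_ge_min[where b = b and a = a and Q = Q and Qc = Qc and S = "grid SS" and r = r and K = K
          and m = m and l = l and Qb = "\<lambda>i. Qb ! i" and c = c, OF ab QQc]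
      unfolding R[symmetric] hts Nx min_le_iff_disj .
    then have cases3: "real (?N x) \<le> 1 + Z x \<or> X x \<le> 0 \<or> Y x \<le> 0"
    proof (elim disjE)
      assume "int (?N x) - 1 - (\<Sum>j<m. of_bool (SS ! 0 ! j)) - (\<Sum>j<l. int (Q j)) \<le> H\<alpha> x"
      then have "real_of_int (int (?N x) - 1 - (\<Sum>j<m. of_bool (SS ! 0 ! j)) - (\<Sum>j<l. int (Q j))) \<le> real_of_int (H\<alpha> x)"
        by (simp only: of_int_le_iff)
      then have "real (?N x) - 1 - C x - D x \<le> real_of_int (H\<alpha> x)"
        unfolding C'[symmetric] D'[symmetric] by (simp only: of_int_diff of_int_of_nat_eq of_int_1)
      then have "real (?N x) \<le> 1 + Z x" unfolding Z_def by linarith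
      then show ?thesis by blast
    next
      assume "H\<beta> x + (\<Sum>j<m. of_bool (a j) - of_bool (b j)) \<le> H\<alpha> x"
      then have "real_of_int (H\<beta> x + (\<Sum>j<m. of_bool (a j) - of_bool (b j))) \<le> real_of_int (H\<alpha> x)"
        by (simp only: of_int_le_iff)
      then have "X x \<le> 0" unfolding X_def U'[symmetric] of_int_add by linarith
      then show ?thesis by blast
    next
      assume "H\<gamma> x + (\<Sum>j<l. int (Qc j) - int (Q j)) \<le> H\<alpha> x"
      then have "real_of_int (H\<gamma> x + (\<Sum>j<l. int (Qc j) - int (Q j))) \<le> real_of_int (H\<alpha> x)"
        by (simp only: of_int_le_iff)
      then have "Y x \<le> 0" unfolding Y_def ED'[symmetric] of_int_add by linarith
      then show ?thesis by blast
    qed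
    have "real (?N x) \<le> B x"
    proof -
      have "real (?N x) \<le> real (dmoves (grid SS) 0 K)" by (simp add: xe dmoves_antimono)
      then show ?thesis by (simp add: xe B_def dmoves_0 hdS)
    qed
    then have N: "real (?N x) \<le> \<bar>B x - real K * p\<bar> + real K * p" by linarith
    have nn: "0 \<le> real K * p" using p by simp
    have N': "of_nat (?N x) \<le> ennreal \<bar>B x - real K * p\<bar> + ennreal (real K * p)"
      using N nn by (simp add: ennreal_of_nat_eq_real_of_nat ennreal_plus[symmetric] ennreal_leI del: ennreal_plus)
    show ?thesis
      using cases3
    proof (elim disjE)
      assume 1: "real (?N x) \<le> 1 + Z x"
      then have "real (?N x) \<le> max 0 (1 + \<nu>) + \<bar>Z x - \<nu>\<bar>" by linarith
      then have "ennreal (real (?N x)) \<le> ennreal (max 0 (1 + \<nu>) + \<bar>Z x - \<nu>\<bar>)" by (rule ennreal_leI)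
      also have "\<dots> = ennreal (max 0 (1 + \<nu>)) + ennreal \<bar>Z x - \<nu>\<bar>" by (rule ennreal_plus) auto
      also have "ennreal (max 0 (1 + \<nu>)) = ennreal (1 + \<nu>)" by (simp add: max_def ennreal_neg)
      finally show ?thesis by (simp add: ennreal_of_nat_eq_real_of_nat add_increasing2)
    next
      assume 2: "X x \<le> 0"
      have "ennreal \<bar>B x - real K * p\<bar> + ennreal (real K * p) \<le> ennreal (1 + \<nu>) + ennreal \<bar>Z x - \<nu>\<bar> + ennreal \<bar>B x - real K * p\<bar>
        + ennreal (real K * p)" by (intro add_mono add_increasing) auto
      from order_trans[OF N' this] 2 show ?thesis by (auto intro: add_increasing2)
    next
      assume 3: "Y x \<le> 0"
      have "ennreal \<bar>B x - real K * p\<bar> + ennreal (real K * p) \<le> ennreal (1 + \<nu>) + ennreal \<bar>Z x - \<nu>\<bar> + ennreal \<bar>B x - real K * p\<bar>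
        + ennreal (real K * p) * of_bool (X x \<le> 0) + ennreal (real K * p)" by (intro add_mono add_increasing2 add_increasing) auto
      from order_trans[OF N' this] 3 show ?thesis by simp
    qed
  qed
  have "mean_moves p r K = (\<integral>\<^sup>+x. of_nat (?N x) \<partial>?P)"
    by (simp add: mean_moves_def joint_def nn_integral_pair_pmf' measure_pmf.emeasure_space_1 R)
  also have "\<dots> \<le> (\<integral>\<^sup>+x. ennreal (1 + \<nu>) + ennreal \<bar>Z x - \<nu>\<bar> + ennreal \<bar>B x - real K * p\<bar>
      + ennreal (real K * p) * of_bool (X x \<le> 0) + ennreal (real K * p) * of_bool (Y x \<le> 0) \<partial>?P)"
    by (rule nn_integral_pmf_mono) (rule key)
  also have "\<dots> = ennreal (1 + \<nu>) + (\<integral>\<^sup>+x. ennreal \<bar>Z x - \<nu>\<bar> \<partial>?P) + (\<integral>\<^sup>+x. ennreal \<bar>B x - real K * p\<bar> \<partial>?P)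
      + ennreal (real K * p) * (\<integral>\<^sup>+x. of_bool (X x \<le> 0) \<partial>?P) + ennreal (real K * p) * (\<integral>\<^sup>+x. of_bool (Y x \<le> 0) \<partial>?P)"
    by (simp add: nn_integral_add nn_integral_cmult measure_pmf.emeasure_space_1)
  also have "\<dots> \<le> ennreal (1 + \<nu>) + ennreal (s + 10 * w / s) + ennreal (s + w / s)
      + ennreal (real K * p) * ennreal (10 * w / \<mu>\<beta>\<^sup>2) + ennreal (real K * p) * ennreal (16 * w / \<mu>\<gamma>\<^sup>2)"
    by (intro add_mono mult_left_mono order_refl spread_abs[OF Z s] spread_abs[OF B s]
        spread_chebyshev[OF X pos(1)] spread_chebyshev[OF Y pos(2)]) auto
  also have "\<dots> = ennreal (1 + \<nu>) + ennreal ((s + 10 * w / s) + (s + w / s)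
      + real K * p * (10 * w / \<mu>\<beta>\<^sup>2) + real K * p * (16 * w / \<mu>\<gamma>\<^sup>2))"
  proof -
    have "0 \<le> w" using S\<alpha> by (simp add: spread_def)
    then show ?thesis using s p
      by (simp add: ennreal_mult[symmetric] ennreal_plus[symmetric] add.assoc del: ennreal_plus)
  qed
  also have "(s + 10 * w / s) + (s + w / s) + real K * p * (10 * w / \<mu>\<beta>\<^sup>2) + real K * p * (16 * w / \<mu>\<gamma>\<^sup>2)
     = 2 * s + 11 * w / s + real K * p * (10 * w / \<mu>\<beta>\<^sup>2 + 16 * w / \<mu>\<gamma>\<^sup>2)"
    by (simp add: field_simps)
  finally show ?thesis by (simp add: \<nu>_def add.assoc)
qed

section \<open>Discretised exponential clocks\<close>

definition psum :: "(nat \<Rightarrow> real) \<Rightarrow> nat \<Rightarrow> real" where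
  "psum f n = (\<Sum>i\<le>n. f i)"

lemma ring_time_psum: "ring_time w r n = psum (w r) n"
  by (simp add: ring_time_def psum_def)

text \<open>Cells are open on the left and closed on the right, in accordance with the
  \<open>\<le>\<close> in \<open>rings_upto\<close>. Several rings in one cell set the same
  bit.\<close>

definition rung :: "real \<Rightarrow> (nat \<Rightarrow> real) \<Rightarrow> nat \<Rightarrow> bool" where
  "rung h f k \<longleftrightarrow> (\<exists>n. real k * h < psum f n \<and> psum f n \<le> real (Suc k) * h)"

text \<open>For positive waits: exactly \<open>n\<close> rings occur up to time \<open>h\<close>.
  With the condition on all \<open>j < n\<close>, both the uniqueness of \<open>n\<close> and the
  recursion over the first wait hold for arbitrary real sequences.\<close>

definition passes :: "(nat \<Rightarrow> real) \<Rightarrow> nat \<Rightarrow> real \<Rightarrow> bool" where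
  "passes f n h \<longleftrightarrow> (\<forall>j<n. psum f j \<le> h) \<and> h < psum f n"

abbreviation expo :: "real measure" where
  "expo \<equiv> density lborel (\<lambda>x. ennreal (exponential_density 1 x))"

interpretation expo: prob_space expo
  by (rule prob_space_exponential_density) simp

lemma sets_expo [measurable_cong]: "sets expo = sets borel" by simp

lemma psum_Stream_0: "psum ((!!) (x ## w)) 0 = x"
  by (simp add: psum_def)

lemma psum_Stream_Suc: "psum ((!!) (x ## w)) (Suc n) = x + psum ((!!) w) n"
  unfolding psum_def by (subst sum.atMost_Suc_shift) simp

lemma passes_Stream_Suc: "passes ((!!) (x ## w)) (Suc n) h \<longleftrightarrow> x \<le> h \<and> passes ((!!) w) n (h - x)"
  unfolding passes_def All_less_Suc2 psum_Stream_0 psum_Stream_Suc by (auto simp: le_diff_eq diff_less_eq add.commute)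

lemma measurable_psum [measurable]: "(\<lambda>w. psum ((!!) w) n) \<in> borel_measurable (stream_space expo)"
proof -
  have "(\<lambda>w. w !! i) \<in> borel_measurable (stream_space expo)" for i
    using measurable_snth[of i expo] by (simp cong: measurable_cong_sets)
  then show ?thesis unfolding psum_def by measurable
qed

lemma measurable_passes [measurable]: "Measurable.pred (stream_space expo) (\<lambda>w. passes ((!!) w) n h)"
  unfolding passes_def by measurable

lemma measurable_rung [measurable]: "Measurable.pred (stream_space expo) (\<lambda>w. rung h ((!!) w) k)"
  unfolding rung_def by measurable

lemma nn_integral_expo:
  assumes [measurable]: "f \<in> borel_measurable borel"
  shows "(\<integral>\<^sup>+x. f x \<partial>expo) = (\<integral>\<^sup>+x. ennreal (exp (- x)) * indicator {0..} x * f x \<partial>lborel)"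
  by (subst nn_integral_density)
    (auto intro!: nn_integral_cong simp: exponential_density_def indicator_def)

text \<open>Memorylessness: on the event that exactly \<open>n\<close> rings occur before time \<open>h\<close>, the remaining clock is fresh.\<close>

lemma nn_integral_passes:
  assumes [measurable]: "G \<in> borel_measurable (stream_space expo)" and "0 \<le> h"
  shows "(\<integral>\<^sup>+w. of_bool (passes ((!!) w) n h) * G ((psum ((!!) w) n - h) ## sdrop (Suc n) w) \<partial>stream_space expo)
    = ennreal (exp (- h) * h ^ n / fact n) * (\<integral>\<^sup>+w. G w \<partial>stream_space expo)"
  using assms(2)
proof (induction n arbitrary: h)
  case 0
  define \<Phi> where "\<Phi> y = (\<integral>\<^sup>+w. G (y ## w) \<partial>stream_space expo)" for y
  interpret S: prob_space "stream_space expo" by (rule expo.prob_space_stream_space)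
  have [measurable]: "\<Phi> \<in> borel_measurable borel"
    unfolding \<Phi>_def by measurable
  have "(\<integral>\<^sup>+w. of_bool (passes ((!!) w) 0 h) * G ((psum ((!!) w) 0 - h) ## sdrop (Suc 0) w) \<partial>stream_space expo)
     = (\<integral>\<^sup>+x. of_bool (h < x) * \<Phi> (x - h) \<partial>expo)"
    by (subst expo.nn_integral_stream_space)
      (simp_all add: passes_def psum_Stream_0 \<Phi>_def nn_integral_cmult)
  also have "\<dots> = (\<integral>\<^sup>+x. ennreal (exp (- x)) * indicator {0..} x * (of_bool (h < x) * \<Phi> (x - h)) \<partial>lborel)"
    by (rule nn_integral_expo) simp
  also have "\<dots> = (\<integral>\<^sup>+y. ennreal (exp (- (h + y))) * indicator {0..} (h + y) * (of_bool (0 < y) * \<Phi> y) \<partial>lborel)"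
    by (subst nn_integral_real_affine[of _ 1 h]) simp_all
  \<comment> \<open>The integrands can differ only at \<open>y = 0\<close>, which lies in
    \<open>{0..}\<close> but corresponds to a ring exactly at \<open>h\<close>.\<close>
  also have "\<dots> = (\<integral>\<^sup>+y. ennreal (exp (- h)) * (ennreal (exp (- y)) * indicator {0..} y * \<Phi> y) \<partial>lborel)"
  proof (rule nn_integral_cong_AE)
    show "AE y in lborel. ennreal (exp (- (h + y))) * indicator {0..} (h + y) * (of_bool (0 < y) * \<Phi> y)
      = ennreal (exp (- h)) * (ennreal (exp (- y)) * indicator {0..} y * \<Phi> y)"
      using AE_lborel_singleton[of 0]
    proof eventually_elim
      case (elim y)
      have "ennreal (exp (- (h + y))) = ennreal (exp (- h)) * ennreal (exp (- y))"
        by (simp add: ennreal_mult[symmetric] exp_add[symmetric])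
      then show ?case using 0 elim
        by (cases "0 < y") (simp_all add: indicator_def mult.assoc)
    qed
  qed
  also have "\<dots> = ennreal (exp (- h)) * (\<integral>\<^sup>+x. \<Phi> x \<partial>expo)"
    by (subst nn_integral_expo) (simp_all add: nn_integral_cmult)
  also have "(\<integral>\<^sup>+x. \<Phi> x \<partial>expo) = (\<integral>\<^sup>+w. G w \<partial>stream_space expo)"
    unfolding \<Phi>_def by (rule expo.nn_integral_stream_space[symmetric]) simp
  finally show ?case by simp
next
  case (Suc n)
  let ?I = "\<integral>\<^sup>+w. G w \<partial>stream_space expo"
  have "(\<integral>\<^sup>+w. of_bool (passes ((!!) w) (Suc n) h) * G ((psum ((!!) w) (Suc n) - h) ## sdrop (Suc (Suc n)) w) \<partial>stream_space expo)
     = (\<integral>\<^sup>+x. of_bool (x \<le> h) * (\<integral>\<^sup>+w. of_bool (passes ((!!) w) n (h - x)) *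
          G ((psum ((!!) w) n - (h - x)) ## sdrop (Suc n) w) \<partial>stream_space expo) \<partial>expo)"
  proof (subst expo.nn_integral_stream_space)
    show "(\<lambda>w. of_bool (passes ((!!) w) (Suc n) h) * G ((psum ((!!) w) (Suc n) - h) ## sdrop (Suc (Suc n)) w))
      \<in> borel_measurable (stream_space expo)" by measurable
    have "(\<integral>\<^sup>+w. of_bool (passes ((!!) (x ## w)) (Suc n) h) *
         G ((psum ((!!) (x ## w)) (Suc n) - h) ## sdrop (Suc (Suc n)) (x ## w)) \<partial>stream_space expo)
      = of_bool (x \<le> h) * (\<integral>\<^sup>+w. of_bool (passes ((!!) w) n (h - x)) *
          G ((psum ((!!) w) n - (h - x)) ## sdrop (Suc n) w) \<partial>stream_space expo)" for x
      by (cases "x \<le> h") (simp_all add: passes_Stream_Suc psum_Stream_Suc diff_diff_eq2 add.commute)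
    then show "(\<integral>\<^sup>+x. \<integral>\<^sup>+w. of_bool (passes ((!!) (x ## w)) (Suc n) h) *
         G ((psum ((!!) (x ## w)) (Suc n) - h) ## sdrop (Suc (Suc n)) (x ## w)) \<partial>stream_space expo \<partial>expo)
      = (\<integral>\<^sup>+x. of_bool (x \<le> h) * (\<integral>\<^sup>+w. of_bool (passes ((!!) w) n (h - x)) *
          G ((psum ((!!) w) n - (h - x)) ## sdrop (Suc n) w) \<partial>stream_space expo) \<partial>expo)"
      by simp
  qed
  also have "\<dots> = (\<integral>\<^sup>+x. of_bool (x \<le> h) * (ennreal (exp (- (h - x)) * (h - x) ^ n / fact n) * ?I) \<partial>expo)"
  proof (rule nn_integral_cong)
    fix x
    show "of_bool (x \<le> h) * (\<integral>\<^sup>+w. of_bool (passes ((!!) w) n (h - x)) *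
          G ((psum ((!!) w) n - (h - x)) ## sdrop (Suc n) w) \<partial>stream_space expo)
       = of_bool (x \<le> h) * (ennreal (exp (- (h - x)) * (h - x) ^ n / fact n) * ?I)"
      using Suc.IH[of "h - x"] by (cases "x \<le> h") (simp_all del: sdrop.simps)
  qed
  also have "\<dots> = (\<integral>\<^sup>+x. ennreal (exp (- x)) * indicator {0..} x * (of_bool (x \<le> h) *
        (ennreal (exp (- (h - x)) * (h - x) ^ n / fact n) * ?I)) \<partial>lborel)"
    by (rule nn_integral_expo) simp
  also have "\<dots> = (\<integral>\<^sup>+x. ennreal (exp (- h) * (h - x) ^ n / fact n) * indicator {0..h} x * ?I \<partial>lborel)"
  proof (rule nn_integral_cong)
    fix x
    \<comment> \<open>The exponentials of the first wait and of the remaining time combine to a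
      constant, so a polynomial is left to integrate; its integral raises the Poisson weight from
      \<open>n\<close> to \<open>Suc n\<close>.\<close>
    have "exp (- x) * exp (- (h - x)) = exp (- h)" by (simp add: exp_add[symmetric])
    then have "ennreal (exp (- x)) * ennreal (exp (- (h - x)) * (h - x) ^ n / fact n)
       = ennreal (exp (- h) * (h - x) ^ n / fact n)" if "x \<le> h"
      using that by (simp add: ennreal_mult[symmetric] mult.assoc[symmetric])
    then show "ennreal (exp (- x)) * indicator {0..} x * (of_bool (x \<le> h) *
        (ennreal (exp (- (h - x)) * (h - x) ^ n / fact n) * ?I))
      = ennreal (exp (- h) * (h - x) ^ n / fact n) * indicator {0..h} x * ?I"
      by (auto simp: indicator_def mult.assoc[symmetric])
  qed
  also have "\<dots> = (\<integral>\<^sup>+x. ennreal (exp (- h) * (h - x) ^ n / fact n) * indicator {0..h} x \<partial>lborel) * ?I"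
    by (rule nn_integral_multc) simp
  also have "(\<integral>\<^sup>+x. ennreal (exp (- h) * (h - x) ^ n / fact n) * indicator {0..h} x \<partial>lborel)
     = ennreal ((- exp (- h) * (h - h) ^ Suc n / fact (Suc n)) - (- exp (- h) * (h - 0) ^ Suc n / fact (Suc n)))"
  proof (rule nn_integral_FTC_Icc)
    fix x :: real
    have "((\<lambda>x. - exp (- h) * (h - x) ^ Suc n / fact (Suc n)) has_real_derivative
        - exp (- h) * (real (Suc n) * (h - x) ^ n * (- 1)) / fact (Suc n)) (at x)"
      by (auto intro!: derivative_eq_intros simp del: power_Suc of_nat_Suc fact_Suc)
    moreover have "- e * (real (Suc n) * y * (- 1)) / fact (Suc n) = e * y / fact n" for e y :: real
      by (simp add: fact_Suc del: of_nat_Suc)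
    ultimately show "((\<lambda>x. - exp (- h) * (h - x) ^ Suc n / fact (Suc n)) has_real_derivative
        exp (- h) * (h - x) ^ n / fact n) (at x)"
      by metis
  qed (use Suc.prems in auto)
  finally show ?case by simp
qed

lemma suminf_poisson:
  assumes "0 \<le> h"
  shows "(\<Sum>n. ennreal (exp (- h) * h ^ n / fact n)) = 1"
    and "(\<Sum>n. ennreal (exp (- h) * h ^ Suc n / fact (Suc n))) = ennreal (1 - exp (- h))"
    and "(\<Sum>n. of_nat n * ennreal (exp (- h) * h ^ n / fact n)) = ennreal h"
proof -
  have "(\<lambda>n. h ^ n / fact n) sums exp h"
    using exp_converges[of h] by (simp add: divide_inverse_commute scaleR_conv_of_real)
  from sums_mult[OF this, of "exp (- h)"] have S: "(\<lambda>n. exp (- h) * h ^ n / fact n) sums 1"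
    by (simp add: exp_minus)
  then show "(\<Sum>n. ennreal (exp (- h) * h ^ n / fact n)) = 1"
    using assms by (subst suminf_ennreal_eq[OF _ S]) auto
  have "(\<lambda>n. exp (- h) * h ^ Suc n / fact (Suc n)) sums (1 - exp (- h))"
    using S by (subst sums_Suc_iff) simp
  then show "(\<Sum>n. ennreal (exp (- h) * h ^ Suc n / fact (Suc n))) = ennreal (1 - exp (- h))"
    using assms by (intro suminf_ennreal_eq) auto
  have "(\<lambda>n. real (Suc n) * (exp (- h) * h ^ Suc n / fact (Suc n))) sums (h * 1)"
    by (rule sums_cong[THEN iffD1, OF _ sums_mult[OF S, of h]]) (simp add: fact_Suc del: of_nat_Suc)
  then have "(\<lambda>n. real n * (exp (- h) * h ^ n / fact n)) sums h"
    by (subst (asm) sums_Suc_iff) simp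
  then have "(\<Sum>n. ennreal (real n * (exp (- h) * h ^ n / fact n))) = ennreal h"
    using assms by (intro suminf_ennreal_eq) auto
  then show "(\<Sum>n. of_nat n * ennreal (exp (- h) * h ^ n / fact n)) = ennreal h"
    using assms by (simp add: ennreal_mult[symmetric] ennreal_of_nat_eq_real_of_nat)
qed

lemma passes_unique: "passes f m h \<Longrightarrow> passes f n h \<Longrightarrow> m = n"
  by (metis linorder_neqE_nat not_le passes_def)

lemma suminf_passes:
  assumes "passes f m h"
  shows "(\<Sum>n. of_bool (passes f n h) * g n) = (g m :: ennreal)"
proof -
  have "of_bool (passes f n h) * g n = (if n = m then g m else 0)" for n
    using assms passes_unique by auto
  then show ?thesis using suminf_finite[of "{m}" "\<lambda>n. if n = m then g m else 0"] by simp
qed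

text \<open>The disjoint events of exactly \<open>n\<close> rings have Poisson weights, by
  memorylessness applied to the constant \<open>1\<close>, and these sum to \<open>1\<close>; so
  almost surely only finitely many rings occur up to \<open>h\<close>.\<close>

lemma AE_passes:
  assumes "0 \<le> h"
  shows "AE w in stream_space expo. \<exists>n. passes ((!!) w) n h"
proof -
  interpret S: prob_space "stream_space expo" by (rule expo.prob_space_stream_space)
  have "emeasure (stream_space expo) {w \<in> space (stream_space expo). \<exists>n. passes ((!!) w) n h}
     = (\<integral>\<^sup>+w. of_bool (\<exists>n. passes ((!!) w) n h) \<partial>stream_space expo)"
  proof -
    let ?A = "{w \<in> space (stream_space expo). \<exists>n. passes ((!!) w) n h}"
    have "emeasure (stream_space expo) ?A = (\<integral>\<^sup>+w. indicator ?A w \<partial>stream_space expo)" by simp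
    also have "\<dots> = (\<integral>\<^sup>+w. of_bool (\<exists>n. passes ((!!) w) n h) \<partial>stream_space expo)"
      by (intro nn_integral_cong) (simp add: indicator_def)
    finally show ?thesis .
  qed
  also have "\<dots> = (\<integral>\<^sup>+w. (\<Sum>n. of_bool (passes ((!!) w) n h) * 1) \<partial>stream_space expo)"
  proof (rule nn_integral_cong)
    fix w
    show "of_bool (\<exists>n. passes ((!!) w) n h) = (\<Sum>n. of_bool (passes ((!!) w) n h) * (1 :: ennreal))"
      using suminf_passes[of "(!!) w" _ h "\<lambda>_. 1"] by (cases "\<exists>n. passes ((!!) w) n h") auto
  qed
  also have "\<dots> = (\<Sum>n. ennreal (exp (- h) * h ^ n / fact n))"
    using nn_integral_passes[of "\<lambda>_. 1", OF _ assms] by (subst nn_integral_suminf) (simp_all add: S.emeasure_space_1)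
  also have "\<dots> = 1" by (rule suminf_poisson(1)[OF assms])
  finally show ?thesis by (subst S.AE_iff_emeasure_eq_1) measurable
qed

definition cells :: "real \<Rightarrow> nat \<Rightarrow> (nat \<Rightarrow> real) \<Rightarrow> bool list" where
  "cells h K f = map (rung h f) [0..<K]"

lemma AE_expo_pos: "AE w in stream_space expo. \<forall>n. 0 < w !! n"
proof -
  have "AE x in expo. 0 < x"
  proof (subst AE_density)
    show "AE x in lborel. 0 < ennreal (exponential_density 1 x) \<longrightarrow> 0 < x"
      using AE_lborel_singleton[of 0] by eventually_elim (auto simp: exponential_density_def)
  qed simp
  then have "AE w in stream_space expo. stream_all ((<) 0) w"
    by (intro expo.AE_stream_all) auto
  then show ?thesis unfolding stream_all_def .
qed

lemma psum_strict_mono: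
  assumes "\<And>i. 0 < f i" "m < n"
  shows "psum f m < psum f n"
  unfolding psum_def by (rule sum_strict_mono2[where b = n]) (use assms in \<open>auto intro: less_imp_le\<close>)

lemma psum_mono: "(\<And>i. 0 < f i) \<Longrightarrow> m \<le> n \<Longrightarrow> psum f m \<le> psum f n"
  using psum_strict_mono[of f m n] by (cases "m = n") auto

text \<open>At time \<open>h\<close> the pending wait is reduced to
  \<open>psum ((!!) w) n - h\<close> and the later waits are untouched; the remaining bits are those
  of this residual clock, moved by one cell.\<close>

lemma cells_shift:
  assumes p: "passes ((!!) w) n h" and pos: "\<And>i. 0 < w !! i" and h: "0 \<le> h"
  shows "cells h (Suc K) ((!!) w) = (0 < n) # cells h K ((!!) ((psum ((!!) w) n - h) ## sdrop (Suc n) w))"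
proof -
  let ?v = "(psum ((!!) w) n - h) ## sdrop (Suc n) w"
  have ps: "psum ((!!) ?v) j = psum ((!!) w) (n + j) - h" for j
  proof (induction j)
    case (Suc j)
    have "psum ((!!) ?v) (Suc j) = psum ((!!) ?v) j + w !! (Suc (n + j))"
      by (simp add: psum_def sdrop_snth del: sdrop.simps)
    then show ?case using Suc by (simp add: psum_def)
  qed (simp add: psum_def)
  have 0: "rung h ((!!) w) 0 \<longleftrightarrow> 0 < n"
  proof
    assume "rung h ((!!) w) 0"
    then obtain m where "psum ((!!) w) m \<le> h" by (auto simp: rung_def)
    then show "0 < n" using p psum_mono[of "(!!) w" 0 m, OF pos] by (cases n) (auto simp: passes_def)
  next
    assume "0 < n"
    then show "rung h ((!!) w) 0" using p pos[of 0] by (auto simp: rung_def passes_def psum_def intro!: exI[of _ 0])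
  qed
  have S: "rung h ((!!) w) (Suc k) \<longleftrightarrow> rung h ((!!) ?v) k" for k
  proof
    assume "rung h ((!!) w) (Suc k)"
    then obtain m where m: "real (Suc k) * h < psum ((!!) w) m" "psum ((!!) w) m \<le> real (Suc (Suc k)) * h"
      by (auto simp: rung_def)
    have "h \<le> real (Suc k) * h" using h by (simp add: algebra_simps)
    then have "n \<le> m" using m p by (auto simp: passes_def not_le[symmetric])
    then obtain j where "m = n + j" using le_Suc_ex by blast
    with m show "rung h ((!!) ?v) k"
      unfolding rung_def ps by (intro exI[of _ j]) (simp add: algebra_simps)
  next
    assume "rung h ((!!) ?v) k"
    then obtain j where "real k * h < psum ((!!) w) (n + j) - h" "psum ((!!) w) (n + j) - h \<le> real (Suc k) * h"
      unfolding rung_def ps by blast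
    then show "rung h ((!!) w) (Suc k)"
      unfolding rung_def by (intro exI[of _ "n + j"]) (simp add: algebra_simps)
  qed
  show ?thesis
    unfolding cells_def upt_conv_Cons[OF zero_less_Suc] by (simp add: 0 S map_Suc_upt[symmetric] del: upt_Suc)
qed

lemma measurable_cells [measurable]: "(\<lambda>w. cells h K ((!!) w)) \<in> measurable (stream_space expo) (count_space UNIV)"
proof -
  have E: "(\<lambda>w. cells h K ((!!) w)) -` {xs} \<inter> space (stream_space expo) \<in> sets (stream_space expo)" for xs
  proof -
    have "cells h K f = xs \<longleftrightarrow> length xs = K \<and> (\<forall>k<K. rung h f k = xs ! k)" for f
      unfolding cells_def list_eq_iff_nth_eq[of "map (rung h f) [0..<K]"] by (simp, blast)
    then have "(\<lambda>w. cells h K ((!!) w)) -` {xs} \<inter> space (stream_space expo)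
      = {w \<in> space (stream_space expo). length xs = K \<and> (\<forall>k<K. rung h ((!!) w) k = xs ! k)}"
      unfolding vimage_def Int_def singleton_iff mem_Collect_eq by (simp add: conj_commute)
    also have "\<dots> \<in> sets (stream_space expo)" by measurable
    finally show ?thesis .
  qed
  show ?thesis
    unfolding measurable_count_space_eq2_countable using E by simp
qed

text \<open>Conditioning on the number of rings in the first cell leaves a fresh clock whatever that
  number is. Hence the bits are independent, and a cell is empty with probability
  \<open>exp (- h)\<close>.\<close>

lemma nn_integral_cells:
  fixes F :: "bool list \<Rightarrow> ennreal"
  assumes h: "0 \<le> h"
  shows "(\<integral>\<^sup>+w. F (cells h K ((!!) w)) \<partial>stream_space expo) = (\<integral>\<^sup>+xs. F xs \<partial>replicate_pmf K (bernoulli_pmf (1 - exp (- h))))"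
proof (induction K arbitrary: F)
  case 0
  interpret S: prob_space "stream_space expo" by (rule expo.prob_space_stream_space)
  show ?case by (simp add: cells_def S.emeasure_space_1)
next
  case (Suc K)
  let ?v = "\<lambda>n w. (psum ((!!) w) n - h) ## sdrop (Suc n) w"
  let ?I = "\<lambda>b. \<integral>\<^sup>+xs. F (b # xs) \<partial>replicate_pmf K (bernoulli_pmf (1 - exp (- h)))"
  have "(\<integral>\<^sup>+w. F (cells h (Suc K) ((!!) w)) \<partial>stream_space expo)
    = (\<integral>\<^sup>+w. (\<Sum>n. of_bool (passes ((!!) w) n h) * F ((0 < n) # cells h K ((!!) (?v n w)))) \<partial>stream_space expo)"
  proof (rule nn_integral_cong_AE)
    show "AE w in stream_space expo. F (cells h (Suc K) ((!!) w))
       = (\<Sum>n. of_bool (passes ((!!) w) n h) * F ((0 < n) # cells h K ((!!) (?v n w))))"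
      using AE_expo_pos AE_passes[OF h]
    proof eventually_elim
      case (elim w)
      then obtain n where n: "passes ((!!) w) n h" by blast
      have "(\<Sum>n. of_bool (passes ((!!) w) n h) * F ((0 < n) # cells h K ((!!) (?v n w))))
          = F ((0 < n) # cells h K ((!!) (?v n w)))"
        by (rule suminf_passes[OF n, where g = "\<lambda>n. F ((0 < n) # cells h K ((!!) (?v n w)))"])
      then show ?case using cells_shift[OF n _ h, of K] elim(1) by simp
    qed
  qed
  also have "\<dots> = (\<Sum>n. \<integral>\<^sup>+w. of_bool (passes ((!!) w) n h) * F ((0 < n) # cells h K ((!!) (?v n w))) \<partial>stream_space expo)"
    by (rule nn_integral_suminf) measurable
  also have "\<dots> = (\<Sum>n. ennreal (exp (- h) * h ^ n / fact n) * ?I (0 < n))"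
  proof (intro suminf_cong)
    fix n :: nat
    have "(\<lambda>w. F ((0 < n) # cells h K ((!!) w))) \<in> borel_measurable (stream_space expo)" by measurable
    from nn_integral_passes[OF this h, of n]
    show "(\<integral>\<^sup>+w. of_bool (passes ((!!) w) n h) * F ((0 < n) # cells h K ((!!) (?v n w))) \<partial>stream_space expo)
       = ennreal (exp (- h) * h ^ n / fact n) * ?I (0 < n)"
      by (simp only: Suc.IH[of "\<lambda>xs. F ((0 < n) # xs)"])
  qed
  also have "\<dots> = ennreal (exp (- h)) * ?I False + (\<Sum>n. ennreal (exp (- h) * h ^ Suc n / fact (Suc n)) * ?I True)"
    by (subst suminf_offset[of _ 1]) (simp_all add: del: power_Suc fact_Suc)
  also have "(\<Sum>n. ennreal (exp (- h) * h ^ Suc n / fact (Suc n)) * ?I True) = ennreal (1 - exp (- h)) * ?I True"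
    by (simp only: ennreal_suminf_multc suminf_poisson(2)[OF h])
  also have "ennreal (exp (- h)) * ?I False + ennreal (1 - exp (- h)) * ?I True
    = (\<integral>\<^sup>+xs. F xs \<partial>replicate_pmf (Suc K) (bernoulli_pmf (1 - exp (- h))))"
    using h by (simp add: add.commute mult.commute)
  finally show ?case .
qed

section \<open>From independent exponential waits to a grid of independent Bernoulli bits\<close>

lemma pmf_replicate_pmf:
  "pmf (replicate_pmf n P) xs = (if length xs = n then \<Prod>i<n. pmf P (xs ! i) else 0)"
proof (induction n arbitrary: xs)
  case (Suc n)
  have eq: "replicate_pmf (Suc n) P = map_pmf (\<lambda>(x, xs). x # xs) (pair_pmf P (replicate_pmf n P))"
    by (simp add: pair_pmf_def map_bind_pmf)
  show ?case
  proof (cases xs)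
    case Nil
    then show ?thesis unfolding eq by (subst pmf_map_outside) auto
  next
    case (Cons y ys)
    have "pmf (replicate_pmf (Suc n) P) xs = pmf P y * pmf (replicate_pmf n P) ys"
      unfolding eq Cons
      using pmf_map_inj'[of "\<lambda>(x, xs). x # xs" "pair_pmf P (replicate_pmf n P)" "(y, ys)"]
      by (simp add: inj_on_def pmf_pair)
    then show ?thesis unfolding Suc.IH Cons by (simp add: prod.lessThan_Suc_shift del: prod.lessThan_Suc replicate_pmf.simps)
  qed
qed auto

locale exponential_clocks = prob_space M for M :: "'a measure" +
  fixes W :: "nat \<Rightarrow> nat \<Rightarrow> 'a \<Rightarrow> real"
  assumes indep: "indep_vars (\<lambda>_. borel) (\<lambda>(r, n). W r n) (UNIV :: (nat \<times> nat) set)"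
    and expo: "\<And>r n. distributed M lborel (W r n) (exponential_density 1)"
begin

abbreviation ws :: "'a \<Rightarrow> waits" where
  "ws \<omega> \<equiv> \<lambda>r n. W r n \<omega>"

lemma measurable_W [measurable]: "W r n \<in> borel_measurable M"
  using expo[of r n] by (auto simp: distributed_def)

lemma distr_W: "distr M borel (W r n) = expo"
proof -
  have "distr M borel (W r n) = distr M lborel (W r n)" by (rule distr_cong) auto
  then show ?thesis using distributed_distr_eq_density[OF expo[of r n]] by simp
qed

lemma measurable_clock [measurable]: "(\<lambda>\<omega>. to_stream (ws \<omega> r)) \<in> measurable M (stream_space expo)"
  by (rule measurable_stream_space2) (simp add: to_stream_def cong: measurable_cong_sets)

lemma snth_to_stream [simp]: "(!!) (to_stream f) = f"
  by (simp add: to_stream_def fun_eq_iff)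

text \<open>Identifies the waits of one particle on the abstract space with the canonical stream of
  independent exponential variables, where integrals are computed by splitting off the first
  wait.\<close>

lemma distr_clock: "distr M (stream_space expo) (\<lambda>\<omega>. to_stream (ws \<omega> r)) = stream_space expo"
proof -
  have "indep_vars (\<lambda>n. PiM {(r, n)} (\<lambda>_. borel :: real measure)) (\<lambda>n \<omega>. restrict (\<lambda>i. (case i of (r, n) \<Rightarrow> W r n) \<omega>) {(r, n)}) UNIV"
    by (rule indep_vars_restrict[OF indep]) (auto simp: disjoint_family_on_def)
  then have "indep_vars (\<lambda>_. borel) (\<lambda>n \<omega>. (restrict (\<lambda>i. (case i of (r, n) \<Rightarrow> W r n) \<omega>) {(r, n)}) (r, n)) UNIV"
    by (rule indep_vars_compose2) simp
  then have "indep_vars (\<lambda>_. borel) (\<lambda>n. W r n) UNIV" by simp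
  then have "distr M (PiM UNIV (\<lambda>_. borel)) (\<lambda>\<omega>. \<lambda>n\<in>UNIV. W r n \<omega>) = PiM UNIV (\<lambda>n. distr M borel (W r n))"
    by (subst (asm) indep_vars_iff_distr_eq_PiM) auto
  then have D: "distr M (PiM UNIV (\<lambda>_. borel)) (\<lambda>\<omega> n. W r n \<omega>) = PiM UNIV (\<lambda>_. expo)"
    by (simp add: distr_W restrict_UNIV)
  have "stream_space expo = distr (PiM UNIV (\<lambda>_. expo)) (stream_space expo) to_stream"
    by (rule stream_space_eq_distr)
  also have "\<dots> = distr (distr M (PiM UNIV (\<lambda>_. borel)) (\<lambda>\<omega> n. W r n \<omega>)) (stream_space expo) to_stream"
    unfolding D ..
  also have "\<dots> = distr M (stream_space expo) (to_stream \<circ> (\<lambda>\<omega> n. W r n \<omega>))"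
  proof (rule distr_distr)
    have "to_stream \<in> measurable (PiM UNIV (\<lambda>_. expo)) (stream_space expo)" by simp
    then show "to_stream \<in> measurable (PiM UNIV (\<lambda>_. borel)) (stream_space expo)"
      by (simp cong: measurable_cong_sets sets_PiM_cong)
  qed (auto intro!: measurable_PiM_single')
  finally show ?thesis by (simp add: o_def)
qed

lemma nn_integral_clock:
  assumes [measurable]: "f \<in> borel_measurable (stream_space expo)"
  shows "(\<integral>\<^sup>+\<omega>. f (to_stream (ws \<omega> r)) \<partial>M) = (\<integral>\<^sup>+w. f w \<partial>stream_space expo)"
  by (subst distr_clock[of r, symmetric]) (simp add: nn_integral_distr)

lemma AE_clock:
  assumes "AE w in stream_space expo. P w"
  shows "AE \<omega> in M. P (to_stream (ws \<omega> r))"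
  using assms by (subst (asm) distr_clock[of r, symmetric]) (rule AE_distrD[OF measurable_clock])

lemma prob_cells:
  assumes "0 \<le> h"
  shows "prob {\<omega> \<in> space M. cells h K (ws \<omega> r) = xs} = pmf (replicate_pmf K (bernoulli_pmf (1 - exp (- h)))) xs"
proof -
  have [measurable]: "Measurable.pred (stream_space expo) (\<lambda>w. cells h K ((!!) w) = xs)" by measurable
  have [measurable]: "Measurable.pred M (\<lambda>\<omega>. cells h K (ws \<omega> r) = xs)"
    using measurable_compose[OF measurable_clock[of r] measurable_cells[of h K]] by simp
  have "emeasure M {\<omega> \<in> space M. cells h K (ws \<omega> r) = xs} = (\<integral>\<^sup>+\<omega>. indicator {\<omega> \<in> space M. cells h K (ws \<omega> r) = xs} \<omega> \<partial>M)"
    by simp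
  also have "\<dots> = (\<integral>\<^sup>+\<omega>. indicator {xs} (cells h K ((!!) (to_stream (ws \<omega> r)))) \<partial>M)"
    by (intro nn_integral_cong) (auto simp: indicator_def)
  also have "\<dots> = (\<integral>\<^sup>+w. indicator {xs} (cells h K ((!!) w)) \<partial>stream_space expo)"
    by (rule nn_integral_clock) measurable
  also have "\<dots> = (\<integral>\<^sup>+ys. indicator {xs} ys \<partial>replicate_pmf K (bernoulli_pmf (1 - exp (- h))))"
    by (rule nn_integral_cells[OF assms])
  also have "\<dots> = ennreal (pmf (replicate_pmf K (bernoulli_pmf (1 - exp (- h)))) xs)"
    by (simp add: emeasure_pmf_single)
  finally show ?thesis by (simp add: emeasure_eq_measure)
qed

lemma measurable_cells_W [measurable]:
  "(\<lambda>\<omega>. cells h K (ws \<omega> r)) \<in> measurable M (count_space UNIV)"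
  using measurable_compose[OF measurable_clock[of r] measurable_cells[of h K]] by simp

text \<open>Distinct particles read disjoint blocks \<open>{r} \<times> UNIV\<close> of the waits,
  and functions of disjoint blocks of an independent family are independent.\<close>

lemma indep_cells: "indep_vars (\<lambda>_. count_space UNIV) (\<lambda>r \<omega>. cells h K (ws \<omega> r)) UNIV"
proof -
  have "indep_vars (\<lambda>r. PiM ({r} \<times> UNIV) (\<lambda>_. borel :: real measure))
     (\<lambda>r \<omega>. restrict (\<lambda>i. (case i of (r, n) \<Rightarrow> W r n) \<omega>) ({r} \<times> UNIV)) UNIV"
    by (rule indep_vars_restrict[OF indep]) (auto simp: disjoint_family_on_def)
  then have "indep_vars (\<lambda>_. count_space UNIV) (\<lambda>r \<omega>. cells h K ((!!) (to_stream (\<lambda>n. (restrict (\<lambda>i. (case i of (r, n) \<Rightarrow> W r n) \<omega>) ({r} \<times> UNIV)) (r, n))))) UNIV"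
  proof (rule indep_vars_compose2)
    fix r :: nat
    have "(\<lambda>f :: nat \<times> nat \<Rightarrow> real. to_stream (\<lambda>n. f (r, n))) \<in> measurable (PiM ({r} \<times> UNIV) (\<lambda>_. borel)) (stream_space expo)"
      by (rule measurable_stream_space2) (simp add: to_stream_def cong: measurable_cong_sets)
    from measurable_compose[OF this measurable_cells[of h K]]
    show "(\<lambda>f. cells h K ((!!) (to_stream (\<lambda>n. f (r, n))))) \<in> measurable (PiM ({r} \<times> UNIV) (\<lambda>_. borel :: real measure)) (count_space UNIV)" .
  qed
  then show ?thesis by simp
qed

lemma nn_integral_grid:
  fixes F :: "bool list list \<Rightarrow> ennreal"
  assumes h: "0 \<le> h"
  shows "(\<integral>\<^sup>+\<omega>. F (map (\<lambda>r. cells h K (ws \<omega> r)) [0..<R]) \<partial>M) = (\<integral>\<^sup>+SS. F SS \<partial>clocks (1 - exp (- h)) R K)"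
proof -
  let ?Z = "\<lambda>\<omega>. map (\<lambda>r. cells h K (ws \<omega> r)) [0..<R]"
  let ?p = "1 - exp (- h)"
  have Zeq: "?Z -` {xs} \<inter> space M = {\<omega> \<in> space M. length xs = R \<and> (\<forall>r<R. cells h K (ws \<omega> r) = xs ! r)}" for xs
  proof -
    have "?Z \<omega> = xs \<longleftrightarrow> length xs = R \<and> (\<forall>r<R. cells h K (ws \<omega> r) = xs ! r)" for \<omega>
      unfolding list_eq_iff_nth_eq[of "map _ [0..<R]"] by (simp, blast)
    then show ?thesis unfolding vimage_def Int_def singleton_iff mem_Collect_eq by (simp add: conj_commute)
  qed
  have Z [measurable]: "?Z \<in> measurable M (count_space UNIV)"
  proof -
    have "?Z -` {xs} \<inter> space M \<in> sets M" for xs unfolding Zeq by measurable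
    then show ?thesis unfolding measurable_count_space_eq2_countable by simp
  qed
  have "distr M (count_space UNIV) ?Z = measure_pmf (clocks ?p R K)"
  proof (rule measure_eqI_countable[where A = UNIV])
    fix xs :: "bool list list"
    have "prob (?Z -` {xs} \<inter> space M) = pmf (clocks ?p R K) xs"
    \<comment> \<open>The product rule for independent events is applied to a nonempty index set, so
      \<open>R = 0\<close> is treated with the lists of wrong length.\<close>
    proof (cases "length xs = R \<and> 0 < R")
      case True
      have "?Z -` {xs} \<inter> space M = (\<Inter>r\<in>{..<R}. (\<lambda>\<omega>. cells h K (ws \<omega> r)) -` {xs ! r} \<inter> space M)"
        unfolding Zeq using True by auto
      then have "prob (?Z -` {xs} \<inter> space M) = (\<Prod>r<R. prob ((\<lambda>\<omega>. cells h K (ws \<omega> r)) -` {xs ! r} \<inter> space M))"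
        using indep_varsD[OF indep_cells, of "{..<R}" "\<lambda>r. {xs ! r}"] True by auto
      also have "\<dots> = (\<Prod>r<R. pmf (replicate_pmf K (bernoulli_pmf ?p)) (xs ! r))"
        by (intro prod.cong refl) (simp add: prob_cells[OF h] vimage_def Int_def conj_commute)
      finally show ?thesis using True by (simp add: clocks_def pmf_replicate_pmf)
    next
      case False
      then show ?thesis unfolding Zeq clocks_def pmf_replicate_pmf by (auto simp: prob_space)
    qed
    then show "emeasure (distr M (count_space UNIV) ?Z) {xs} = emeasure (measure_pmf (clocks ?p R K)) {xs}"
      by (simp add: emeasure_distr emeasure_eq_measure emeasure_pmf_single)
  qed auto
  then have "(\<integral>\<^sup>+SS. F SS \<partial>clocks ?p R K) = (\<integral>\<^sup>+SS. F SS \<partial>distr M (count_space UNIV) ?Z)" by simp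
  then show ?thesis by (simp add: nn_integral_distr)
qed

end

section \<open>Agreement of the discretised and the original process on regular paths\<close>

definition regular :: "waits \<Rightarrow> bool" where
  "regular w \<longleftrightarrow> (\<forall>r n. 0 < w r n) \<and> (\<forall>r (T::nat). \<exists>n. passes (w r) n (real T))"

lemma down_closed_lessThan_card:
  assumes "finite A" "\<And>m n. n \<in> A \<Longrightarrow> m \<le> n \<Longrightarrow> m \<in> A"
  shows "A = {..<card A}"
proof (cases "A = {}")
  case False
  have "x \<in> A \<longleftrightarrow> x \<in> {..Max A}" for x
    using Max_ge[OF assms(1)] assms(2)[OF Max_in[OF assms(1) False]] unfolding atMost_iff by blast
  then have "A = {..Max A}" by (rule set_eqI)
  then have "A = {..<Suc (Max A)}" by (simp add: lessThan_Suc_atMost)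
  then show ?thesis by (metis card_lessThan)
qed simp

context
  fixes w :: waits
  assumes reg: "regular w"
begin

lemma regular_pos: "0 < w r n"
  using reg by (simp add: regular_def)

lemma ring_time_less_iff: "ring_time w r m < ring_time w r n \<longleftrightarrow> m < n"
  unfolding ring_time_psum using psum_strict_mono[of "w r", OF regular_pos]
  by (metis linorder_neqE_nat order_less_asym order_less_irrefl)

lemma ring_time_pos: "0 < ring_time w r n"
  unfolding ring_time_def by (rule sum_pos) (auto simp: regular_pos)

lemma finite_rings: "finite {n. ring_time w r n \<le> s}"
proof -
  obtain n where n: "passes (w r) n (real (nat \<lceil>s\<rceil>))" using reg[unfolded regular_def, THEN conjunct2, rule_format] by meson
  have "s \<le> real (nat \<lceil>s\<rceil>)" by linarith
  then have "s < ring_time w r n" using n unfolding passes_def ring_time_psum by linarith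
  then have "ring_time w r m < ring_time w r n" if "ring_time w r m \<le> s" for m
    using that by linarith
  then have "{n. ring_time w r n \<le> s} \<subseteq> {..<n}"
    unfolding ring_time_less_iff by blast
  then show ?thesis by (rule finite_subset) simp
qed

lemma rings_upto_eq: "{n. ring_time w r n \<le> s} = {..<rings_upto w r s}"
  unfolding rings_upto_def
proof (rule down_closed_lessThan_card[OF finite_rings])
  fix m n assume "n \<in> {n. ring_time w r n \<le> s}" "m \<le> n"
  then show "m \<in> {n. ring_time w r n \<le> s}"
    using ring_time_less_iff[of r m n] by (cases "m = n") auto
qed

lemma ring_time_le_iff: "ring_time w r n \<le> s \<longleftrightarrow> n < rings_upto w r s"
  using rings_upto_eq[of r s] by auto

lemma rings_uptoI:
  assumes "\<And>n. ring_time w r n \<le> s \<longleftrightarrow> n < N"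
  shows "rings_upto w r s = N"
  unfolding rings_upto_def assms by (simp add: lessThan_def[symmetric])

lemma moves_0: "moves w 0 n = n"
  by (induction n) auto

text \<open>Every marked cell contains a ring of its own. The bound holds on every mesh and thus
  supplies the dominating function for the refinement.\<close>

lemma dmoves_0_le_rings:
  assumes "0 \<le> h"
  shows "dmoves (\<lambda>i. rung h (w i)) 0 k \<le> rings_upto w 0 (real k * h)"
proof (induction k)
  case (Suc k)
  have mono: "rings_upto w 0 (real k * h) \<le> rings_upto w 0 (real (Suc k) * h)"
  proof -
    have "{..<rings_upto w 0 (real k * h)} \<subseteq> {..<rings_upto w 0 (real (Suc k) * h)}"
      unfolding rings_upto_eq[symmetric] using assms by (auto simp: algebra_simps)
    then show ?thesis by simp
  qed
  show ?case
  proof (cases "rung h (w 0) k")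
    case True
    then obtain n where n: "real k * h < ring_time w 0 n" "ring_time w 0 n \<le> real (Suc k) * h"
      by (auto simp: rung_def ring_time_psum)
    then have "rings_upto w 0 (real k * h) \<le> n" "n < rings_upto w 0 (real (Suc k) * h)"
      using ring_time_le_iff by (auto simp: not_less[symmetric])
    then show ?thesis using Suc.IH True by simp
  qed (use Suc.IH mono in simp)
qed simp

text \<open>
  The parallel update is what makes simultaneous rings of different clocks harmless: as soon as
  distinct ring times lie in distinct cells, the discretised system agrees with the original one.
\<close>

lemma dmoves_eq_moves:
  assumes h: "0 \<le> h" and K: "real K * h \<le> t"
    and sep: "\<And>i j m n. i \<le> r \<Longrightarrow> j \<le> r \<Longrightarrow> ring_time w i m \<le> t \<Longrightarrow> ring_time w j n \<le> t \<Longrightarrow>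
      ring_time w i m < ring_time w j n \<Longrightarrow> h \<le> ring_time w j n - ring_time w i m"
  shows "i \<le> r \<Longrightarrow> k \<le> K \<Longrightarrow> dmoves (\<lambda>i. rung h (w i)) i k = moves w i (rings_upto w i (real k * h))"
proof (induction k arbitrary: i)
  case 0
  have "rings_upto w i 0 = 0" by (rule rings_uptoI) (use ring_time_pos in \<open>simp add: not_le\<close>)
  then show ?case by simp
next
  case (Suc k)
  let ?S = "\<lambda>i. rung h (w i)"
  define c where "c = rings_upto w i (real k * h)"
  have kt: "real (Suc k) * h \<le> t"
  proof -
    have "real (Suc k) * h \<le> real K * h" using Suc.prems h by (intro mult_right_mono) auto
    then show ?thesis using K by linarith
  qed
  have kS: "real (Suc k) * h = real k * h + h" by (simp add: algebra_simps)
  \<comment> \<open>Two points of a half-open cell are less than \<open>h\<close> apart, contrary to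
    \<open>sep\<close>. Only rings at different times are excluded; simultaneous ones remain
    possible.\<close>
  have same: False
    if "i \<le> r" "j \<le> r" "real k * h < ring_time w i m" "ring_time w i m < ring_time w j n" "ring_time w j n \<le> real (Suc k) * h"
    for i j m n
    using sep[of i j m n] that kt kS by linarith
  have IH: "dmoves ?S j k = moves w j (rings_upto w j (real k * h))" if "j \<le> r" for j
    using Suc.IH[of j] Suc.prems that by simp
  show ?case
  proof (cases "?S i k")
    case False
    have "rings_upto w i (real (Suc k) * h) = c"
      unfolding c_def
    proof (rule rings_uptoI)
      fix n
      show "ring_time w i n \<le> real (Suc k) * h \<longleftrightarrow> n < rings_upto w i (real k * h)"
      proof -
        have "\<not> (real k * h < ring_time w i n \<and> ring_time w i n \<le> real (Suc k) * h)"
          using False unfolding rung_def ring_time_psum by blast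
        then show ?thesis unfolding ring_time_le_iff[symmetric] using kS h by linarith
      qed
    qed
    moreover have "dmoves ?S i (Suc k) = dmoves ?S i k" using False by (cases i) auto
    ultimately show ?thesis using IH[of i] Suc.prems by (simp add: c_def)
  next
    case True
    then obtain n where n: "real k * h < ring_time w i n" "ring_time w i n \<le> real (Suc k) * h"
      by (auto simp: rung_def ring_time_psum)
    have "\<not> ring_time w i n \<le> real k * h" using n(1) by linarith
    then have "c \<le> n" unfolding ring_time_le_iff c_def by simp
    have c1: "real k * h < ring_time w i c"
    proof -
      have "\<not> ring_time w i c \<le> real k * h" unfolding ring_time_le_iff c_def by simp
      then show ?thesis by linarith
    qed
    have nc: "n = c"
    proof (rule ccontr)
      assume "n \<noteq> c"
      with \<open>c \<le> n\<close> have "ring_time w i c < ring_time w i n" unfolding ring_time_less_iff by simp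
      then show False using same[OF Suc.prems(1) Suc.prems(1) c1 _ n(2)] by blast
    qed
    have Sc: "rings_upto w i (real (Suc k) * h) = Suc c"
    proof (rule rings_uptoI)
      fix m
      show "ring_time w i m \<le> real (Suc k) * h \<longleftrightarrow> m < Suc c"
      proof
        assume m: "ring_time w i m \<le> real (Suc k) * h"
        have "\<not> ring_time w i c < ring_time w i m"
          using same[OF Suc.prems(1) Suc.prems(1) c1 _ m] by blast
        then show "m < Suc c" unfolding ring_time_less_iff by simp
      next
        assume "m < Suc c"
        then have "\<not> ring_time w i c < ring_time w i m" unfolding ring_time_less_iff by simp
        then show "ring_time w i m \<le> real (Suc k) * h"
          using n(2) unfolding nc by linarith
      qed
    qed
    show ?thesis
    proof (cases i)
      case 0
      then show ?thesis using IH[of 0] True Sc by (simp add: moves_0 c_def)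
    next
      case (Suc j)
      \<comment> \<open>The predecessor has no ring in this cell before ring \<open>c\<close>, and
        the strict inequality in \<open>rings_before\<close> discards a simultaneous one. Hence it
        is seen as at the start of the cell, exactly as in the parallel update.\<close>
      have "ring_time w j m < ring_time w i c \<longleftrightarrow> ring_time w j m \<le> real k * h" for m
      proof -
        have "j \<le> r" "ring_time w i c \<le> real (Suc k) * h" using Suc.prems(1) Suc n(2) nc by auto
        then have "\<not> (real k * h < ring_time w j m \<and> ring_time w j m < ring_time w i c)"
          using same[of j i m c] Suc.prems(1) by blast
        then show ?thesis using c1 by linarith
      qed
      then have "rings_before w j (ring_time w i c) = rings_upto w j (real k * h)"
        by (simp add: rings_before_def rings_upto_def)
      then show ?thesis
        using IH[of i] IH[of j] True Sc Suc.prems Suc by (simp add: c_def site_after_def Let_def)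
    qed
  qed
qed

text \<open>On a regular path the clocks \<open>0\<close> to \<open>r\<close> have finitely many
  rings up to \<open>t\<close>, so the gaps between different ring times have a positive minimum,
  which a fine mesh undercuts.\<close>

lemma eventually_dmoves_eq_jumps:
  assumes t: "0 < t"
  shows "eventually (\<lambda>K. dmoves (\<lambda>i. rung (t / real K) (w i)) r K = jumps w r t) sequentially"
proof -
  define T where "T = (\<Union>i\<le>r. ring_time w i ` {n. ring_time w i n \<le> t})"
  \<comment> \<open>The element \<open>1\<close> keeps the set nonempty when there are no two
    different ring times.\<close>
  define D where "D = insert 1 {d \<in> (\<lambda>(a, b). b - a) ` (T \<times> T). 0 < d}"
  have "finite T" unfolding T_def using finite_rings by auto
  then have D: "finite D" "D \<noteq> {}" unfolding D_def by auto
  define \<delta> where "\<delta> = Min D"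
  have \<delta>: "0 < \<delta>" using Min_in[OF D] by (auto simp: \<delta>_def D_def)
  have sep: "\<delta> \<le> ring_time w j n - ring_time w i m"
    if "i \<le> r" "j \<le> r" "ring_time w i m \<le> t" "ring_time w j n \<le> t" "ring_time w i m < ring_time w j n" for i j m n
    unfolding \<delta>_def
  proof (rule Min_le[OF D(1)])
    have "ring_time w i m \<in> T" "ring_time w j n \<in> T" using that unfolding T_def by blast+
    then show "ring_time w j n - ring_time w i m \<in> D" using that by (auto simp: D_def image_iff intro!: bexI)
  qed
  have "eventually (\<lambda>K. t / \<delta> \<le> real K) sequentially"
    by (rule eventually_compose_filterlim[OF eventually_ge_at_top filterlim_real_sequentially])
  with eventually_gt_at_top[of 0] show ?thesis
  proof eventually_elim
    case (elim K)
    have hd: "t / real K \<le> \<delta>" and tK: "real K * (t / real K) = t"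
      using elim \<delta> by (auto simp: field_simps)
    have "dmoves (\<lambda>i. rung (t / real K) (w i)) r K = moves w r (rings_upto w r (real K * (t / real K)))"
    proof (rule dmoves_eq_moves[where r = r and K = K and t = t])
      show "t / real K \<le> ring_time w j n - ring_time w i m"
        if "i \<le> r" "j \<le> r" "ring_time w i m \<le> t" "ring_time w j n \<le> t" "ring_time w i m < ring_time w j n" for i j m n
        using sep[OF that] hd by linarith
    qed (use t tK in auto)
    then show ?case by (simp only: tK jumps_def)
  qed
qed

end

section \<open>Convergence of the means as the mesh is refined\<close>

context exponential_clocks
begin

lemma AE_regular: "AE \<omega> in M. regular (ws \<omega>)"
proof -
  have "AE \<omega> in M. \<forall>r. (\<forall>n. 0 < W r n \<omega>) \<and> (\<forall>T::nat. \<exists>n. passes (\<lambda>n. W r n \<omega>) n (real T))"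
  proof (subst AE_all_countable, intro allI)
    fix r
    have "AE w in stream_space expo. (\<forall>n. 0 < w !! n) \<and> (\<forall>T::nat. \<exists>n. passes ((!!) w) n (real T))"
      using AE_expo_pos AE_passes by (auto simp: AE_all_countable)
    from AE_clock[OF this, of r]
    show "AE \<omega> in M. (\<forall>n. 0 < W r n \<omega>) \<and> (\<forall>T::nat. \<exists>n. passes (\<lambda>n. W r n \<omega>) n (real T))"
      by simp
  qed
  then show ?thesis by eventually_elim (auto simp: regular_def)
qed

lemma measurable_ring_time [measurable]: "(\<lambda>\<omega>. ring_time (ws \<omega>) r n) \<in> borel_measurable M"
  unfolding ring_time_def by measurable

lemma measurable_rings_upto [measurable]: "(\<lambda>\<omega>. rings_upto (ws \<omega>) r t) \<in> measurable M (count_space UNIV)"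
  unfolding rings_upto_def by measurable

lemma measurable_moves: "(\<lambda>\<omega>. moves (ws \<omega>) r n) \<in> measurable M (count_space UNIV)"
proof (induction r arbitrary: n)
  case 0
  have "moves w 0 n = n" for w by (induction n) auto
  then show ?case by simp
next
  case (Suc r)
  show ?case
  proof (induction n)
    case (Suc n)
    have "(\<lambda>\<omega>. rings_before (ws \<omega>) r (ring_time (ws \<omega>) (Suc r) n)) \<in> measurable M (count_space UNIV)"
      unfolding rings_before_def by measurable
    then have A: "(\<lambda>\<omega>. moves (ws \<omega>) r (rings_before (ws \<omega>) r (ring_time (ws \<omega>) (Suc r) n))) \<in> measurable M (count_space UNIV)"
      by (rule measurable_compose_countable[OF \<open>\<And>n. (\<lambda>\<omega>. moves (ws \<omega>) r n) \<in> measurable M (count_space UNIV)\<close>])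
    have "(\<lambda>\<omega>. (\<lambda>a b. if site_after (Suc r) a + 1 = site_after r b then a else Suc a) (moves (ws \<omega>) (Suc r) n)
        (moves (ws \<omega>) r (rings_before (ws \<omega>) r (ring_time (ws \<omega>) (Suc r) n)))) \<in> measurable M (count_space UNIV)"
      by (rule measurable_compose_countable[OF measurable_compose_countable[OF _ A] Suc.IH]) simp
    then show ?case by (simp add: Let_def)
  qed simp
qed

lemma measurable_jumps [measurable]: "(\<lambda>\<omega>. jumps (ws \<omega>) r t) \<in> measurable M (count_space UNIV)"
  unfolding jumps_def by (rule measurable_compose_countable[OF measurable_moves measurable_rings_upto])

lemma nn_integral_rings:
  assumes "0 \<le> t"
  shows "(\<integral>\<^sup>+\<omega>. of_nat (rings_upto (ws \<omega>) r t) \<partial>M) = ennreal t"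
proof -
  interpret S: prob_space "stream_space expo" by (rule expo.prob_space_stream_space)
  have "(\<integral>\<^sup>+\<omega>. of_nat (rings_upto (ws \<omega>) r t) \<partial>M)
     = (\<integral>\<^sup>+\<omega>. (\<Sum>n. of_bool (passes ((!!) (to_stream (ws \<omega> r))) n t) * of_nat n) \<partial>M)"
  proof (rule nn_integral_cong_AE)
    show "AE \<omega> in M. of_nat (rings_upto (ws \<omega>) r t)
      = (\<Sum>n. of_bool (passes ((!!) (to_stream (ws \<omega> r))) n t) * (of_nat n :: ennreal))"
      using AE_regular AE_clock[OF AE_passes[OF assms], of r]
    proof eventually_elim
      case (elim \<omega>)
      then obtain n where n: "passes (ws \<omega> r) n t" by auto
      have "rings_upto (ws \<omega>) r t = n"
      proof (rule rings_uptoI[OF elim(1)])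
        fix m
        have "t < ring_time (ws \<omega>) r m" if "n \<le> m"
          using n psum_mono[of "ws \<omega> r" n m, OF regular_pos[OF elim(1)] that] by (simp add: passes_def ring_time_psum)
        then show "ring_time (ws \<omega>) r m \<le> t \<longleftrightarrow> m < n"
          using n by (auto simp: passes_def ring_time_psum not_le[symmetric])
      qed
      then show ?case using suminf_passes[OF n, of of_nat] by simp
    qed
  qed
  also have "\<dots> = (\<integral>\<^sup>+w. (\<Sum>n. of_bool (passes ((!!) w) n t) * of_nat n) \<partial>stream_space expo)"
    by (rule nn_integral_clock) measurable
  also have "\<dots> = (\<Sum>n. \<integral>\<^sup>+w. of_bool (passes ((!!) w) n t) * of_nat n \<partial>stream_space expo)"
    by (rule nn_integral_suminf) measurable
  also have "\<dots> = (\<Sum>n. of_nat n * ennreal (exp (- t) * t ^ n / fact n))"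
    using nn_integral_passes[OF _ assms, of "\<lambda>_. of_nat _"] by (simp add: S.emeasure_space_1 mult.commute)
  also have "\<dots> = ennreal t" by (rule suminf_poisson(3)[OF assms])
  finally show ?thesis .
qed

definition mean_jumps :: "nat \<Rightarrow> real \<Rightarrow> ennreal" where
  "mean_jumps r t = (\<integral>\<^sup>+\<omega>. of_nat (jumps (ws \<omega>) r t) \<partial>M)"

text \<open>The grid read off from the waits has law \<open>clocks\<close> and on almost every path
  eventually reproduces the jumps. Dominated convergence applies with the rings of the first clock,
  whose mean is \<open>t\<close>.\<close>

lemma mean_moves_tendsto:
  assumes t: "0 < t"
  shows "(\<lambda>K. mean_moves (1 - exp (- (t / real K))) r K) \<longlonglongrightarrow> mean_jumps r t"
proof -
  let ?f = "\<lambda>K \<omega>. of_nat (dmoves (grid (map (\<lambda>r. cells (t / real K) K (ws \<omega> r)) [0..<Suc r])) r K) :: ennreal"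
  have meas: "?f K \<in> borel_measurable M" for K
  proof -
    have "(\<lambda>\<omega>. map (\<lambda>r. cells (t / real K) K (ws \<omega> r)) [0..<Suc r]) \<in> measurable M (count_space UNIV)"
    proof -
      have "(\<lambda>\<omega>. map (\<lambda>r. cells (t / real K) K (ws \<omega> r)) rs) \<in> measurable M (count_space UNIV)" for rs
      proof (induction rs)
        case (Cons r rs)
        have "(\<lambda>\<omega>. (\<lambda>a b. a # b) (cells (t / real K) K (ws \<omega> r)) (map (\<lambda>r. cells (t / real K) K (ws \<omega> r)) rs)) \<in> measurable M (count_space UNIV)"
          by (rule measurable_compose_countable[OF measurable_compose_countable[OF _ Cons] measurable_cells_W]) simp
        then show ?case by simp
      qed simp
      then show ?thesis .
    qed
    from measurable_compose[OF this, of "\<lambda>SS. of_nat (dmoves (grid SS) r K)" borel] show ?thesis by simp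
  qed
  have dm: "dmoves (grid (map (\<lambda>r. cells h K (ws \<omega> r)) [0..<Suc r])) r K = dmoves (\<lambda>i. rung h (ws \<omega> i)) r K" for h K \<omega>
    by (rule dmoves_cong) (auto simp: cells_def nth_append simp del: upt_Suc)
  have "mean_moves (1 - exp (- (t / real K))) r K = (\<integral>\<^sup>+\<omega>. ?f K \<omega> \<partial>M)" for K
    unfolding mean_moves_def using t by (subst nn_integral_grid[symmetric]) auto
  moreover have "(\<lambda>K. \<integral>\<^sup>+\<omega>. ?f K \<omega> \<partial>M) \<longlonglongrightarrow> (\<integral>\<^sup>+\<omega>. of_nat (jumps (ws \<omega>) r t) \<partial>M)"
  proof (rule nn_integral_dominated_convergence)
    show "(\<integral>\<^sup>+\<omega>. of_nat (rings_upto (ws \<omega>) 0 t) \<partial>M) < \<infinity>" using nn_integral_rings[of t 0] t by simp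
    show "AE \<omega> in M. ?f K \<omega> \<le> of_nat (rings_upto (ws \<omega>) 0 t)" for K
      using AE_regular
    proof eventually_elim
      case (elim \<omega>)
      have "dmoves (\<lambda>i. rung (t / real K) (ws \<omega> i)) r K \<le> dmoves (\<lambda>i. rung (t / real K) (ws \<omega> i)) 0 K"
        by (rule dmoves_antimono) simp
      also have "\<dots> \<le> rings_upto (ws \<omega>) 0 (real K * (t / real K))"
        using t by (intro dmoves_0_le_rings[OF elim]) auto
      also have "\<dots> \<le> rings_upto (ws \<omega>) 0 t"
      proof (cases "K = 0")
        \<comment> \<open>For \<open>K = 0\<close> the mesh \<open>t / real K\<close> is
          \<open>0\<close> by the convention on division, and no ring occurs up to time
          \<open>0\<close>.\<close>
        case True
        have "rings_upto (ws \<omega>) 0 0 = 0"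
          by (rule rings_uptoI[OF elim]) (use ring_time_pos[OF elim] in \<open>simp add: not_le\<close>)
        then show ?thesis using True by simp
      qed simp
      finally show ?case unfolding dm by (rule of_nat_mono)
    qed
    show "AE \<omega> in M. (\<lambda>K. ?f K \<omega>) \<longlonglongrightarrow> of_nat (jumps (ws \<omega>) r t)"
      using AE_regular
    proof eventually_elim
      case (elim \<omega>)
      have "eventually (\<lambda>K. ?f K \<omega> = of_nat (jumps (ws \<omega>) r t)) sequentially"
        using eventually_dmoves_eq_jumps[OF elim t, of r] by eventually_elim (simp only: dm)
      then show ?case by (rule tendsto_eventually)
    qed
  qed (use meas in auto)
  ultimately show ?thesis by (simp add: mean_jumps_def)
qed

end

section \<open>Asymptotics\<close>

text \<open>The mean length of the stationary M/M/1 queue with arrival rate \<alpha> and service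
  rate \<open>1\<close>, the limit of \<open>mean_queue p \<alpha>\<close> as \<open>p\<close> tends
  to \<open>0\<close>.\<close>

definition odds :: "real \<Rightarrow> real" where
  "odds \<alpha> = \<alpha> / (1 - \<alpha>)"

lemma mean_queue_bounds:
  assumes "0 < p" "0 < \<alpha>" "\<alpha> < 1"
  shows "mean_queue p \<alpha> \<le> odds \<alpha>" "odds \<alpha> - p / (1 - \<alpha>) \<le> mean_queue p \<alpha>"
proof -
  have eq: "mean_queue p \<alpha> = odds \<alpha> - \<alpha> * \<alpha> * p / (1 - \<alpha>)"
    by (simp add: mean_queue_def odds_def diff_divide_distrib[symmetric] algebra_simps)
  have "\<alpha> * \<alpha> * p / (1 - \<alpha>) \<le> p / (1 - \<alpha>)"
  proof (rule divide_right_mono)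
    have "\<alpha> * \<alpha> \<le> 1" using assms by (simp add: mult_le_one)
    then show "\<alpha> * \<alpha> * p \<le> p" using assms by simp
  qed (use assms in simp)
  moreover have "0 \<le> \<alpha> * \<alpha> * p / (1 - \<alpha>)" using assms by simp
  ultimately show "mean_queue p \<alpha> \<le> odds \<alpha>" "odds \<alpha> - p / (1 - \<alpha>) \<le> mean_queue p \<alpha>"
    unfolding eq by linarith+
qed

lemma real_times_one_minus_exp:
  assumes "0 < t"
  shows "real K * (1 - exp (- (t / real K))) \<le> t"
proof (cases "K = 0")
  case False
  have "1 - exp (- (t / real K)) \<le> t / real K"
    using exp_ge_add_one_self[of "- (t / real K)"] by linarith
  then have "real K * (1 - exp (- (t / real K))) \<le> real K * (t / real K)"
    by (rule mult_left_mono) simp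
  then show ?thesis using False by simp
qed (use assms in simp)

lemma mesh_limits:
  assumes "0 < t"
  shows "(\<lambda>K. 1 - exp (- (t / real K))) \<longlonglongrightarrow> 0"
    and "(\<lambda>K. real K * (1 - exp (- (t / real K)))) \<longlonglongrightarrow> t"
proof -
  have u: "(\<lambda>K. t / real K) \<longlonglongrightarrow> 0"
    by (rule tendsto_divide_0[OF tendsto_const]) (rule filterlim_real_at_infinity_sequentially)
  from tendsto_exp[OF tendsto_minus[OF u]] have "(\<lambda>K. exp (- (t / real K))) \<longlonglongrightarrow> 1" by simp
  from tendsto_diff[OF tendsto_const[of 1] this] show "(\<lambda>K. 1 - exp (- (t / real K))) \<longlonglongrightarrow> 0" by simp
  show "(\<lambda>K. real K * (1 - exp (- (t / real K)))) \<longlonglongrightarrow> t"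
  proof (rule tendsto_sandwich)
    from tendsto_divide[OF tendsto_const[of t] tendsto_add[OF tendsto_const[of 1] u]]
    show "(\<lambda>K. t / (1 + t / real K)) \<longlonglongrightarrow> t" by simp
    show "eventually (\<lambda>K. t / (1 + t / real K) \<le> real K * (1 - exp (- (t / real K)))) sequentially"
      using eventually_gt_at_top[of 0]
    proof eventually_elim
      case (elim K)
      define v where "v = t / real K"
      have v: "0 < v" "t = real K * v" using elim assms by (auto simp: v_def)
      have "exp (- v) \<le> 1 / (1 + v)"
        using exp_ge_add_one_self[of v] v by (simp add: exp_minus inverse_eq_divide frac_le)
      then have "v / (1 + v) \<le> 1 - exp (- v)" using v by (simp add: field_simps)
      then have "real K * (v / (1 + v)) \<le> real K * (1 - exp (- v))" by (rule mult_left_mono) simp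
      then show ?case unfolding v_def[symmetric] using v(2) by simp
    qed
  qed (use real_times_one_minus_exp[OF assms] in auto)
qed

section \<open>Explicit bounds for the mean number of jumps of one particle\<close>

context exponential_clocks
begin

text \<open>Bounds that are uniform in the mesh survive the limit. In the second, the parameter of
  \<open>mean_moves_decay\<close> is set to \<open>2\<close>, which makes the bound geometric in
  \<open>r\<close> and so summable over the particles.\<close>

lemma mean_jumps_le:
  assumes t: "0 < t"
  shows "mean_jumps r t \<le> ennreal t" and "mean_jumps r t \<le> ennreal (exp (2 * t) / 2 ^ Suc r)"
proof -
  let ?p = "\<lambda>K. 1 - exp (- (t / real K))"
  have p: "0 \<le> ?p K" "?p K \<le> 1" for K using t by auto
  have "mean_moves (?p K) r K \<le> ennreal t" for K
    using mean_moves_le[OF p(1)[of K] p(2)[of K], of r K] ennreal_leI[OF real_times_one_minus_exp[OF t, of K]] by (rule order_trans)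
  then show "mean_jumps r t \<le> ennreal t"
    by (intro LIMSEQ_le_const2[OF mean_moves_tendsto[OF t]]) auto
  have "mean_moves (?p K) r K \<le> ennreal (exp (2 * t) / 2 ^ Suc r)" for K
  proof -
    have "real K * ?p K * 2 \<le> 2 * t" using real_times_one_minus_exp[OF t, of K] by linarith
    then have "exp (real K * ?p K * 2) / 2 ^ Suc r \<le> exp (2 * t) / 2 ^ Suc r"
      by (intro divide_right_mono) auto
    then show ?thesis
      using mean_moves_decay[OF p(1)[of K] p(2)[of K], of 2 r K] by (meson ennreal_leI order_trans zero_less_numeral)
  qed
  then show "mean_jumps r t \<le> ennreal (exp (2 * t) / 2 ^ Suc r)"
    by (intro LIMSEQ_le_const2[OF mean_moves_tendsto[OF t]]) auto
qed

lemma mean_jumps_antimono: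
  assumes t: "0 < t" and "r \<le> r'"
  shows "mean_jumps r' t \<le> mean_jumps r t"
  unfolding mean_jumps_def
proof (rule nn_integral_mono_AE)
  show "AE \<omega> in M. of_nat (jumps (ws \<omega>) r' t) \<le> (of_nat (jumps (ws \<omega>) r t) :: ennreal)"
    using AE_regular
  proof eventually_elim
    case (elim \<omega>)
    have "eventually (\<lambda>K. jumps (ws \<omega>) r' t \<le> jumps (ws \<omega>) r t) sequentially"
      using eventually_dmoves_eq_jumps[OF elim t, of r] eventually_dmoves_eq_jumps[OF elim t, of r']
      by eventually_elim (metis assms(2) dmoves_antimono)
    then have "jumps (ws \<omega>) r' t \<le> jumps (ws \<omega>) r t" by (auto simp: eventually_sequentially)
    then show ?case by (rule of_nat_mono)
  qed
qed

definition mj :: "nat \<Rightarrow> real \<Rightarrow> real" where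
  "mj r t = enn2real (mean_jumps r t)"

lemma ennreal_mj: "0 < t \<Longrightarrow> ennreal (mj r t) = mean_jumps r t"
  unfolding mj_def using mean_jumps_le(1)[of t r]
  by (intro ennreal_enn2real) (auto simp: top_unique less_top[symmetric])

lemma mj_nonneg: "0 \<le> mj r t"
  by (simp add: mj_def)

lemma mj_bounds:
  assumes t: "0 < t"
  shows "mj r t \<le> t" "mj r t \<le> exp (2 * t) / 2 ^ Suc r"
proof -
  have "ennreal (mj r t) \<le> ennreal t" "ennreal (mj r t) \<le> ennreal (exp (2 * t) / 2 ^ Suc r)"
    using mean_jumps_le[OF t, of r] ennreal_mj[OF t, of r] by auto
  then show "mj r t \<le> t" "mj r t \<le> exp (2 * t) / 2 ^ Suc r"
    using t by (auto simp: ennreal_le_iff simp del: power_Suc)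
qed

lemma mj_antimono: "0 < t \<Longrightarrow> r \<le> r' \<Longrightarrow> mj r' t \<le> mj r t"
  using mean_jumps_antimono[of t r r'] ennreal_mj[of t r] ennreal_mj[of t r'] mj_nonneg
  by (metis ennreal_le_iff)

text \<open>One mesh is fixed for given \<open>t\<close>, with an error \<open>1\<close> in the mean
  that is negligible after division by \<open>t\<close>. The number of cells is a multiple of
  \<open>n\<close>, so that its \<open>n\<close>-th part is an exact time window for near
  exits.\<close>

lemma discretisation:
  assumes t: "0 < t" and n: "0 < (n :: nat)"
  obtains m p where "0 < p" "p < 1" "p \<le> 1 / t" "t - 1 \<le> real (n * m) * p" "real (n * m) * p \<le> t"
    "mean_moves p r (n * m) \<le> ennreal (mj r t + 1)" "ennreal (mj r t) \<le> mean_moves p r (n * m) + 1"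
proof -
  let ?p = "\<lambda>K. 1 - exp (- (t / real K))"
  have sub: "filterlim (\<lambda>m. n * m) sequentially sequentially"
    using n by (simp add: filterlim_at_top_gt mult_nat_left_at_top)
  have lim: "(\<lambda>K. mean_moves (?p K) r K) \<longlonglongrightarrow> ennreal (mj r t)"
    using mean_moves_tendsto[OF t, of r] ennreal_mj[OF t, of r] by simp
  have fin: "mean_moves (?p K) r K = ennreal (enn2real (mean_moves (?p K) r K))" for K
    using mean_moves_le[of "?p K" r K] t by (intro ennreal_enn2real[symmetric]) (auto simp: top_unique less_top[symmetric])
  have lim': "(\<lambda>K. enn2real (mean_moves (?p K) r K)) \<longlonglongrightarrow> mj r t"
    using tendsto_enn2real[OF lim] mj_nonneg by simp
  have "eventually (\<lambda>K. 0 < K \<and> ?p K < 1 / t \<and> t - 1 < real K * ?p K \<and>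
     enn2real (mean_moves (?p K) r K) < mj r t + 1 \<and> mj r t - 1 < enn2real (mean_moves (?p K) r K)) sequentially"
    using order_tendstoD(2)[OF mesh_limits(1)[OF t], of "1 / t"] order_tendstoD(1)[OF mesh_limits(2)[OF t], of "t - 1"]
      order_tendstoD(2)[OF lim', of "mj r t + 1"] order_tendstoD(1)[OF lim', of "mj r t - 1"] eventually_gt_at_top[of 0] t
    by (auto elim!: eventually_elim2 simp: eventually_conj_iff)
  from eventually_compose_filterlim[OF this sub] obtain m where m: "0 < n * m" "?p (n * m) < 1 / t"
    "t - 1 < real (n * m) * ?p (n * m)" "enn2real (mean_moves (?p (n * m)) r (n * m)) < mj r t + 1"
    "mj r t - 1 < enn2real (mean_moves (?p (n * m)) r (n * m))"
    by (auto simp: eventually_sequentially)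
  show ?thesis
  proof (rule that[of "?p (n * m)" m])
    show "mean_moves (?p (n * m)) r (n * m) \<le> ennreal (mj r t + 1)"
      using m(4) by (subst fin) (intro ennreal_leI, simp)
    have "ennreal (mj r t) \<le> ennreal (enn2real (mean_moves (?p (n * m)) r (n * m)) + 1)"
      using m(5) by (intro ennreal_leI) simp
    then show "ennreal (mj r t) \<le> mean_moves (?p (n * m)) r (n * m) + 1"
      by (subst fin) simp
  qed (use m t real_times_one_minus_exp[OF t, of "n * m"] in auto)
qed

text \<open>The choice \<open>s = sqrt t\<close> in \<open>mean_moves_ge\<close> balances its two
  error terms when \<open>r\<close> is of order \<open>t\<close>. Replacing
  \<open>mean_queue\<close> by the larger \<open>odds\<close> only weakens the bound.\<close>

lemma mj_ge:
  assumes t: "0 < t" and \<alpha>: "0 < \<alpha>" "\<alpha> < 1"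
  shows "\<alpha> * (t - 1) - real (Suc r) * odds \<alpha> - 1 - sqrt t - (2 * t + 4 * real (Suc r) / (1 - \<alpha>)\<^sup>2) / sqrt t \<le> mj r t"
proof -
  obtain m p where p: "0 < p" "p < 1" "p \<le> 1 / t" "t - 1 \<le> real (1 * m) * p" "real (1 * m) * p \<le> t"
    "mean_moves p r (1 * m) \<le> ennreal (mj r t + 1)"
    using discretisation[OF t, of 1 r] by (metis zero_less_one)
  let ?h = "mean_height p (Suc r) m \<alpha>" and ?w = "noise p (Suc r) m \<alpha>"
  have s: "0 < sqrt t" using t by simp
  have w0: "0 \<le> ?w" using p by (simp add: noise_def)
  have "ennreal ?h \<le> ennreal (mj r t + 1) + ennreal (sqrt t + ?w / sqrt t)"
    using mean_moves_ge[OF p(1,2) \<alpha> s, of r m] p(6) by (metis add_right_mono mult_1 order_trans)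
  also have "\<dots> = ennreal (mj r t + 1 + (sqrt t + ?w / sqrt t))"
    using mj_nonneg[of r t] s w0 by (intro ennreal_plus[symmetric]) auto
  finally have "?h \<le> mj r t + 1 + (sqrt t + ?w / sqrt t)"
    using mj_nonneg[of r t] s w0 by (subst (asm) ennreal_le_iff) auto
  moreover have "\<alpha> * (t - 1) - real (Suc r) * odds \<alpha> \<le> ?h"
  proof -
    have "\<alpha> * (t - 1) \<le> \<alpha> * (real m * p)" using p \<alpha> by (intro mult_left_mono) auto
    moreover have "real (Suc r) * mean_queue p \<alpha> \<le> real (Suc r) * odds \<alpha>"
      using mean_queue_bounds(1)[OF p(1) \<alpha>] by (intro mult_left_mono) auto
    moreover have "?h = \<alpha> * (real m * p) - real (Suc r) * mean_queue p \<alpha>"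
      unfolding mean_height_def by (simp only: mult.left_commute)
    ultimately show ?thesis by linarith
  qed
  moreover have "?w / sqrt t \<le> (2 * t + 4 * real (Suc r) / (1 - \<alpha>)\<^sup>2) / sqrt t"
    using s p by (intro divide_right_mono) (auto simp: noise_def)
  ultimately show ?thesis by linarith
qed

text \<open>\<open>mean_moves_le_deviation\<close> divided by \<open>t\<close>:
  \<open>\<rho>\<close> and \<open>\<sigma>\<close> are scaled indices, \<open>b\<beta>\<close> and
  \<open>b\<gamma>\<close> lower bounds of the scaled drifts, \<open>\<omega>\<close> an upper bound
  of the scaled noise. The terms \<open>\<rho> / (1 - \<alpha>) / t\<close> pay for passing from
  \<open>mean_queue\<close> to \<open>odds\<close> with \<open>p \<le> 1 / t\<close>.\<close>

lemma mj_le: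
  fixes t \<alpha> \<beta> \<gamma> \<rho> \<sigma> :: real and n l r :: nat
  assumes t: "0 < t" and n: "0 < n" and par: "0 < \<beta>" "\<beta> < \<alpha>" "\<alpha> < \<gamma>" "\<gamma> < 1" and l: "l \<le> Suc r"
  defines "\<rho> \<equiv> real (Suc r) / t" and "\<sigma> \<equiv> real l / t"
  defines "b\<beta> \<equiv> \<rho> * (odds \<alpha> - odds \<beta>) - (\<alpha> - \<beta>) * (1 - 1 / real n) - \<rho> / (1 - \<alpha>) / t"
    and "b\<gamma> \<equiv> (\<gamma> - \<alpha>) * (1 - 1 / t) - (\<rho> - \<sigma>) * (odds \<gamma> - odds \<alpha>) - \<rho> / (1 - \<alpha>) / t"
    and "\<omega> \<equiv> 2 + 4 * \<rho> / (1 - \<gamma>)\<^sup>2"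
  assumes b: "0 < b\<beta>" "0 < b\<gamma>"
  shows "mj r t / t \<le> 1 / t + max 0 (1 / t + \<alpha> - \<rho> * odds \<alpha> + \<rho> / (1 - \<alpha>) / t + 1 / real n + \<sigma> * odds \<alpha>)
     + 2 / sqrt t + 11 * \<omega> / sqrt t + (10 * \<omega> / b\<beta>\<^sup>2 + 16 * \<omega> / b\<gamma>\<^sup>2) / t"
proof -
  obtain m p where p: "0 < p" "p < 1" "p \<le> 1 / t" "t - 1 \<le> real (n * m) * p" "real (n * m) * p \<le> t"
    "ennreal (mj r t) \<le> mean_moves p r (n * m) + 1"
    using discretisation[OF t n, of r] by metis
  define K R T where "K = n * m" and "R = real (Suc r)" and "T = real K * p"
  have T: "t - 1 \<le> T" "T \<le> t" "0 \<le> T" using p by (auto simp: T_def K_def)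
  have \<alpha>: "0 < \<alpha>" "\<alpha> < 1" and \<beta>: "\<beta> < 1" and \<gamma>: "0 < \<gamma>" using par by auto
  have mp: "real m * p = T / real n" using n by (simp add: T_def K_def)
  have s: "0 < sqrt t" using t by simp
  have R: "R = \<rho> * t" "0 \<le> R" and lt: "real l = \<sigma> * t" and \<rho>: "0 \<le> \<rho>" "0 \<le> \<sigma>" "\<sigma> \<le> \<rho>"
    using t l by (auto simp: R_def \<rho>_def \<sigma>_def divide_right_mono)
  have \<omega>: "0 \<le> \<omega>" using \<rho> by (simp add: \<omega>_def)
  have q\<alpha>: "mean_queue p \<alpha> \<le> odds \<alpha>" "odds \<alpha> - 1 / (1 - \<alpha>) / t \<le> mean_queue p \<alpha>"
  proof -
    have "p / (1 - \<alpha>) \<le> 1 / t / (1 - \<alpha>)" using p(3) \<alpha> by (intro divide_right_mono) auto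
    then show "mean_queue p \<alpha> \<le> odds \<alpha>" "odds \<alpha> - 1 / (1 - \<alpha>) / t \<le> mean_queue p \<alpha>"
      using mean_queue_bounds[OF p(1) \<alpha>] by (auto simp: mult.commute)
  qed
  have q\<beta>: "mean_queue p \<beta> \<le> odds \<beta>" and q\<gamma>: "mean_queue p \<gamma> \<le> odds \<gamma>"
    using mean_queue_bounds(1)[OF p(1)] par \<beta> \<gamma> by auto
  let ?h = "mean_height p (Suc r) K"
  define \<mu>\<beta> where "\<mu>\<beta> = ?h \<beta> - ?h \<alpha> + real m * ((\<alpha> - \<beta>) * p)"
  define \<mu>\<gamma> where "\<mu>\<gamma> = ?h \<gamma> - ?h \<alpha> + real l * (mean_queue p \<gamma> - mean_queue p \<alpha>)"
  define w where "w = noise p (Suc r) K \<gamma>"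
  have h: "?h \<delta> = \<delta> * T - R * mean_queue p \<delta>" for \<delta>
    by (simp add: mean_height_def T_def R_def)
  have \<mu>\<beta>: "t * b\<beta> \<le> \<mu>\<beta>"
  proof -
    have "\<mu>\<beta> = R * mean_queue p \<alpha> - R * mean_queue p \<beta> - (\<alpha> - \<beta>) * (1 - 1 / real n) * T"
    proof -
      have eq: "real m * ((\<alpha> - \<beta>) * p) = (\<alpha> - \<beta>) * (T * (1 / real n))"
      proof -
        have "real m * ((\<alpha> - \<beta>) * p) = (\<alpha> - \<beta>) * (real m * p)" by (simp only: mult.left_commute)
        then show ?thesis using mp by simp
      qed
      have "\<beta> * T - R * qb - (\<alpha> * T - R * qa) + (\<alpha> - \<beta>) * (T * N)
          = R * qa - R * qb - (\<alpha> - \<beta>) * (1 - N) * T" for qa qb N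
        by (simp add: algebra_simps)
      then show ?thesis unfolding \<mu>\<beta>_def h eq .
    qed
    moreover have "R * (odds \<alpha> - 1 / (1 - \<alpha>) / t) \<le> R * mean_queue p \<alpha>" "R * mean_queue p \<beta> \<le> R * odds \<beta>"
      using q\<alpha> q\<beta> R by (auto intro: mult_left_mono)
    moreover have "(\<alpha> - \<beta>) * (1 - 1 / real n) * T \<le> (\<alpha> - \<beta>) * (1 - 1 / real n) * t"
      using par n T by (intro mult_left_mono mult_nonneg_nonneg) auto
    moreover have "t * b\<beta> = R * (odds \<alpha> - 1 / (1 - \<alpha>) / t) - R * odds \<beta> - (\<alpha> - \<beta>) * (1 - 1 / real n) * t"
      unfolding b\<beta>_def R(1) by (simp add: algebra_simps)
    ultimately show ?thesis by linarith
  qed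
  have \<mu>\<gamma>: "t * b\<gamma> \<le> \<mu>\<gamma>"
  proof -
    have "\<mu>\<gamma> = (\<gamma> - \<alpha>) * T - (R - real l) * mean_queue p \<gamma> + (R - real l) * mean_queue p \<alpha>"
      unfolding \<mu>\<gamma>_def h by (simp add: algebra_simps)
    moreover have Rl: "0 \<le> R - real l" "R - real l \<le> R" using l by (auto simp: R_def)
    moreover have "(R - real l) * mean_queue p \<gamma> \<le> (R - real l) * odds \<gamma>"
      using q\<gamma> Rl by (intro mult_left_mono) auto
    moreover have "(R - real l) * (odds \<alpha> - 1 / (1 - \<alpha>) / t) \<le> (R - real l) * mean_queue p \<alpha>"
      using q\<alpha> Rl by (intro mult_left_mono) auto
    moreover have "(R - real l) * (1 / (1 - \<alpha>) / t) \<le> R * (1 / (1 - \<alpha>) / t)"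
      using Rl \<alpha> t by (intro mult_right_mono) auto
    moreover have "(\<gamma> - \<alpha>) * (t - 1) \<le> (\<gamma> - \<alpha>) * T" using par T by (intro mult_left_mono) auto
    moreover have "t * b\<gamma> = (\<gamma> - \<alpha>) * (t - 1) - (R - real l) * (odds \<gamma> - odds \<alpha>) - R * (1 / (1 - \<alpha>) / t)"
    proof -
      have "t * ((\<gamma> - \<alpha>) * (1 - 1 / t)) = (\<gamma> - \<alpha>) * (t - 1)" using t by (simp add: field_simps)
      then show ?thesis unfolding b\<gamma>_def R(1) lt using t by (simp add: algebra_simps)
    qed
    ultimately show ?thesis by (simp add: algebra_simps)
  qed
  have wt: "w \<le> \<omega> * t"
  proof -
    have "\<omega> * t = 2 * t + 4 * R / (1 - \<gamma>)\<^sup>2" by (simp add: \<omega>_def R(1) algebra_simps)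
    then show ?thesis using T by (simp add: w_def noise_def T_def R_def)
  qed
  have w0: "0 \<le> w" using p by (simp add: w_def noise_def)
  have tb: "0 < t * b\<beta>" "0 < t * b\<gamma>" using b t by auto
  have pos: "0 < \<mu>\<beta>" "0 < \<mu>\<gamma>" using \<mu>\<beta> \<mu>\<gamma> tb by auto
  define A where "A = 1 + ?h \<alpha> + real m * p + real l * mean_queue p \<alpha>"
  define B where "B = 2 * sqrt t + 11 * w / sqrt t + T * (10 * w / \<mu>\<beta>\<^sup>2 + 16 * w / \<mu>\<gamma>\<^sup>2)"
  have B0: "0 \<le> B" using s w0 T by (simp add: B_def)
  have "mean_moves p r K \<le> ennreal A + ennreal B"
    unfolding A_def B_def T_def w_def \<mu>\<beta>_def \<mu>\<gamma>_def
    by (rule mean_moves_le_deviation[OF p(1,2) par refl _ l s])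
      (use pos n in \<open>auto simp: K_def \<mu>\<beta>_def \<mu>\<gamma>_def\<close>)
  then have "ennreal (mj r t) \<le> ennreal A + ennreal B + 1"
    using p(6) by (metis K_def add_right_mono order_trans)
  also have "\<dots> = ennreal (max 0 A + B + 1)"
    using B0 by (simp add: ennreal_plus[symmetric] ennreal_1[symmetric] max_def ennreal_neg del: ennreal_plus ennreal_1)
  finally have mjle: "mj r t \<le> max 0 A + B + 1"
    using B0 by (subst (asm) ennreal_le_iff) auto
  have A: "A / t \<le> 1 / t + \<alpha> - \<rho> * odds \<alpha> + \<rho> / (1 - \<alpha>) / t + 1 / real n + \<sigma> * odds \<alpha>"
  proof -
    have "A \<le> 1 + \<alpha> * t - R * (odds \<alpha> - 1 / (1 - \<alpha>) / t) + t / real n + real l * odds \<alpha>"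
    proof -
      have "\<alpha> * T \<le> \<alpha> * t" "T / real n \<le> t / real n" using T \<alpha> by (auto intro: mult_left_mono divide_right_mono)
      moreover have "R * (odds \<alpha> - 1 / (1 - \<alpha>) / t) \<le> R * mean_queue p \<alpha>" "real l * mean_queue p \<alpha> \<le> real l * odds \<alpha>"
        using q\<alpha> R by (auto intro: mult_left_mono)
      ultimately show ?thesis unfolding A_def h mp by linarith
    qed
    then have "A / t \<le> (1 + \<alpha> * t - R * (odds \<alpha> - 1 / (1 - \<alpha>) / t) + t / real n + real l * odds \<alpha>) / t"
      using t by (intro divide_right_mono) auto
    also have "\<dots> = 1 / t + \<alpha> - \<rho> * odds \<alpha> + \<rho> / (1 - \<alpha>) / t + 1 / real n + \<sigma> * odds \<alpha>"
      unfolding R(1) lt using t by (simp add: add_divide_distrib diff_divide_distrib right_diff_distrib)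
    finally show ?thesis .
  qed
  have Bt: "B / t \<le> 2 / sqrt t + 11 * \<omega> / sqrt t + (10 * \<omega> / b\<beta>\<^sup>2 + 16 * \<omega> / b\<gamma>\<^sup>2) / t"
  proof -
    have sq: "sqrt t / t = 1 / sqrt t" using t by (simp add: real_div_sqrt field_simps)
    \<comment> \<open>Noise of order \<open>t\<close> against a squared drift of order
      \<open>t^2\<close> leaves \<open>1 / t\<close>; the prefactor \<open>T \<le> t\<close> is
      cancelled by the final division by \<open>t\<close>.\<close>
    have frac: "c * w / \<mu>\<^sup>2 \<le> c * \<omega> / d\<^sup>2 / t" if "0 < t * d" "t * d \<le> \<mu>" "0 \<le> c" for c d \<mu>
    proof -
      have "c * w / \<mu>\<^sup>2 \<le> c * (\<omega> * t) / (t * d)\<^sup>2"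
        using that wt w0 by (intro frac_le mult_left_mono power_mono zero_less_power) auto
      also have "\<dots> = c * \<omega> / d\<^sup>2 / t" using t by (simp add: power2_eq_square)
      finally show ?thesis .
    qed
    have "10 * w / \<mu>\<beta>\<^sup>2 + 16 * w / \<mu>\<gamma>\<^sup>2 \<le> 10 * \<omega> / b\<beta>\<^sup>2 / t + 16 * \<omega> / b\<gamma>\<^sup>2 / t"
      using frac[OF tb(1) \<mu>\<beta>, of 10] frac[OF tb(2) \<mu>\<gamma>, of 16] by simp
    then have "T * (10 * w / \<mu>\<beta>\<^sup>2 + 16 * w / \<mu>\<gamma>\<^sup>2) \<le> t * (10 * \<omega> / b\<beta>\<^sup>2 / t + 16 * \<omega> / b\<gamma>\<^sup>2 / t)"
      using T w0 by (intro mult_mono) auto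
    moreover have "11 * w / sqrt t \<le> 11 * (\<omega> * t) / sqrt t" using wt s by (intro divide_right_mono) auto
    ultimately have "B \<le> 2 * sqrt t + 11 * (\<omega> * t) / sqrt t + t * (10 * \<omega> / b\<beta>\<^sup>2 / t + 16 * \<omega> / b\<gamma>\<^sup>2 / t)"
      unfolding B_def by linarith
    then have "B / t \<le> (2 * sqrt t + 11 * (\<omega> * t) / sqrt t + t * (10 * \<omega> / b\<beta>\<^sup>2 / t + 16 * \<omega> / b\<gamma>\<^sup>2 / t)) / t"
      using t by (intro divide_right_mono) auto
    also have "\<dots> = 2 * (sqrt t / t) + 11 * \<omega> / sqrt t + (10 * \<omega> / b\<beta>\<^sup>2 + 16 * \<omega> / b\<gamma>\<^sup>2) / t"
      using t by (simp add: add_divide_distrib)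
    finally show ?thesis unfolding sq by simp
  qed
  have "mj r t / t \<le> (max 0 A + B + 1) / t" using mjle t by (intro divide_right_mono) auto
  also have "\<dots> = max 0 (A / t) + B / t + 1 / t"
    using t by (simp add: add_divide_distrib max_def divide_le_0_iff zero_le_divide_iff)
  finally show ?thesis using A Bt by linarith
qed

end

section \<open>Limits for the particle with index \<open>x * t\<close>\<close>

lemma one_over_tendsto_0: "((\<lambda>t::real. 1 / t) \<longlongrightarrow> 0) at_top"
  using tendsto_inverse_0_at_top[OF filterlim_ident] by (simp add: inverse_eq_divide)

lemma one_over_sqrt_tendsto_0: "((\<lambda>t::real. 1 / sqrt t) \<longlongrightarrow> 0) at_top"
  using tendsto_inverse_0_at_top[OF sqrt_at_top] by (simp add: inverse_eq_divide)

lemma floor_ratio_tendsto: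
  assumes "0 \<le> x"
  shows "((\<lambda>t. real (Suc (nat \<lfloor>x * t\<rfloor>)) / t) \<longlongrightarrow> x) at_top"
proof (rule tendsto_sandwich)
  note inv = one_over_tendsto_0
  show "((\<lambda>_. x) \<longlongrightarrow> x) at_top" by simp
  show "((\<lambda>t. x + 1 / t) \<longlongrightarrow> x) at_top"
    using tendsto_add[OF tendsto_const inv, of x] by simp
  have b: "x * t \<le> real (Suc (nat \<lfloor>x * t\<rfloor>))" "real (Suc (nat \<lfloor>x * t\<rfloor>)) \<le> x * t + 1" if "0 < t" for t
  proof -
    have "0 \<le> x * t" using that assms by simp
    then have "real (nat \<lfloor>x * t\<rfloor>) = of_int \<lfloor>x * t\<rfloor>" by simp
    then show "x * t \<le> real (Suc (nat \<lfloor>x * t\<rfloor>))" "real (Suc (nat \<lfloor>x * t\<rfloor>)) \<le> x * t + 1" by linarith+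
  qed
  show "\<forall>\<^sub>F t in at_top. x \<le> real (Suc (nat \<lfloor>x * t\<rfloor>)) / t"
    using eventually_gt_at_top[of 0] by eventually_elim (use b(1) in \<open>simp add: pos_le_divide_eq del: of_nat_Suc\<close>)
  show "\<forall>\<^sub>F t in at_top. real (Suc (nat \<lfloor>x * t\<rfloor>)) / t \<le> x + 1 / t"
    using eventually_gt_at_top[of 0]
  proof eventually_elim
    case (elim t)
    then have "real (Suc (nat \<lfloor>x * t\<rfloor>)) / t \<le> (x * t + 1) / t" using b(2)[of t] by (intro divide_right_mono) auto
    then show ?case using elim by (simp add: add_divide_distrib)
  qed
qed

lemma div_ratio_tendsto:
  assumes R: "((\<lambda>t. real (R t) / t) \<longlongrightarrow> x) at_top" and n: "0 < n"
  shows "((\<lambda>t. real (R t div n) / t) \<longlongrightarrow> x / real n) at_top"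
proof (rule tendsto_sandwich[where f = "\<lambda>t. real (R t) / t / real n - 1 / t" and h = "\<lambda>t. real (R t) / t / real n"])
  note inv = one_over_tendsto_0
  have q: "((\<lambda>t. real (R t) / t / real n) \<longlongrightarrow> x / real n) at_top"
    using n by (intro tendsto_divide R tendsto_const) auto
  then show "((\<lambda>t. real (R t) / t / real n) \<longlongrightarrow> x / real n) at_top" .
  show "((\<lambda>t. real (R t) / t / real n - 1 / t) \<longlongrightarrow> x / real n) at_top"
    using tendsto_diff[OF q inv] by simp
  have b: "real k / real n - 1 \<le> real (k div n)" "real (k div n) \<le> real k / real n" for k
  proof -
    show "real (k div n) \<le> real k / real n" by (rule of_nat_div_le_of_nat)
    have "k \<le> n * (k div n) + n"
      using mod_less_divisor[OF n, of k] mult_div_mod_eq[of n k] by linarith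
    then have "real k \<le> real n * real (k div n) + real n" by (metis of_nat_add of_nat_le_iff of_nat_mult)
    then show "real k / real n - 1 \<le> real (k div n)" using n by (simp add: field_simps)
  qed
  show "\<forall>\<^sub>F t in at_top. real (R t div n) / t \<le> real (R t) / t / real n"
    using eventually_gt_at_top[of 0]
  proof eventually_elim
    case (elim t)
    then have "real (R t div n) / t \<le> real (R t) / real n / t" using b(2) by (intro divide_right_mono) auto
    then show ?case by (simp add: mult.commute)
  qed
  show "\<forall>\<^sub>F t in at_top. real (R t) / t / real n - 1 / t \<le> real (R t div n) / t"
    using eventually_gt_at_top[of 0]
  proof eventually_elim
    case (elim t)
    then have "(real (R t) / real n - 1) / t \<le> real (R t div n) / t" using b(1) by (intro divide_right_mono) auto
    then show ?case by (simp add: diff_divide_distrib mult.commute)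
  qed
qed

context exponential_clocks
begin

lemma mj_ratio_eventually_ge:
  assumes x: "0 < x" "x < 1" and c: "c < (1 - sqrt x)\<^sup>2"
  shows "eventually (\<lambda>t. c < mj (nat \<lfloor>x * t\<rfloor>) t / t) at_top"
proof -
  define y where "y = sqrt x"
  have y: "0 < y" "y < 1" "x = y * y" using x by (auto simp: y_def)
  let ?R = "\<lambda>t. Suc (nat \<lfloor>x * t\<rfloor>)"
  note inv = one_over_tendsto_0
  note sq = one_over_sqrt_tendsto_0
  have \<rho>: "((\<lambda>t. real (?R t) / t) \<longlongrightarrow> x) at_top" using x by (intro floor_ratio_tendsto) simp
  let ?\<alpha> = "1 - y"
  let ?L = "\<lambda>t. ?\<alpha> * (1 - 1 / t) - real (?R t) / t * odds ?\<alpha> - 1 / t - 1 / sqrt t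
      - (2 + 4 * (real (?R t) / t) / (1 - ?\<alpha>)\<^sup>2) * (1 / sqrt t)"
  have "(?L \<longlongrightarrow> ?\<alpha> * (1 - 0) - x * odds ?\<alpha> - 0 - 0 - (2 + 4 * x / (1 - ?\<alpha>)\<^sup>2) * 0) at_top"
    using y by (intro tendsto_intros inv sq \<rho>) auto
  \<comment> \<open>With \<open>x = y * y\<close> and \<open>odds (1 - y) = (1 - y) / y\<close> the
    value is \<open>(1 - y) - y * (1 - y)\<close>.\<close>
  moreover have "?\<alpha> * (1 - 0) - x * odds ?\<alpha> - 0 - 0 - (2 + 4 * x / (1 - ?\<alpha>)\<^sup>2) * 0 = (1 - sqrt x)\<^sup>2"
    using y by (simp add: odds_def y_def[symmetric] power2_eq_square field_simps)
  ultimately have "(?L \<longlongrightarrow> (1 - sqrt x)\<^sup>2) at_top" by (simp only:)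
  from order_tendstoD(1)[OF this c] eventually_gt_at_top[of 0]
  show ?thesis
  proof eventually_elim
    case (elim t)
    have "(?\<alpha> * (t - 1) - real (?R t) * odds ?\<alpha> - 1 - sqrt t - (2 * t + 4 * real (?R t) / (1 - ?\<alpha>)\<^sup>2) / sqrt t) / t
       \<le> mj (nat \<lfloor>x * t\<rfloor>) t / t"
      using mj_ge[OF elim(2), of ?\<alpha> "nat \<lfloor>x * t\<rfloor>"] y(1,2) elim(2) by (intro divide_right_mono) auto
    moreover have "?L t = (?\<alpha> * (t - 1) - real (?R t) * odds ?\<alpha> - 1 - sqrt t - (2 * t + 4 * real (?R t) / (1 - ?\<alpha>)\<^sup>2) / sqrt t) / t"
    proof -
      have s: "sqrt t / t = 1 / sqrt t" using elim(2) by (simp add: real_div_sqrt field_simps)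
      have "(a * (t - 1) - R * b - 1 - sqrt t - (2 * t + 4 * R / d) / sqrt t) / t
          = a * (1 - 1 / t) - R / t * b - 1 / t - sqrt t / t - (2 + 4 * (R / t) / d) * (1 / sqrt t)" for a R b d
        using elim(2) by (simp add: diff_divide_distrib add_divide_distrib right_diff_distrib distrib_right mult.commute)
      then show ?thesis by (simp only: s)
    qed
    ultimately show ?case using elim(1) by linarith
  qed
qed

text \<open>The order of the choices matters. The window \<open>1 / n\<close> is fixed first, so
  small that the limiting cost of a near exit stays below \<open>c\<close>; the perturbation
  \<open>e\<close> of the intensity is then tied to it; only afterwards does \<open>t\<close> grow,
  so that the error terms vanish while the drifts keep positive limits.\<close>

lemma mj_ratio_eventually_le:
  assumes x: "0 < x" "x < 1" and c: "(1 - sqrt x)\<^sup>2 < c"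
  shows "eventually (\<lambda>t. mj (nat \<lfloor>x * t\<rfloor>) t / t < c) at_top"
proof -
  define y where "y = sqrt x"
  have y: "0 < y" "y < 1" "x = y * y" using x by (auto simp: y_def)
  let ?\<alpha> = "1 - y"
  note inv = one_over_tendsto_0
  note sq = one_over_sqrt_tendsto_0
  have invn: "(\<lambda>n. 1 / real n) \<longlonglongrightarrow> 0" by (rule lim_1_over_n)
  have "(\<lambda>n. (1 - y)\<^sup>2 + 1 / real n + x * (1 / real n) * odds ?\<alpha>) \<longlonglongrightarrow> (1 - y)\<^sup>2 + 0 + x * 0 * odds ?\<alpha>"
    by (intro tendsto_intros invn)
  then have "eventually (\<lambda>n. (1 - y)\<^sup>2 + 1 / real n + x * (1 / real n) * odds ?\<alpha> < c) sequentially"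
    using c by (intro order_tendstoD(2)) (auto simp: y_def)
  \<comment> \<open>Ensures \<open>e < 1 - y\<close>, that is, a positive intensity
    \<open>?\<beta>\<close>.\<close>
  moreover have "eventually (\<lambda>n. y / 2 * (1 / real n) < 1 - y) sequentially"
  proof (rule order_tendstoD(2))
    show "(\<lambda>n. y / 2 * (1 / real n)) \<longlonglongrightarrow> y / 2 * 0" by (intro tendsto_intros invn)
  qed (use y in simp)
  ultimately have "eventually (\<lambda>n. 0 < n \<and> y / 2 * (1 / real n) < 1 - y \<and>
      (1 - y)\<^sup>2 + 1 / real n + x * (1 / real n) * odds ?\<alpha> < c) sequentially"
    using eventually_gt_at_top[of 0] by eventually_elim auto
  then obtain n where n: "0 < n" "y / 2 * (1 / real n) < 1 - y"
      "(1 - y)\<^sup>2 + 1 / real n + x * (1 / real n) * odds ?\<alpha> < c"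
    by (auto simp: eventually_sequentially)
  define \<delta> where "\<delta> = 1 / real n"
  \<comment> \<open>The limiting drifts turn out to be
    \<open>e * (\<delta> * (y + e) - e) / (y + e)\<close> and
    \<open>e * (y * \<delta> - e) / (y - e)\<close>. Both are positive for
    \<open>e < y * \<delta>\<close>, and half this threshold is taken.\<close>
  define e where "e = y / 2 * \<delta>"
  have \<delta>: "0 < \<delta>" "\<delta> \<le> 1" using n(1) by (auto simp: \<delta>_def)
  have e: "0 < e" "e < 1 - y" "e < y"
  proof -
    show "0 < e" using y \<delta> by (simp add: e_def)
    show "e < 1 - y" using n(2) by (simp only: e_def \<delta>_def)
    have "y / 2 * \<delta> \<le> y / 2 * 1" using y \<delta> by (intro mult_left_mono) auto
    then show "e < y" using y unfolding e_def by linarith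
  qed
  let ?\<beta> = "?\<alpha> - e" and ?\<gamma> = "?\<alpha> + e"
  have odds: "odds ?\<alpha> = 1 / y - 1" "odds ?\<beta> = 1 / (y + e) - 1" "odds ?\<gamma> = 1 / (y - e) - 1"
  proof -
    have odds: "odds (1 - z) = 1 / z - 1" if "0 < z" for z
      using that by (simp add: odds_def diff_divide_distrib)
    have eq: "?\<beta> = 1 - (y + e)" "?\<gamma> = 1 - (y - e)" by simp_all
    show "odds ?\<alpha> = 1 / y - 1" "odds ?\<beta> = 1 / (y + e) - 1" "odds ?\<gamma> = 1 / (y - e) - 1"
      unfolding eq using odds[of y] odds[of "y + e"] odds[of "y - e"] y e by auto
  qed
  define R where "R t = Suc (nat \<lfloor>x * t\<rfloor>)" for t
  define \<rho> where "\<rho> t = real (R t) / t" for t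
  define \<sigma> where "\<sigma> t = real (R t div n) / t" for t
  have \<rho>: "(\<rho> \<longlongrightarrow> x) at_top" unfolding \<rho>_def[abs_def] R_def using x by (intro floor_ratio_tendsto) simp
  have \<sigma>: "(\<sigma> \<longlongrightarrow> x * \<delta>) at_top"
    using div_ratio_tendsto[OF \<rho>[unfolded \<rho>_def[abs_def]] n(1)] by (simp add: \<sigma>_def[abs_def] \<delta>_def)
  define b\<beta> where "b\<beta> t = \<rho> t * (odds ?\<alpha> - odds ?\<beta>) - (?\<alpha> - ?\<beta>) * (1 - 1 / real n) - \<rho> t / (1 - ?\<alpha>) / t" for t
  define b\<gamma> where "b\<gamma> t = (?\<gamma> - ?\<alpha>) * (1 - 1 / t) - (\<rho> t - \<sigma> t) * (odds ?\<gamma> - odds ?\<alpha>) - \<rho> t / (1 - ?\<alpha>) / t" for t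
  define \<omega> where "\<omega> t = 2 + 4 * \<rho> t / (1 - ?\<gamma>)\<^sup>2" for t
  have \<rho>t: "((\<lambda>t. \<rho> t / (1 - ?\<alpha>) / t) \<longlongrightarrow> 0) at_top"
  proof -
    have "((\<lambda>t. \<rho> t / (1 - ?\<alpha>) * (1 / t)) \<longlongrightarrow> x / (1 - ?\<alpha>) * 0) at_top"
      using y by (intro tendsto_intros \<rho> inv) auto
    then show ?thesis by simp
  qed
  define c\<beta> where "c\<beta> = x * (odds ?\<alpha> - odds ?\<beta>) - (?\<alpha> - ?\<beta>) * (1 - 1 / real n) - 0"
  define c\<gamma> where "c\<gamma> = (?\<gamma> - ?\<alpha>) * (1 - 0) - (x - x * \<delta>) * (odds ?\<gamma> - odds ?\<alpha>) - 0"
  have b\<beta>: "(b\<beta> \<longlongrightarrow> c\<beta>) at_top"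
    unfolding b\<beta>_def[abs_def] c\<beta>_def by (intro tendsto_intros \<rho> \<rho>t)
  have b\<gamma>: "(b\<gamma> \<longlongrightarrow> c\<gamma>) at_top"
    unfolding b\<gamma>_def[abs_def] c\<gamma>_def by (intro tendsto_intros \<rho> \<sigma> \<rho>t inv)
  have c\<beta>: "0 < c\<beta>"
  proof -
    have "u * u * (1 / u - 1 / (u + v)) = u * v / (u + v)" if "u \<noteq> 0" "u + v \<noteq> 0" for u v :: real
    proof -
      have "1 / u - 1 / (u + v) = v / (u * (u + v))" using that by (simp add: diff_frac_eq)
      then show ?thesis using that by simp
    qed
    from this[of y e] have "x * (1 / y - 1 / (y + e)) = y * e / (y + e)" using y e by simp
    then have "c\<beta> = y * e / (y + e) - e * (1 - \<delta>)" unfolding c\<beta>_def odds by (simp add: \<delta>_def)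
    moreover have "u * v / (u + v) - v * (1 - d) = v * (d * (u + v) - v) / (u + v)" if "u + v \<noteq> 0" for u v d :: real
      using that by (simp add: field_simps)
    from this[of y e \<delta>] have "y * e / (y + e) - e * (1 - \<delta>) = e * (\<delta> * (y + e) - e) / (y + e)"
      using y e by simp
    moreover have "0 < \<delta> * (y + e) - e"
    proof -
      have "\<delta> * (y + e) - e = e + \<delta> * e" by (simp add: e_def algebra_simps)
      then show ?thesis using add_pos_pos[OF e(1) mult_pos_pos[OF \<delta>(1) e(1)]] by linarith
    qed
    ultimately show ?thesis using e y by simp
  qed
  have c\<gamma>: "0 < c\<gamma>"
  proof -
    have "(u * u - u * u * d) * (1 / (u - v) - 1 / u) = u * (1 - d) * v / (u - v)"
      if "u \<noteq> 0" "u - v \<noteq> 0" for u v d :: real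
    proof -
      have "1 / (u - v) - 1 / u = v / (u * (u - v))" using that by (simp add: diff_frac_eq mult.commute)
      moreover have "u * u - u * u * d = u * u * (1 - d)" by (simp add: algebra_simps)
      ultimately show ?thesis using that by simp
    qed
    from this[of y e \<delta>] have "(x - x * \<delta>) * (1 / (y - e) - 1 / y) = y * (1 - \<delta>) * e / (y - e)"
      using y e by simp
    then have "c\<gamma> = e - y * (1 - \<delta>) * e / (y - e)" unfolding c\<gamma>_def odds by simp
    moreover have "v - u * (1 - d) * v / (u - v) = v * (u * d - v) / (u - v)" if "u - v \<noteq> 0" for u v d :: real
      using that by (simp add: field_simps)
    from this[of y e \<delta>] have "e - y * (1 - \<delta>) * e / (y - e) = e * (y * \<delta> - e) / (y - e)"
      using e by simp
    moreover have "y * \<delta> - e = e" by (simp add: e_def)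
    ultimately show ?thesis using e y by simp
  qed
  have \<omega>: "(\<omega> \<longlongrightarrow> 2 + 4 * x / (1 - ?\<gamma>)\<^sup>2) at_top"
    unfolding \<omega>_def[abs_def] using e by (intro tendsto_intros \<rho>) auto
  let ?U = "\<lambda>t. 1 / t + max 0 (1 / t + ?\<alpha> - \<rho> t * odds ?\<alpha> + \<rho> t / (1 - ?\<alpha>) / t + 1 / real n + \<sigma> t * odds ?\<alpha>)
     + 2 * (1 / sqrt t) + 11 * \<omega> t * (1 / sqrt t) + (10 * \<omega> t / (b\<beta> t)\<^sup>2 + 16 * \<omega> t / (b\<gamma> t)\<^sup>2) * (1 / t)"
  let ?w = "2 + 4 * x / (1 - ?\<gamma>)\<^sup>2"
  let ?m = "0 + ?\<alpha> - x * odds ?\<alpha> + 0 + 1 / real n + x * \<delta> * odds ?\<alpha>"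
  have "(?U \<longlongrightarrow> 0 + max 0 ?m + 2 * 0 + 11 * ?w * 0 + (10 * ?w / c\<beta>\<^sup>2 + 16 * ?w / c\<gamma>\<^sup>2) * 0) at_top"
    using c\<beta> c\<gamma> by (intro tendsto_intros tendsto_max inv sq \<rho> \<sigma> \<rho>t b\<beta> b\<gamma> \<omega>) auto
  moreover have "0 + max 0 ?m + 2 * 0 + 11 * ?w * 0 + (10 * ?w / c\<beta>\<^sup>2 + 16 * ?w / c\<gamma>\<^sup>2) * 0 < c"
  proof -
    have "?\<alpha> - x * odds ?\<alpha> = (1 - y)\<^sup>2"
      unfolding odds using y by (simp add: power2_eq_square field_simps)
    then have "?m < c" using n(3) by (simp add: \<delta>_def)
    moreover have "0 < c" using c by (smt (verit) zero_le_power2)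
    ultimately show ?thesis by simp
  qed
  ultimately have "eventually (\<lambda>t. ?U t < c) at_top" by (rule order_tendstoD(2))
  with order_tendstoD(1)[OF b\<beta> c\<beta>] order_tendstoD(1)[OF b\<gamma> c\<gamma>] eventually_gt_at_top[of 0]
  show ?thesis
  proof eventually_elim
    case (elim t)
    have "mj (nat \<lfloor>x * t\<rfloor>) t / t \<le> 1 / t + max 0 (1 / t + ?\<alpha> - \<rho> t * odds ?\<alpha> + \<rho> t / (1 - ?\<alpha>) / t + 1 / real n + \<sigma> t * odds ?\<alpha>)
     + 2 / sqrt t + 11 * \<omega> t / sqrt t + (10 * \<omega> t / (b\<beta> t)\<^sup>2 + 16 * \<omega> t / (b\<gamma> t)\<^sup>2) / t"
      unfolding \<rho>_def \<sigma>_def \<omega>_def b\<beta>_def b\<gamma>_def R_def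
      by (rule mj_le) (use elim n e y in \<open>auto simp: \<rho>_def \<sigma>_def \<omega>_def b\<beta>_def b\<gamma>_def R_def div_le_dividend simp del: of_nat_Suc\<close>)
    then show ?case using elim(4) by simp
  qed
qed

lemma mj_ratio_tendsto:
  assumes "0 < x" "x < 1"
  shows "((\<lambda>t. mj (nat \<lfloor>x * t\<rfloor>) t / t) \<longlongrightarrow> (1 - sqrt x)\<^sup>2) at_top"
  using mj_ratio_eventually_ge[OF assms] mj_ratio_eventually_le[OF assms] by (intro order_tendstoI) auto

text \<open>The means decrease in the index, so a particle beyond \<open>x = 1\<close> is dominated
  by one at some \<open>z < 1\<close> with \<open>(1 - sqrt z)^2 < c\<close>, where the upper bound
  already applies.\<close>

lemma mj_ratio_tendsto_0:
  assumes x: "1 < x"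
  shows "((\<lambda>t. mj (nat \<lfloor>x * t\<rfloor>) t / t) \<longlongrightarrow> 0) at_top"
proof (rule order_tendstoI)
  fix c :: real assume "c < 0"
  then have gt: "c < mj (nat \<lfloor>x * t\<rfloor>) t / t" if "0 < t" for t
    using that mj_nonneg[of "nat \<lfloor>x * t\<rfloor>" t] by (smt (verit) divide_nonneg_pos)
  show "eventually (\<lambda>t. c < mj (nat \<lfloor>x * t\<rfloor>) t / t) at_top"
    using eventually_gt_at_top[of 0] by eventually_elim (rule gt)
next
  fix c :: real assume c: "0 < c"
  have "((\<lambda>z. (1 - sqrt z)\<^sup>2) \<longlongrightarrow> (1 - sqrt 1)\<^sup>2) (at_left 1)"
    by (intro tendsto_intros)
  then have "eventually (\<lambda>z. (1 - sqrt z)\<^sup>2 < c) (at_left 1)"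
    using c by (intro order_tendstoD(2)) auto
  moreover have "eventually (\<lambda>z::real. 0 < z) (at_left 1)"
    using eventually_at_left_real[of 0 1] by (auto elim: eventually_mono)
  moreover have "eventually (\<lambda>z::real. z < 1) (at_left 1)"
    using eventually_at_left_real[of 0 1] by (auto elim: eventually_mono)
  ultimately have "eventually (\<lambda>z. (1 - sqrt z)\<^sup>2 < c \<and> 0 < z \<and> z < 1) (at_left (1 :: real))"
    by eventually_elim auto
  then obtain z where z: "(1 - sqrt z)\<^sup>2 < c" "0 < z" "z < 1"
    using eventually_happens'[of "at_left (1 :: real)"] by auto
  have "eventually (\<lambda>t. mj (nat \<lfloor>z * t\<rfloor>) t / t < c) at_top"
    by (rule mj_ratio_eventually_le[OF z(2,3,1)])
  then show "eventually (\<lambda>t. mj (nat \<lfloor>x * t\<rfloor>) t / t < c) at_top"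
    using eventually_gt_at_top[of 0]
  proof eventually_elim
    case (elim t)
    have "nat \<lfloor>z * t\<rfloor> \<le> nat \<lfloor>x * t\<rfloor>"
      using elim x z by (intro nat_mono floor_mono mult_right_mono) auto
    then have "mj (nat \<lfloor>x * t\<rfloor>) t / t \<le> mj (nat \<lfloor>z * t\<rfloor>) t / t"
      using elim by (intro divide_right_mono mj_antimono) auto
    then show ?case using elim by linarith
  qed
qed

end

section \<open>Summation over the particles\<close>

lemma suminf_eq_nn_integral_floor:
  fixes f :: "nat \<Rightarrow> ennreal"
  shows "(\<Sum>r. f r) = (\<integral>\<^sup>+(y::real). f (nat \<lfloor>y\<rfloor>) * indicator {0..} y \<partial>lborel)"
proof -
  let ?A = "\<lambda>r. {real r..<real r + 1}"
  have "disjoint_family ?A" by (auto simp: disjoint_family_on_def)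
  then have "(\<Sum>r. f r * indicator (?A r) y) = f (nat \<lfloor>y\<rfloor>)" if "0 \<le> y" for y :: real
    using that by (intro suminf_cmult_indicator) (auto simp: of_nat_nat)
  moreover have "(\<Sum>r. f r * indicator (?A r) y) = 0" if "y < 0" for y
    using that by (simp add: indicator_def)
  ultimately have eq: "f (nat \<lfloor>y\<rfloor>) * indicator {0..} y = (\<Sum>r. f r * indicator (?A r) y)" for y :: real
    by (cases "0 \<le> y") (auto simp: not_le)
  have "(\<integral>\<^sup>+(y::real). f (nat \<lfloor>y\<rfloor>) * indicator {0..} y \<partial>lborel) = (\<integral>\<^sup>+y. (\<Sum>r. f r * indicator (?A r) y) \<partial>lborel)"
    by (rule nn_integral_cong) (rule eq)
  also have "\<dots> = (\<Sum>r. \<integral>\<^sup>+y. f r * indicator (?A r) y \<partial>lborel)"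
    by (rule nn_integral_suminf) simp
  also have "\<dots> = (\<Sum>r. f r)" by (simp add: nn_integral_cmult)
  finally show ?thesis ..
qed

lemma nn_integral_profile:
  "(\<integral>\<^sup>+x. ennreal ((1 - sqrt x)\<^sup>2) * indicator {0..1} x \<partial>lborel) = ennreal (1 / 6)"
proof -
  \<comment> \<open>The square root is not differentiable at \<open>0\<close>, but
    \<open>h * sqrt h / h = sqrt h\<close> tends to \<open>0\<close> there; so the primitive is
    differentiable on the whole closed interval.\<close>
  have x_sqrt: "((\<lambda>x. x * sqrt x) has_real_derivative 3 / 2 * sqrt x) (at x)" if "0 \<le> x" for x
  proof (cases "x = 0")
    case True
    have "((\<lambda>h. ((0 + h) * sqrt (0 + h) - 0 * sqrt 0) / h) \<longlongrightarrow> 0) (at 0)"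
    proof (rule Lim_transform_eventually)
      show "(sqrt \<longlongrightarrow> 0) (at 0)" using isCont_real_sqrt[of 0] by (simp add: isCont_def)
      show "eventually (\<lambda>h. sqrt h = ((0 + h) * sqrt (0 + h) - 0 * sqrt 0) / h) (at 0)"
        using eventually_at_filter by (auto simp: eventually_at intro!: exI[of _ 1])
    qed
    then show ?thesis using True by (simp add: DERIV_def)
  next
    case False
    then have "0 < x" using that by simp
    have "((\<lambda>x. x * sqrt x) has_real_derivative 1 * sqrt x + inverse (sqrt x) / 2 * x) (at x)"
      using \<open>0 < x\<close> by (intro DERIV_mult DERIV_ident DERIV_real_sqrt)
    moreover have "1 * sqrt x + inverse (sqrt x) / 2 * x = 3 / 2 * sqrt x"
    proof -
      have "inverse (sqrt x) * x = sqrt x" using \<open>0 < x\<close> by (simp add: inverse_eq_divide real_div_sqrt)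
      then show ?thesis by simp
    qed
    ultimately show ?thesis by simp
  qed
  have "(\<integral>\<^sup>+x. ennreal ((1 - sqrt x)\<^sup>2) * indicator {0..1} x \<partial>lborel)
     = ennreal ((1 - 4 / 3 * (1 * sqrt 1) + 1\<^sup>2 / 2) - (0 - 4 / 3 * (0 * sqrt 0) + 0\<^sup>2 / 2))"
  proof (rule nn_integral_FTC_Icc[where F = "\<lambda>x. x - 4 / 3 * (x * sqrt x) + x\<^sup>2 / 2"])
    fix x :: real assume x: "x \<in> {0..1}"
    have "((\<lambda>x. x\<^sup>2 / 2) has_real_derivative x) (at x)" by (auto intro!: derivative_eq_intros)
    with x have "((\<lambda>x. x - 4 / 3 * (x * sqrt x) + x\<^sup>2 / 2) has_real_derivative 1 - 4 / 3 * (3 / 2 * sqrt x) + x) (at x)"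
      by (intro DERIV_add DERIV_diff DERIV_ident DERIV_cmult x_sqrt) auto
    moreover have "1 - 4 / 3 * (3 / 2 * sqrt x) + x = (1 - sqrt x)\<^sup>2"
      using x by (simp add: power2_diff)
    ultimately show "((\<lambda>x. x - 4 / 3 * (x * sqrt x) + x\<^sup>2 / 2) has_real_derivative (1 - sqrt x)\<^sup>2) (at x)"
      by simp
  qed auto
  then show ?thesis by simp
qed

context exponential_clocks
begin

text \<open>The sum over the particles is the integral of a step function. The substitution
  \<open>y = x * t\<close> yields one factor \<open>t\<close> and the scaling of \<open>mj\<close>
  the other; the integrand then has a pointwise limit.\<close>

lemma mean_total_jumps_ratio:
  assumes t: "0 < t"
  shows "(\<integral>\<^sup>+\<omega>. total_jumps (ws \<omega>) t \<partial>M) / ennreal (t\<^sup>2)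
    = (\<integral>\<^sup>+x. ennreal (mj (nat \<lfloor>x * t\<rfloor>) t / t) * indicator {0..} x \<partial>lborel)" (is "_ = ?J")
proof -
  have [measurable]: "(\<lambda>x::real. g (nat \<lfloor>x\<rfloor>) :: ennreal) \<in> borel_measurable borel" for g
    by (rule measurable_compose[OF measurable_real_floor, of "\<lambda>i. g (nat i)"]) simp
  have [measurable]: "(\<lambda>x. g (nat \<lfloor>x * t\<rfloor>) :: ennreal) \<in> borel_measurable borel" for g
    by (rule measurable_compose[OF _ \<open>(\<lambda>x::real. g (nat \<lfloor>x\<rfloor>) :: ennreal) \<in> borel_measurable borel\<close>, of "\<lambda>x. x * t"]) simp
  have "(\<integral>\<^sup>+\<omega>. total_jumps (ws \<omega>) t \<partial>M) = (\<Sum>r. mean_jumps r t)"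
    unfolding total_jumps_def mean_jumps_def
    by (rule nn_integral_suminf) (rule measurable_compose[OF measurable_jumps], simp)
  also have "\<dots> = (\<integral>\<^sup>+(y::real). ennreal (mj (nat \<lfloor>y\<rfloor>) t) * indicator {0..} y \<partial>lborel)"
    by (simp add: suminf_eq_nn_integral_floor ennreal_mj[OF t])
  also have "\<dots> = ennreal t * (\<integral>\<^sup>+x. ennreal (mj (nat \<lfloor>x * t\<rfloor>) t) * indicator {0..} (x * t) \<partial>lborel)"
    using t by (subst nn_integral_real_affine[of _ t 0]) (simp_all add: mult.commute)
  also have "(\<integral>\<^sup>+x. ennreal (mj (nat \<lfloor>x * t\<rfloor>) t) * indicator {0..} (x * t) \<partial>lborel)
     = (\<integral>\<^sup>+x. ennreal t * (ennreal (mj (nat \<lfloor>x * t\<rfloor>) t / t) * indicator {0..} x) \<partial>lborel)"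
  proof (rule nn_integral_cong)
    fix x
    have "ennreal (mj (nat \<lfloor>x * t\<rfloor>) t) = ennreal t * ennreal (mj (nat \<lfloor>x * t\<rfloor>) t / t)"
      using t mj_nonneg by (simp add: ennreal_mult[symmetric])
    moreover have "0 \<le> x * t \<longleftrightarrow> 0 \<le> x" using t by (simp add: zero_le_mult_iff)
    ultimately show "ennreal (mj (nat \<lfloor>x * t\<rfloor>) t) * indicator {0..} (x * t)
       = ennreal t * (ennreal (mj (nat \<lfloor>x * t\<rfloor>) t / t) * indicator {0..} x)"
      by (simp add: indicator_def mult.assoc)
  qed
  also have "\<dots> = ennreal t * ?J"
    by (rule nn_integral_cmult) measurable
  finally have "(\<integral>\<^sup>+\<omega>. total_jumps (ws \<omega>) t \<partial>M) = ?J * ennreal (t\<^sup>2)"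
    using t by (simp add: power2_eq_square ennreal_mult mult_ac)
  then show ?thesis using t by (simp add: mult_divide_eq_ennreal)
qed

text \<open>The constant \<open>4\<close> comes from \<open>exp 2 \<le> 9 \<le> 2 ^ 4\<close>. For
  \<open>x \<le> 4\<close> the ratio is at most \<open>1\<close>; beyond, the decay in the index
  gives \<open>2 powr ((4 - x) * t)\<close>, and \<open>1 \<le> t\<close> removes the dependence on
  \<open>t\<close>.\<close>

lemma mj_ratio_le:
  assumes "1 \<le> t" "0 \<le> x"
  shows "mj (nat \<lfloor>x * t\<rfloor>) t / t \<le> 2 powr (4 - x)"
proof (cases "x \<le> 4")
  case True
  have "mj (nat \<lfloor>x * t\<rfloor>) t / t \<le> 1" using mj_bounds(1)[of t "nat \<lfloor>x * t\<rfloor>"] assms by simp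
  also have "1 \<le> 2 powr (4 - x)" using True by (intro ge_one_powr_ge_zero) auto
  finally show ?thesis .
next
  case False
  have "exp (2 :: real) = exp 1 * exp 1" by (simp add: exp_add[symmetric])
  also have "\<dots> \<le> 3 * 3" using exp_le by (intro mult_mono) auto
  finally have "exp (2 :: real) \<le> 2 powr 4" by simp
  then have "exp 2 powr t \<le> (2 powr 4) powr t" using assms by (intro powr_mono2) auto
  also have "(2 powr 4) powr t = 2 powr (4 * t)" by (rule powr_powr)
  finally have e: "exp (2 * t) \<le> 2 powr (4 * t)" by (simp add: powr_def mult.commute)
  have "x * t \<le> real (Suc (nat \<lfloor>x * t\<rfloor>))" using assms by linarith
  then have p: "2 powr (x * t) \<le> 2 ^ Suc (nat \<lfloor>x * t\<rfloor>)"
    by (subst powr_realpow[symmetric]) (auto intro: powr_mono)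
  have "mj (nat \<lfloor>x * t\<rfloor>) t / t \<le> mj (nat \<lfloor>x * t\<rfloor>) t"
    using assms mj_nonneg[of "nat \<lfloor>x * t\<rfloor>" t] by (simp add: divide_le_eq mult_right_le_one_le mult_le_cancel_left1)
  also have "\<dots> \<le> exp (2 * t) / 2 ^ Suc (nat \<lfloor>x * t\<rfloor>)" using mj_bounds(2) assms by simp
  also have "\<dots> \<le> 2 powr (4 * t) / 2 powr (x * t)" using e p by (intro frac_le) auto
  also have "\<dots> = 2 powr ((4 - x) * t)" by (simp add: powr_diff[symmetric] algebra_simps)
  also have "\<dots> \<le> 2 powr (4 - x)"
  proof (rule powr_mono)
    show "(4 - x) * t \<le> 4 - x" using False assms mult_left_mono_neg[of 1 t "4 - x"] by simp
  qed simp
  finally show ?thesis .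
qed

lemma nn_integral_dominating: "(\<integral>\<^sup>+x. ennreal (2 powr (4 - x)) * indicator {0..} x \<partial>lborel) < \<infinity>"
proof -
  interpret E: prob_space "density lborel (exponential_density (ln 2))"
    by (rule prob_space_exponential_density) simp
  have "(\<integral>\<^sup>+x. ennreal (2 powr (4 - x)) * indicator {0..} x \<partial>lborel)
     = (\<integral>\<^sup>+x. ennreal (16 / ln 2) * ennreal (exponential_density (ln 2) x) \<partial>lborel)"
  proof (rule nn_integral_cong)
    fix x :: real
    have "2 powr (4 - x) = 16 / ln 2 * (ln 2 * exp (- x * ln 2))"
    proof -
      have "2 powr (4 - x) = 2 powr 4 * 2 powr (- x)" by (simp only: powr_add[symmetric]) simp
      moreover have "2 powr (- x) = exp (- x * ln 2)" by (simp add: powr_def)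
      ultimately show ?thesis by simp
    qed
    then show "ennreal (2 powr (4 - x)) * indicator {0..} x = ennreal (16 / ln 2) * ennreal (exponential_density (ln 2) x)"
      by (simp add: exponential_density_def ennreal_mult[symmetric] indicator_def)
  qed
  also have "\<dots> = ennreal (16 / ln 2) * (\<integral>\<^sup>+x. ennreal (exponential_density (ln 2) x) \<partial>lborel)"
    by (rule nn_integral_cmult) simp
  also have "(\<integral>\<^sup>+x. ennreal (exponential_density (ln 2) x) \<partial>lborel) = 1"
    using E.emeasure_space_1 by (simp add: emeasure_density)
  finally show ?thesis by simp
qed

lemma total_jumps_asymptotics:
  "((\<lambda>t. (\<integral>\<^sup>+\<omega>. total_jumps (ws \<omega>) t \<partial>M) / ennreal (t\<^sup>2)) \<longlongrightarrow> ennreal (1 / 6)) at_top"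
proof (rule tendsto_at_topI_sequentially)
  fix X :: "nat \<Rightarrow> real" assume X: "filterlim X at_top sequentially"
  \<comment> \<open>The domination is available for times at least \<open>1\<close>; the truncation
    alters only finitely many terms.\<close>
  define Y where "Y n = max 1 (X n)" for n
  have Y: "filterlim Y at_top sequentially"
    by (rule filterlim_at_top_mono[OF X]) (simp add: Y_def)
  have Y1: "1 \<le> Y n" for n by (simp add: Y_def)
  let ?u = "\<lambda>n x. ennreal (mj (nat \<lfloor>x * Y n\<rfloor>) (Y n) / Y n) * indicator {0..} x"
  let ?u' = "\<lambda>x. ennreal ((1 - sqrt x)\<^sup>2) * indicator {0..1} x"
  have "(\<lambda>n. \<integral>\<^sup>+x. ?u n x \<partial>lborel) \<longlonglongrightarrow> (\<integral>\<^sup>+x. ?u' x \<partial>lborel)"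
  proof (rule nn_integral_dominated_convergence)
    show "?u n \<in> borel_measurable lborel" for n
    proof -
      have "(\<lambda>x. mj (nat \<lfloor>x * Y n\<rfloor>) (Y n)) \<in> borel_measurable borel"
        by (rule measurable_compose[OF measurable_compose[OF _ measurable_real_floor], of "\<lambda>x. x * Y n" _ "\<lambda>i. mj (nat i) (Y n)"]) auto
      then show ?thesis by measurable
    qed
    show "(\<integral>\<^sup>+x. ennreal (2 powr (4 - x)) * indicator {0..} x \<partial>lborel) < \<infinity>"
      by (rule nn_integral_dominating)
    show "AE x in lborel. ?u n x \<le> ennreal (2 powr (4 - x)) * indicator {0..} x" for n
      using mj_ratio_le[OF Y1[of n]] by (intro AE_I2) (auto simp: indicator_def intro: ennreal_leI)
    show "AE x in lborel. (\<lambda>n. ?u n x) \<longlonglongrightarrow> ?u' x"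
      \<comment> \<open>The points \<open>0\<close> and \<open>1\<close>, not covered by the
        pointwise limits, form a null set.\<close>
      using AE_lborel_singleton[of 0] AE_lborel_singleton[of 1]
    proof eventually_elim
      case (elim x)
      consider "x < 0" | "0 < x" "x < 1" | "1 < x" using elim by linarith
      then show ?case
      proof cases
        case 2
        have "(\<lambda>n. mj (nat \<lfloor>x * Y n\<rfloor>) (Y n) / Y n) \<longlonglongrightarrow> (1 - sqrt x)\<^sup>2"
          by (rule filterlim_compose[OF mj_ratio_tendsto[OF 2] Y])
        then show ?thesis using 2 by (simp add: tendsto_ennrealI)
      next
        case 3
        have "(\<lambda>n. mj (nat \<lfloor>x * Y n\<rfloor>) (Y n) / Y n) \<longlonglongrightarrow> 0"
          by (rule filterlim_compose[OF mj_ratio_tendsto_0[OF 3] Y])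
        then have "(\<lambda>n. ennreal (mj (nat \<lfloor>x * Y n\<rfloor>) (Y n) / Y n)) \<longlonglongrightarrow> ennreal 0" by (rule tendsto_ennrealI)
        then show ?thesis using 3 by simp
      qed simp
    qed
  qed measurable
  then have lim: "(\<lambda>n. \<integral>\<^sup>+x. ?u n x \<partial>lborel) \<longlonglongrightarrow> ennreal (1 / 6)"
    by (simp only: nn_integral_profile)
  have "eventually (\<lambda>n. 1 \<le> X n) sequentially" using X by (simp add: filterlim_at_top)
  then have "eventually (\<lambda>n. (\<integral>\<^sup>+x. ?u n x \<partial>lborel) = (\<integral>\<^sup>+\<omega>. total_jumps (ws \<omega>) (X n) \<partial>M) / ennreal ((X n)\<^sup>2)) sequentially"
  proof eventually_elim
    case (elim n)
    then have "Y n = X n" "0 < X n" by (auto simp: Y_def)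
    then show ?case using mean_total_jumps_ratio[of "X n"] by simp
  qed
  with lim show "(\<lambda>n. (\<integral>\<^sup>+\<omega>. total_jumps (ws \<omega>) (X n) \<partial>M) / ennreal ((X n)\<^sup>2)) \<longlonglongrightarrow> ennreal (1 / 6)"
    by (rule Lim_transform_eventually)
qed

end

theorem theorem3p1:
  fixes M :: "'a measure" and W :: "nat \<Rightarrow> nat \<Rightarrow> 'a \<Rightarrow> real"
  assumes "prob_space M"
    and "prob_space.indep_vars M (\<lambda>_. borel) (\<lambda>(r, n). W r n) (UNIV :: (nat \<times> nat) set)"
    and "\<And>r n. distributed M lborel (W r n) (exponential_density 1)"
  shows "((\<lambda>t::real. (\<integral>\<^sup>+ \<omega>. total_jumps (\<lambda>r n. W r n \<omega>) t \<partial>M) / ennreal (t ^ 2))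
           \<longlongrightarrow> ennreal (1 / 6)) at_top"
proof -
  interpret exponential_clocks M W
    using assms by (simp add: exponential_clocks_def exponential_clocks_axioms_def)
  show ?thesis by (rule total_jumps_asymptotics)
qed

end
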